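(* Let $n$ and $k\ge 3$ be integers and let $\mathcal F\subset\binom{[n]}{k}$ be an almost intersecting family. Then $$|\mathcal F|\le \binom{n-1}{k-1}-\binom{n-k-1}{k-1}+2$$ holds in each of the following cases: (i) $k=3$ and $n\ge 13$; (ii) $k\ge 4$ and $n\ge 3k+3$; (iii) $k\ge 10$ and $n>2k+2\sqrt{k}+4$. Moreover, in these cases equality is only possible when $\mathcal F$ is isomorphic to $\mathcal B^+$.
   Context: $[n]=\{1,\dots,n\}$, $\binom{[n]}{k}$ denotes the set of all $k$-element subsets of $[n]$, and $[a,b]=\{a,a+1,\dots,b\}$. A family $\mathcal F$ of sets is intersecting if $F\cap G\neq\emptyset$ for all $F,G\in\mathcal F$. It is almost intersecting if it is not intersecting, but for every $F\in\mathcal F$ there is at most one $G\in\mathcal F$ with $F\cap G=\emptyset$. The Hilton–Milner family is $\mathcal B_{k+1}=\{B\in\binom{[n]}{k}:1\in B,\ B\cap[2,k+1]\neq\emptyset\}\cup\{[2,k+1]\}$. Let $B\in\binom{[n]}{k}$ be any set with $1\in B$ and $B\cap[2,k+1]=\emptyset$, and set $\mathcal B^+=\mathcal B_{k+1}\cup\{B\}$; it is almost intersecting and $|\mathcal B^+|=\binom{n-1}{k-1}-\binom{n-k-1}{k-1}+2$. Two families are isomorphic if one is obtained from the other by a permutation of the ground set $[n]$. *)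

theory Defs
  imports Complex_Main "HOL-Combinatorics.Permutations"
begin

definition ksubsets :: "nat \<Rightarrow> nat \<Rightarrow> nat set set" where
  "ksubsets n k = {F. F \<subseteq> {1..n} \<and> card F = k}"

definition intersecting :: "'a set set \<Rightarrow> bool" where
  "intersecting \<F> \<longleftrightarrow> (\<forall>F\<in>\<F>. \<forall>G\<in>\<F>. F \<inter> G \<noteq> {})"

definition almost_intersecting :: "'a set set \<Rightarrow> bool" where
  "almost_intersecting \<F> \<longleftrightarrow>
     \<not> intersecting \<F> \<and> (\<forall>F\<in>\<F>. \<exists>\<^sub>\<le>\<^sub>1 G. G \<in> \<F> \<and> F \<inter> G = {})"

definition hilton_milner :: "nat \<Rightarrow> nat \<Rightarrow> nat set set" where
  "hilton_milner n k =
     {B \<in> ksubsets n k. 1 \<in> B \<and> B \<inter> {2..k+1} \<noteq> {}} \<union> {{2..k+1}}"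

text \<open>The sets that may be added to the Hilton--Milner family to form the family
  \<open>\<B>\<^sup>+\<close>. Such sets exist as soon as \<open>1 \<le> k\<close> and \<open>2 * k \<le> n\<close>.\<close>

definition admissible_extra :: "nat \<Rightarrow> nat \<Rightarrow> nat set \<Rightarrow> bool" where
  "admissible_extra n k B \<longleftrightarrow> B \<in> ksubsets n k \<and> 1 \<in> B \<and> B \<inter> {2..k+1} = {}"

lemma admissible_extra_exists:
  assumes "1 \<le> k" "2 * k \<le> n"
  shows "\<exists>B. admissible_extra n k B"
proof
  show "admissible_extra n k (insert 1 {k+2..2*k})"
    using assms by (auto simp: admissible_extra_def ksubsets_def)
qed

definition B_plus :: "nat \<Rightarrow> nat \<Rightarrow> nat set \<Rightarrow> nat set set" where
  "B_plus n k B = hilton_milner n k \<union> {B}"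

definition isomorphic_families :: "nat \<Rightarrow> nat set set \<Rightarrow> nat set set \<Rightarrow> bool" where
  "isomorphic_families n \<F> \<G> \<longleftrightarrow> (\<exists>\<pi>. \<pi> permutes {1..n} \<and> \<G> = (\<lambda>F. \<pi> ` F) ` \<F>)"

end

theory Submission
  imports Defs
begin

text \<open>
  For a point \<open>x\<close>, the sets of \<open>\<F>\<close> avoiding \<open>x\<close> and the sets containing \<open>x\<close> that have no disjoint partner
  form a cross-intersecting pair, so the Kruskal--Katona theorem bounds \<open>|\<F>|\<close> in terms of the number
  \<open>a\<close> of sets avoiding \<open>x\<close>. The number of sets containing \<open>x\<close> that do have a partner is at most \<open>a\<close>, and,
  by Bollobas' set-pair inequality, at most \<open>M = (2k - 1 choose k - 1)\<close>. For \<open>2 \<le> a \<le> (n - 3 choose k - 2)\<close>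
  the resulting bound is smaller than claimed, and for \<open>a = 1\<close> it is attained only by \<open>\<B>\<^sup>+\<close>.

  It remains to find a point \<open>x\<close> with small \<open>a\<close>. Deleting one set from each disjoint pair leaves an
  intersecting family with at least \<open>|\<F>| - M\<close> members. If no point is heavy for it, left-shifting either
  keeps this property or already contradicts the size of the family; and in a shifted intersecting
  family at least half of the sets contain \<open>1\<close>, which together with Kruskal--Katona is again a
  contradiction. For \<open>k = 3\<close> a point of maximum degree works directly.
\<close>

section \<open>Shifting and the Kruskal--Katona theorem\<close>

text \<open>Shifting destroys the almost intersecting property, so it is applied to an intersecting
  subfamily only; the price is the additive term \<open>M\<close>. The threshold
  \<open>(n - 3 choose k - 2)\<close> comes from the family of all k-sets with at least two points
  in a fixed triple: so many of its sets avoid a given point of the triple. Several size comparisons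
  below are comparisons with this family. Once \<open>a\<close> is below the threshold, two bounds
  on the sets with a partner are played off against each other. For small \<open>a\<close> their
  number is at most \<open>a\<close>, so \<open>|\<F>|\<close> is at most \<open>2 a\<close> plus
  the number of partnerless sets, and Kruskal--Katona has to lose more than 2 sets per unit of
  \<open>a\<close>. For larger \<open>a\<close> the constant \<open>M\<close> is better, and a loss
  of 1 per unit suffices. The crossover is a free parameter, chosen differently for n \<ge> 3k + 3
  and for n close to 2k. The case k = 4 needs a separate count, because the general estimate for
  shifted families is too weak there for n = 15.\<close>

definition cross_intersecting :: "'a set set \<Rightarrow> 'a set set \<Rightarrow> bool" where
  "cross_intersecting \<A> \<B> \<longleftrightarrow> (\<forall>A\<in>\<A>. \<forall>B\<in>\<B>. A \<inter> B \<noteq> {})"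

text \<open>Order of the arguments: \<open>y\<close> comes in and \<open>v\<close> goes out.
  Blocking a replacement whose result is already present makes the map injective on the
  family.\<close>

definition shift_set :: "'a \<Rightarrow> 'a \<Rightarrow> 'a set set \<Rightarrow> 'a set \<Rightarrow> 'a set" where
  "shift_set y v \<A> S =
     (if v \<in> S \<and> y \<notin> S \<and> insert y (S - {v}) \<notin> \<A> then insert y (S - {v}) else S)"

definition shift :: "'a \<Rightarrow> 'a \<Rightarrow> 'a set set \<Rightarrow> 'a set set" where
  "shift y v \<A> = shift_set y v \<A> ` \<A>"

lemma inj_on_shift_set: "inj_on (shift_set y v \<A>) \<A>"
proof (rule inj_onI)
  fix S T assume "S \<in> \<A>" "T \<in> \<A>" and eq: "shift_set y v \<A> S = shift_set y v \<A> T"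
  then show "S = T"
    unfolding shift_set_def
    by (auto split: if_splits)
qed

lemma card_shift: "card (shift y v \<A>) = card \<A>"
  unfolding shift_def by (rule card_image[OF inj_on_shift_set])

lemma shift_subsets:
  assumes "\<A> \<subseteq> {S. S \<subseteq> V \<and> card S = p}" "finite V" "y \<in> V"
  shows "shift y v \<A> \<subseteq> {S. S \<subseteq> V \<and> card S = p}"
proof
  fix T assume "T \<in> shift y v \<A>"
  then obtain S where S: "S \<in> \<A>" "T = shift_set y v \<A> S" unfolding shift_def by auto
  have "S \<subseteq> V" "card S = p" using S assms by auto
  moreover have "finite S" using calculation assms finite_subset by auto
  moreover have "card (insert y (S - {v})) = card S" if "v \<in> S" "y \<notin> S"
    using that \<open>finite S\<close> by (metis card_Suc_Diff1 card_insert_disjoint Diff_iff finite_Diff)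
  ultimately show "T \<in> {S. S \<subseteq> V \<and> card S = p}"
    using S assms unfolding shift_set_def by auto
qed

lemma cross_intersecting_sym: "cross_intersecting \<A> \<B> \<Longrightarrow> cross_intersecting \<B> \<A>"
  unfolding cross_intersecting_def by blast

lemma intersecting_iff_cross: "intersecting \<A> \<longleftrightarrow> cross_intersecting \<A> \<A>"
  unfolding cross_intersecting_def intersecting_def by blast

text \<open>The critical case is that \<open>S\<close> and \<open>T\<close> meet in \<open>v\<close>
  alone. Then \<open>T\<close> stayed in place only because its own replacement is in
  \<open>\<B>\<close>; that set must meet \<open>S\<close>, and it can do so neither in
  \<open>y\<close> nor in \<open>v\<close>.\<close>

lemma shift_set_meets:
  assumes "cross_intersecting \<A> \<B>" "S \<in> \<A>" "T \<in> \<B>"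
    and "shift_set y v \<A> S \<noteq> S" "shift_set y v \<B> T = T"
  shows "shift_set y v \<A> S \<inter> T \<noteq> {}"
proof -
  have S: "v \<in> S" "y \<notin> S" "shift_set y v \<A> S = insert y (S - {v})"
    using assms(4) unfolding shift_set_def by (auto split: if_splits)
  have ST: "S \<inter> T \<noteq> {}" using assms unfolding cross_intersecting_def by auto
  show ?thesis
  proof (cases "y \<in> T \<or> (S - {v}) \<inter> T \<noteq> {}")
    case True then show ?thesis using S by auto
  next
    case False
    then have "v \<in> T" "y \<notin> T" using ST by auto
    then have "insert y (T - {v}) \<in> \<B>"
      using assms(5) unfolding shift_set_def by (auto split: if_splits)
    then have "S \<inter> insert y (T - {v}) \<noteq> {}"
      using assms(1,2) unfolding cross_intersecting_def by blast
    then show ?thesis using False S by auto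
  qed
qed

lemma cross_intersecting_shift:
  assumes "cross_intersecting \<A> \<B>"
  shows "cross_intersecting (shift y v \<A>) (shift y v \<B>)"
  unfolding cross_intersecting_def shift_def
proof (intro ballI; elim imageE)
  fix A B S T assume *: "S \<in> \<A>" "T \<in> \<B>" "A = shift_set y v \<A> S" "B = shift_set y v \<B> T"
  consider "A = S" "B = T" | "A \<noteq> S" "B = T" | "A = S" "B \<noteq> T" | "A \<noteq> S" "B \<noteq> T" by blast
  then show "A \<inter> B \<noteq> {}"
  proof cases
    case 1 then show ?thesis using assms * unfolding cross_intersecting_def by auto
  next
    case 2 then show ?thesis using shift_set_meets[OF assms *(1,2)] * by auto
  next
    case 3 then show ?thesis
      using shift_set_meets[OF cross_intersecting_sym[OF assms] *(2,1)] * by auto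
  next
    case 4 then have "y \<in> A" "y \<in> B" using * unfolding shift_set_def by (auto split: if_splits)
    then show ?thesis by auto
  qed
qed

lemma intersecting_shift: "intersecting \<A> \<Longrightarrow> intersecting (shift y v \<A>)"
  by (simp add: intersecting_iff_cross cross_intersecting_shift)

lemma finite_subsets: "finite V \<Longrightarrow> \<A> \<subseteq> {S. S \<subseteq> V \<and> card S = p} \<Longrightarrow> finite \<A>"
  by (rule finite_subset[of _ "Pow V"]) auto

text \<open>All shifts lead out of the single point \<open>v\<close>. Each one that changes
  \<open>\<A>\<close> lowers the number of its members through \<open>v\<close>, so a pair
  minimising this number is stable. The second family is shifted along only to remain
  cross-intersecting.\<close>

lemma stable_pair_exists:
  assumes V: "finite V" and v: "v \<in> V"
    and "\<A> \<subseteq> {S. S \<subseteq> V \<and> card S = p}" "\<B> \<subseteq> {S. S \<subseteq> V \<and> card S = q}"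
    and "cross_intersecting \<A> \<B>"
  obtains \<A>' \<B>' where "\<A>' \<subseteq> {S. S \<subseteq> V \<and> card S = p}" "\<B>' \<subseteq> {S. S \<subseteq> V \<and> card S = q}"
    "cross_intersecting \<A>' \<B>'" "card \<A>' = card \<A>" "card \<B>' = card \<B>"
    "\<forall>S\<in>\<A>'. \<forall>y\<in>V. v \<in> S \<longrightarrow> y \<notin> S \<longrightarrow> insert y (S - {v}) \<in> \<A>'"
proof -
  define good where "good = (\<lambda>(\<A>', \<B>'). \<A>' \<subseteq> {S. S \<subseteq> V \<and> card S = p} \<and>
    \<B>' \<subseteq> {S. S \<subseteq> V \<and> card S = q} \<and> cross_intersecting \<A>' \<B>' \<and> card \<A>' = card \<A> \<and> card \<B>' = card \<B>)"
  define \<mu> where "\<mu> = (\<lambda>(\<A>' :: 'a set set, \<B>' :: 'a set set). card {S\<in>\<A>'. v \<in> S})"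
  have "good (\<A>, \<B>)" using assms unfolding good_def by auto
  then obtain P where P: "good P" "\<And>Q. good Q \<Longrightarrow> \<mu> P \<le> \<mu> Q"
    using ex_has_least_nat[of good "(\<A>, \<B>)" \<mu>] by auto
  obtain \<A>' \<B>' where PP: "P = (\<A>', \<B>')" by (cases P)
  have fin: "finite \<A>'" using P(1) V finite_subsets unfolding PP good_def by auto
  show thesis
  proof (rule that[of \<A>' \<B>'])
    show "\<forall>S\<in>\<A>'. \<forall>y\<in>V. v \<in> S \<longrightarrow> y \<notin> S \<longrightarrow> insert y (S - {v}) \<in> \<A>'"
    proof (intro ballI impI)
      fix S y assume S: "S \<in> \<A>'" "y \<in> V" "v \<in> S" "y \<notin> S"
      show "insert y (S - {v}) \<in> \<A>'"
      proof (rule ccontr)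
        assume new: "insert y (S - {v}) \<notin> \<A>'"
        have "good (shift y v \<A>', shift y v \<B>')"
          using P(1) S shift_subsets[of \<A>' V p y v] shift_subsets[of \<B>' V q y v] V
          unfolding PP good_def by (auto simp: card_shift cross_intersecting_shift)
        then have "\<mu> P \<le> \<mu> (shift y v \<A>', shift y v \<B>')" by (rule P(2))
        then have le: "card {S\<in>\<A>'. v \<in> S} \<le> card {S\<in>shift y v \<A>'. v \<in> S}"
          unfolding \<mu>_def PP by simp
        have yv: "y \<noteq> v" using S by auto
        have "{S\<in>shift y v \<A>'. v \<in> S} \<subseteq> {S\<in>\<A>'. v \<in> S} - {S}"
        proof
          fix T assume "T \<in> {S\<in>shift y v \<A>'. v \<in> S}"
          then obtain U where U: "U \<in> \<A>'" "T = shift_set y v \<A>' U" "v \<in> T"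
            unfolding shift_def by auto
          then have "T = U" "U \<noteq> S" using yv S new unfolding shift_set_def by (auto split: if_splits)
          then show "T \<in> {S\<in>\<A>'. v \<in> S} - {S}" using U by auto
        qed
        then have "card {S\<in>shift y v \<A>'. v \<in> S} < card {S\<in>\<A>'. v \<in> S}"
          using S fin by (intro psubset_card_mono) auto
        then show False using le by simp
      qed
    qed
  qed (use P(1) in \<open>auto simp: PP good_def\<close>)
qed

lemma card_link:
  shows "card ((\<lambda>S. S - {v}) ` {S\<in>\<A>. v \<in> S}) = card {S\<in>\<A>. v \<in> S}"
  by (rule card_image) (auto simp: inj_on_def)

lemma card_split_at:
  assumes "finite \<A>"
  shows "card \<A> = card {S\<in>\<A>. v \<notin> S} + card ((\<lambda>S. S - {v}) ` {S\<in>\<A>. v \<in> S})"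
proof -
  have "\<A> = {S\<in>\<A>. v \<notin> S} \<union> {S\<in>\<A>. v \<in> S}" by auto
  then have "card \<A> = card {S\<in>\<A>. v \<notin> S} + card {S\<in>\<A>. v \<in> S}"
    using assms by (metis (no_types, lifting) card_Un_disjoint disjoint_iff finite_Un mem_Collect_eq)
  then show ?thesis by (simp add: card_link)
qed

lemma link_subsets:
  assumes "\<A> \<subseteq> {S. S \<subseteq> V \<and> card S = Suc p}"
  shows "(\<lambda>S. S - {v}) ` {S\<in>\<A>. v \<in> S} \<subseteq> {S. S \<subseteq> V - {v} \<and> card S = p}"
  using assms by auto

text \<open>The base case \<open>q = r\<close> of the Kruskal--Katona induction: complements of
  members of \<open>\<A>\<close> are q-sets outside \<open>\<B>\<close>.\<close>

lemma complements_cross: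
  assumes "finite V" "card V = p + q" "\<A> \<subseteq> {S. S \<subseteq> V \<and> card S = p}"
    "\<B> \<subseteq> {S. S \<subseteq> V \<and> card S = q}" "cross_intersecting \<A> \<B>"
  shows "card \<A> + card \<B> \<le> card V choose q"
proof -
  let ?c = "\<lambda>S. V - S"
  have inj: "inj_on ?c \<A>" using assms(3) by (intro inj_onI) (metis (no_types, lifting) double_diff mem_Collect_eq order_refl subsetD)
  have sub: "?c ` \<A> \<subseteq> {S. S \<subseteq> V \<and> card S = q}"
    using assms(1,2,3) by (auto simp: card_Diff_subset finite_subset)
  have disj: "?c ` \<A> \<inter> \<B> = {}" using assms(5) unfolding cross_intersecting_def by fastforce
  have f: "finite (?c ` \<A>)" "finite \<B>" using finite_subsets[OF assms(1) sub] finite_subsets[OF assms(1,4)] by auto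
  have "card \<A> + card \<B> = card (?c ` \<A> \<union> \<B>)" using disj f inj by (simp add: card_Un_disjoint card_image)
  also have "\<dots> \<le> card {S. S \<subseteq> V \<and> card S = q}"
    using sub assms(1,4) by (intro card_mono) auto
  also have "\<dots> = card V choose q" using assms(1) by (rule n_subsets)
  finally show ?thesis .
qed

text \<open>A point on the segment between the binomial coefficients at \<open>x\<close> and
  \<open>Suc x\<close>. It replaces the coefficient with a real upper argument in Lovasz's form of
  the Kruskal--Katona theorem.\<close>

definition interp :: "real \<Rightarrow> nat \<Rightarrow> nat \<Rightarrow> real" where
  "interp \<beta> x r = (1 - \<beta>) * real (x choose r) + \<beta> * real (Suc x choose r)"

lemma interp_Suc_Suc: "interp \<beta> (Suc x) (Suc r) = interp \<beta> x (Suc r) + interp \<beta> x r"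
  unfolding interp_def by (simp add: algebra_simps)

lemma interp_nonneg: "0 \<le> \<beta> \<Longrightarrow> \<beta> \<le> 1 \<Longrightarrow> 0 \<le> interp \<beta> x r"
  unfolding interp_def by simp

lemma interp_ge_one:
  assumes "0 \<le> \<beta>" "\<beta> \<le> 1" "r \<le> x"
  shows "1 \<le> interp \<beta> x r"
proof -
  have "1 \<le> real (x choose r)" "1 \<le> real (Suc x choose r)"
    using assms(3) by (metis One_nat_def Suc_leI le_Suc_eq of_nat_1 of_nat_mono zero_less_binomial)+
  then have "(1 - \<beta>) * 1 + \<beta> * 1 \<le> interp \<beta> x r"
    unfolding interp_def using assms by (intro add_mono mult_left_mono) auto
  then show ?thesis by simp
qed

text \<open>The interpolated coefficients still obey Pascal's rule, and this is all that Frankl's inductive proof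
  of the Kruskal--Katona theorem uses. Passing to complements turns shadows into cross-intersecting
  families: \<open>r\<close> is the size of the complement of a member of \<open>\<A>\<close>.\<close>

lemma kruskal_katona_cross:
  fixes \<A> \<B> :: "'a set set" and \<beta> :: real
  assumes "finite V" "card V = p + r" "q \<le> r" "r \<le> x"
    and "\<A> \<subseteq> {S. S \<subseteq> V \<and> card S = p}" "\<B> \<subseteq> {S. S \<subseteq> V \<and> card S = q}"
    and "cross_intersecting \<A> \<B>" "0 \<le> \<beta>" "\<beta> \<le> 1"
    and "interp \<beta> x r \<le> real (card \<A>)"
  shows "real (card \<B>) + interp \<beta> x q \<le> real (card V choose q)"
  using assms
proof (induction "card V" arbitrary: V p r q x \<A> \<B> rule: less_induct)
  case less
  note fV = \<open>finite V\<close> and cV = \<open>card V = p + r\<close>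
  consider (eq) "q = r" | (zero) "q = 0" "q < r" | (step) "0 < q" "q < r"
    using \<open>q \<le> r\<close> by linarith
  then show ?case
  proof cases
    case eq
    have "card \<A> + card \<B> \<le> card V choose q"
      using complements_cross[of V p q \<A> \<B>] less.prems eq by auto
    then have "real (card \<A>) + real (card \<B>) \<le> real (card V choose q)"
      by (metis of_nat_add of_nat_mono)
    then show ?thesis using less.prems(10) eq by simp
  next
    case zero
    have "1 \<le> real (card \<A>)" using interp_ge_one[of \<beta> r x] less.prems by linarith
    then have "\<A> \<noteq> {}" by auto
    have "B = {}" if "B \<in> \<B>" for B
    proof -
      have "B \<subseteq> V" "card B = 0" using that less.prems(6) zero by auto
      then show ?thesis using fV finite_subset card_eq_0_iff by metis
    qed
    then have "\<B> \<subseteq> {{}}" by auto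
    then have "\<B> = {}" using \<open>\<A> \<noteq> {}\<close> less.prems(7) unfolding cross_intersecting_def by auto
    then show ?thesis using zero by (simp add: interp_def)
  next
    case step
    obtain q' where q': "q = Suc q'" using step by (cases q) auto
    obtain r' where r': "r = Suc r'" using step by (cases r) auto
    obtain x' where x': "x = Suc x'" using \<open>r \<le> x\<close> r' by (cases x) auto
    have "V \<noteq> {}" using cV r' by auto
    then obtain v where v: "v \<in> V" by auto
    define V' where "V' = V - {v}"
    have V': "finite V'" "card V' = p + r'" "card V' < card V" "card V = Suc (card V')"
      unfolding V'_def using fV cV v r' by auto
    obtain \<A>' \<B>' where A': "\<A>' \<subseteq> {S. S \<subseteq> V \<and> card S = p}" "\<B>' \<subseteq> {S. S \<subseteq> V \<and> card S = q}"
      "cross_intersecting \<A>' \<B>'" "card \<A>' = card \<A>" "card \<B>' = card \<B>"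
      and stable: "\<forall>S\<in>\<A>'. \<forall>y\<in>V. v \<in> S \<longrightarrow> y \<notin> S \<longrightarrow> insert y (S - {v}) \<in> \<A>'"
      by (rule stable_pair_exists[OF fV v less.prems(5,6,7)])
    define A0 where "A0 = {S\<in>\<A>'. v \<notin> S}"
    define A1 where "A1 = (\<lambda>S. S - {v}) ` {S\<in>\<A>'. v \<in> S}"
    define B0 where "B0 = {S\<in>\<B>'. v \<notin> S}"
    define B1 where "B1 = (\<lambda>S. S - {v}) ` {S\<in>\<B>'. v \<in> S}"
    have finA: "finite \<A>'" "finite \<B>'" 
      using finite_subsets[OF fV A'(1)] finite_subsets[OF fV A'(2)] by auto
    have cA: "card \<A> = card A0 + card A1" and cB: "card \<B> = card B0 + card B1"
      using card_split_at[OF finA(1), of v] card_split_at[OF finA(2), of v] A'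
      unfolding A0_def A1_def B0_def B1_def by auto
    have sub: "A0 \<subseteq> {S. S \<subseteq> V' \<and> card S = p}" "B0 \<subseteq> {S. S \<subseteq> V' \<and> card S = q}"
      "B1 \<subseteq> {S. S \<subseteq> V' \<and> card S = q'}"
      using A'(1,2) link_subsets[of \<B>' V q' v] q' unfolding A0_def B0_def B1_def V'_def by auto
    have fA0: "finite A0" using finA unfolding A0_def by auto
    have cross: "cross_intersecting A0 B0" "cross_intersecting A0 B1"
      using A'(3) unfolding A0_def B0_def B1_def cross_intersecting_def by auto
    have up: "insert y S \<in> A0" if "S \<in> A1" "y \<in> V'" "y \<notin> S" for S y
      using that stable unfolding A1_def A0_def V'_def by auto
    \<comment> \<open>If \<open>A0\<close> were too small, Pascal's rule would make
      \<open>A1\<close> large. By induction the complements of \<open>A1\<close>, which are r-sets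
      in \<open>V'\<close>, would then have a large shadow on level \<open>r'\<close>, and stability
      puts the complements of that shadow into \<open>A0\<close>.\<close>
    have claim: "interp \<beta> x' r' \<le> real (card A0)"
    proof (rule ccontr)
      assume neg: "\<not> ?thesis"
      have "interp \<beta> x' r + interp \<beta> x' r' \<le> real (card A0) + real (card A1)"
        using less.prems(10) cA interp_Suc_Suc[of \<beta> x' r'] x' r' by simp
      then have big: "interp \<beta> x' r < real (card A1)" using neg by linarith
      have "0 < card A1" using big interp_nonneg[OF less.prems(8,9), of x' r] by linarith
      then have "A1 \<noteq> {}" by auto
      then obtain S where S: "S \<in> A1" by auto
      then have "0 < p" using A'(1) fV unfolding A1_def
        by (auto simp: card_gt_0_iff finite_subset)
      then obtain p' where p': "p = Suc p'" by (cases p) auto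
      have A1s: "A1 \<subseteq> {S. S \<subseteq> V' \<and> card S = p'}"
        using link_subsets[of \<A>' V p' v] A' p' unfolding A1_def V'_def by auto
      show False
      proof (cases "r \<le> x'")
        case True
        \<comment> \<open>The r'-sets outside \<open>B'\<close> form the shadow: each misses some
          \<open>T\<close> in \<open>A1\<close>, and its complement in \<open>V'\<close> is
          \<open>T\<close> with one point added.\<close>
        define B' where "B' = {D. D \<subseteq> V' \<and> card D = r' \<and> (\<forall>T\<in>A1. T \<inter> D \<noteq> {})}"
        have "real (card B') + interp \<beta> x' r' \<le> real (card V' choose r')"
        proof (rule less.hyps[OF V'(3,1), of p' r r' x' A1 B'])
          show "cross_intersecting A1 B'" unfolding B'_def cross_intersecting_def by auto
        qed (use V' p' r' True A1s big less.prems in \<open>auto simp: B'_def\<close>)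
        moreover have "card V' choose r' \<le> card B' + card A0"
        proof -
          let ?D = "{D. D \<subseteq> V' \<and> card D = r'}"
          have fD: "finite ?D" using V' by auto
          have "card (?D - B') \<le> card A0"
          proof (rule card_inj_on_le[of "\<lambda>D. V' - D"])
            show "inj_on (\<lambda>D. V' - D) (?D - B')"
              by (intro inj_onI) (metis (no_types, lifting) DiffD1 double_diff mem_Collect_eq order_refl)
            show "(\<lambda>D. V' - D) ` (?D - B') \<subseteq> A0"
            proof
              fix U assume "U \<in> (\<lambda>D. V' - D) ` (?D - B')"
              then obtain D where D: "U = V' - D" "D \<subseteq> V'" "card D = r'" "D \<notin> B'" by auto
              then obtain T where T: "T \<in> A1" "T \<inter> D = {}" unfolding B'_def by auto
              have TV: "T \<subseteq> V'" "card T = p'" using T A1s by auto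
              have "card U = p" using D V' by (simp add: card_Diff_subset finite_subset)
              moreover have "T \<subseteq> U" using TV T D by auto
              moreover have "finite U" using D V' by auto
              ultimately have "card (U - T) = 1" using TV p' by (simp add: card_Diff_subset finite_subset)
              then obtain y where y: "U - T = {y}" by (auto simp: card_1_singleton_iff)
              then have "U = insert y T" using \<open>T \<subseteq> U\<close> by auto
              moreover have "y \<in> V'" "y \<notin> T" using y D by auto
              ultimately show "U \<in> A0" using up T by auto
            qed
          qed (rule fA0)
          moreover have "B' \<subseteq> ?D" unfolding B'_def by auto
          then have "card (?D - B') = card ?D - card B'" "card B' \<le> card ?D"
            using fD by (auto intro: card_Diff_subset finite_subset card_mono)
          ultimately show ?thesis using n_subsets[OF V'(1), of r'] by simp
        qed
        ultimately show False using neg by linarith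
      next
        case False
        \<comment> \<open>Now \<open>x' < r\<close>, out of reach of the induction hypothesis. A
          single member of \<open>A1\<close> already has \<open>r\<close> one-point extensions, all
          in \<open>A0\<close>, and only \<open>1 + \<beta> r'\<close> are required.\<close>
        then have xr: "x' = r'" using less.prems(4) x' r' by auto
        have SV: "S \<subseteq> V'" "card S = p'" using S A1s by auto
        have "card (V' - S) = r" using SV V' p' r' by (simp add: card_Diff_subset finite_subset)
        moreover have "card (V' - S) \<le> card A0"
        proof (rule card_inj_on_le[of "\<lambda>y. insert y S"])
          show "inj_on (\<lambda>y. insert y S) (V' - S)" by (auto simp: inj_on_def)
        qed (use up S fA0 in auto)
        ultimately have "r \<le> card A0" by simp
        moreover have "interp \<beta> x' r' \<le> real r"
        proof -
          have "interp \<beta> r' r' = 1 + \<beta> * real r'" unfolding interp_def by (simp add: algebra_simps)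
          also have "\<dots> \<le> 1 + 1 * real r'" using less.prems(9) by (intro add_mono mult_right_mono) auto
          finally show ?thesis using xr r' by simp
        qed
        ultimately show False using neg by linarith
      qed
    qed
    have 1: "real (card B0) + interp \<beta> x' q \<le> real (card V' choose q)"
      by (rule less.hyps[OF V'(3,1,2), of q x' A0 B0])
        (use step r' x' less.prems sub cross claim in auto)
    have 2: "real (card B1) + interp \<beta> x' q' \<le> real (card V' choose q')"
      by (rule less.hyps[OF V'(3,1,2), of q' x' A0 B1])
        (use step r' x' q' less.prems sub cross claim in auto)
    have "real (card V choose q) = real (card V' choose q) + real (card V' choose q')"
      using V'(4) q' by simp
    then show ?thesis using 1 2 cB interp_Suc_Suc[of \<beta> x' q'] q' x' by simp
  qed
qed

text \<open>The bound is piecewise linear in the size of the first family, so a linear estimate only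
  has to be checked at the binomial coefficients.\<close>

lemma kruskal_katona_linear:
  fixes \<A> \<B> :: "'a set set" and \<kappa> \<mu> :: real
  assumes "finite V" "card V = p + r" "q \<le> r" "r \<le> x0" "x0 \<le> x1"
    and "\<A> \<subseteq> {S. S \<subseteq> V \<and> card S = p}" "\<B> \<subseteq> {S. S \<subseteq> V \<and> card S = q}"
    and "cross_intersecting \<A> \<B>"
    and lo: "x0 choose r \<le> card \<A>" and hi: "card \<A> \<le> x1 choose r"
    and lin: "\<And>x. x0 \<le> x \<Longrightarrow> x \<le> x1 \<Longrightarrow> \<kappa> * real (x choose r) + \<mu> \<le> real (x choose q)"
  shows "real (card \<B>) + \<kappa> * real (card \<A>) + \<mu> \<le> real (card V choose q)"
proof -
  have fin: "interp 0 x s = real (x choose s)" for x s by (simp add: interp_def)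
  show ?thesis
  proof (cases "card \<A> = x1 choose r")
    case True
    have "real (card \<B>) + interp 0 x1 q \<le> real (card V choose q)"
      by (rule kruskal_katona_cross[of V p r q x1 \<A> \<B> 0]) (use assms True in \<open>auto simp: fin\<close>)
    then show ?thesis using lin[of x1] assms(5) True by (simp add: fin)
  next
    case False
    \<comment> \<open>The largest coefficient not above \<open>card \<A>\<close> selects the
      segment, and \<open>\<beta>\<close> below selects the point on it at which
      \<open>interp \<beta> x r\<close> equals \<open>card \<A>\<close> exactly.\<close>
    define x where "x = (GREATEST x. x \<le> x1 \<and> x choose r \<le> card \<A>)"
    have ex: "x0 \<le> x1 \<and> x0 choose r \<le> card \<A>" using assms by auto
    have x: "x \<le> x1 \<and> x choose r \<le> card \<A>"
      unfolding x_def by (rule GreatestI_nat[of _ x0 x1]) (use ex in auto)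
    have x0x: "x0 \<le> x" unfolding x_def by (rule Greatest_le_nat[of _ _ x1]) (use ex in auto)
    have "x \<noteq> x1" using x False hi by auto
    then have Sx: "Suc x \<le> x1" using x by auto
    have gt: "card \<A> < Suc x choose r"
    proof (rule ccontr)
      assume "\<not> ?thesis"
      then have "Suc x \<le> x" unfolding x_def
        by (intro Greatest_le_nat[of _ _ x1]) (use Sx in \<open>auto simp: x_def\<close>)
      then show False by simp
    qed
    define d where "d = real (Suc x choose r) - real (x choose r)"
    have d: "0 < d" unfolding d_def using gt x by linarith
    define \<beta> where "\<beta> = (real (card \<A>) - real (x choose r)) / d"
    have b: "0 \<le> \<beta>" "\<beta> \<le> 1" unfolding \<beta>_def using d x gt by (auto simp: d_def divide_simps)
    have bd: "\<beta> * d = real (card \<A>) - real (x choose r)" unfolding \<beta>_def using d by simp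
    then have eq: "interp \<beta> x r = real (card \<A>)" unfolding interp_def d_def by (simp add: algebra_simps)
    have "real (card \<B>) + interp \<beta> x q \<le> real (card V choose q)"
      by (rule kruskal_katona_cross[of V p r q x \<A> \<B> \<beta>]) (use assms x0x b eq in auto)
    moreover have "(1 - \<beta>) * (\<kappa> * real (x choose r) + \<mu>) + \<beta> * (\<kappa> * real (Suc x choose r) + \<mu>) \<le> interp \<beta> x q"
      unfolding interp_def using b lin[of x] lin[of "Suc x"] x0x x Sx
      by (intro add_mono mult_left_mono) auto
    moreover have "(1 - \<beta>) * (\<kappa> * real (x choose r) + \<mu>) + \<beta> * (\<kappa> * real (Suc x choose r) + \<mu>)
        = \<kappa> * interp \<beta> x r + \<mu>"
      unfolding interp_def by (simp add: algebra_simps)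
    ultimately show ?thesis using eq by simp
  qed
qed

section \<open>Set pairs\<close>

text \<open>For each point \<open>x\<close>, the pairs with \<open>x \<notin> A i\<close>, with
  \<open>x\<close> deleted from \<open>B i\<close>, form a system on \<open>V - {x}\<close>. Summing
  the induction hypothesis over all \<open>x\<close> reproduces every weight exactly
  \<open>card V\<close> times. An empty \<open>B i\<close> meets no other \<open>A j\<close>, so
  such an \<open>i\<close> is the only index.\<close>

lemma bollobas_set_pairs:
  fixes A B :: "'i \<Rightarrow> 'a set"
  assumes "finite I" "finite V"
    and "\<And>i. i \<in> I \<Longrightarrow> A i \<subseteq> V" "\<And>i. i \<in> I \<Longrightarrow> B i \<subseteq> V"
    and "\<And>i. i \<in> I \<Longrightarrow> A i \<inter> B i = {}"
    and "\<And>i j. i \<in> I \<Longrightarrow> j \<in> I \<Longrightarrow> i \<noteq> j \<Longrightarrow> A i \<inter> B j \<noteq> {}"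
  shows "(\<Sum>i\<in>I. 1 / real ((card (A i) + card (B i)) choose card (A i))) \<le> 1"
  using assms
proof (induction "card V" arbitrary: V I B rule: less_induct)
  case less
  show ?case
  proof (cases "\<exists>i\<in>I. B i = {}")
    case True
    then obtain i where i: "i \<in> I" "B i = {}" by auto
    then have "I = {i}" using less.prems(6)[of _ i] by auto
    then show ?thesis using i by simp
  next
    case False
    show ?thesis
    proof (cases "I = {}")
      case nonempty: False
      then obtain i0 where "i0 \<in> I" by auto
      then have V: "V \<noteq> {}" using False less.prems(4) by auto
      define n where "n = card V"
      have n: "0 < n" unfolding n_def using V less.prems by (simp add: card_gt_0_iff)
      define t where "t = (\<lambda>x i. 1 / real ((card (A i) + card (B i - {x})) choose card (A i)))"
      have "(\<Sum>i\<in>{i\<in>I. x \<notin> A i}. t x i) \<le> 1" if x: "x \<in> V" for x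
        unfolding t_def
      proof (rule less.hyps[of "V - {x}"])
        show "card (V - {x}) < card V" using x less.prems by (meson card_Diff1_less)
        show "A i \<inter> (B j - {x}) \<noteq> {}" if "i \<in> {i\<in>I. x \<notin> A i}" "j \<in> {i\<in>I. x \<notin> A i}" "i \<noteq> j" for i j
          using less.prems(6)[of i j] that by auto
        show "A i \<inter> (B i - {x}) = {}" if "i \<in> {i\<in>I. x \<notin> A i}" for i
          using less.prems(5)[of i] that by auto
      qed (use less.prems in auto)
      then have "(\<Sum>x\<in>V. \<Sum>i\<in>{i\<in>I. x \<notin> A i}. t x i) \<le> (\<Sum>x\<in>V. 1)" by (intro sum_mono) auto
      also have "\<dots> = real n" unfolding n_def by simp
      finally have le: "(\<Sum>x\<in>V. \<Sum>i\<in>{i\<in>I. x \<notin> A i}. t x i) \<le> real n" .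
      have "(\<Sum>x\<in>V. \<Sum>i\<in>{i\<in>I. x \<notin> A i}. t x i) = (\<Sum>i\<in>I. \<Sum>x\<in>{x\<in>V. x \<notin> A i}. t x i)"
        by (rule sum.swap_restrict) (use less.prems in auto)
      \<comment> \<open>With a = |A i| and b = |B i|, the b points of \<open>B i\<close> contribute
        b / C(a+b-1, a) = (a+b) / C(a+b, a), and each of the n - a - b points outside both sets
        contributes 1 / C(a+b, a). The total is n / C(a+b, a).\<close>
      also have "\<dots> = (\<Sum>i\<in>I. real n * (1 / real ((card (A i) + card (B i)) choose card (A i))))"
      proof (rule sum.cong[OF refl])
        fix i assume i: "i \<in> I"
        define a where "a = card (A i)"
        define b where "b = card (B i)"
        define c where "c = real ((a + b) choose a)"
        have sub: "A i \<subseteq> V" "B i \<subseteq> V" "A i \<inter> B i = {}" using less.prems i by auto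
        have fin: "finite (A i)" "finite (B i)"
          using finite_subset[OF sub(1) less.prems(2)] finite_subset[OF sub(2) less.prems(2)] by auto
        have b: "0 < b" unfolding b_def using False i fin by (simp add: card_gt_0_iff)
        have ab: "card (A i \<union> B i) = a + b" unfolding a_def b_def using sub fin by (simp add: card_Un_disjoint)
        then have abn: "a + b \<le> n" unfolding n_def using sub less.prems(2) by (metis card_mono Un_least)
        have c: "0 < c" unfolding c_def by simp
        have split: "{x\<in>V. x \<notin> A i} = B i \<union> (V - (A i \<union> B i))" using sub by auto
        have "(\<Sum>x\<in>{x\<in>V. x \<notin> A i}. t x i) = (\<Sum>x\<in>B i. t x i) + (\<Sum>x\<in>V - (A i \<union> B i). t x i)"
          unfolding split using fin less.prems(2) by (intro sum.union_disjoint) auto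
        also have "(\<Sum>x\<in>V - (A i \<union> B i). t x i) = (\<Sum>x\<in>V - (A i \<union> B i). 1 / c)"
          by (rule sum.cong) (auto simp: t_def c_def a_def b_def)
        also have "\<dots> = (real n - real (a + b)) / c"
          using ab sub less.prems(2) abn by (simp add: card_Diff_subset finite_subset fin n_def of_nat_diff)
        also have "(\<Sum>x\<in>B i. t x i) = (\<Sum>x\<in>B i. 1 / real ((a + (b - 1)) choose a))"
          using fin by (intro sum.cong) (auto simp: t_def a_def b_def card_Diff_singleton)
        also have "\<dots> = real b / real ((a + (b - 1)) choose a)" by (simp add: b_def)
        also have "\<dots> = real (a + b) / c"
        proof -
          have "b * ((a + b) choose b) = (a + b) * ((a + b - 1) choose (b - 1))"
            using b by (rule times_binomial_minus1_eq)
          moreover have "(a + b) choose b = (a + b) choose a"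
            using binomial_symmetric[of a "a + b"] by simp
          moreover have "(a + b - 1) choose (b - 1) = (a + (b - 1)) choose a"
            using binomial_symmetric[of a "a + (b - 1)"] b by simp
          ultimately have "real b * c = real (a + b) * real ((a + (b - 1)) choose a)"
            unfolding c_def by (metis of_nat_mult)
          moreover have "0 < real ((a + (b - 1)) choose a)" by simp
          ultimately show ?thesis using c by (simp add: field_simps)
        qed
        finally show "(\<Sum>x\<in>{x\<in>V. x \<notin> A i}. t x i)
            = real n * (1 / real ((card (A i) + card (B i)) choose card (A i)))"
          using c by (simp add: c_def a_def b_def add_divide_distrib[symmetric])
      qed
      also have "\<dots> = real n * (\<Sum>i\<in>I. 1 / real ((card (A i) + card (B i)) choose card (A i)))"
        by (simp add: sum_distrib_left)
      finally have "real n * (\<Sum>i\<in>I. 1 / real ((card (A i) + card (B i)) choose card (A i))) \<le> real n * 1"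
        using le by simp
      then show ?thesis using n by (simp only: mult_le_cancel_left_pos of_nat_0_less_iff)
    qed simp
  qed
qed

text \<open>Ordered pairs, so each unordered disjoint pair counts twice. This is what turns C(2k, k)
  into its half C(2k-1, k-1) later on.\<close>

definition disjoint_pairs :: "'a set set \<Rightarrow> ('a set \<times> 'a set) set" where
  "disjoint_pairs \<F> = {(X, Y). X \<in> \<F> \<and> Y \<in> \<F> \<and> X \<inter> Y = {}}"

lemma finite_disjoint_pairs: "finite \<F> \<Longrightarrow> finite (disjoint_pairs \<F>)"
  by (rule finite_subset[of _ "\<F> \<times> \<F>"]) (auto simp: disjoint_pairs_def)

lemma almost_intersecting_unique:
  assumes "almost_intersecting \<F>" "F \<in> \<F>" "G \<in> \<F>" "G' \<in> \<F>" "F \<inter> G = {}" "F \<inter> G' = {}"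
  shows "G = G'"
  using assms unfolding almost_intersecting_def Uniq_def by blast

text \<open>Uniqueness of partners is the cross condition of Bollobas' inequality: if the first set
  of one pair misses the second set of another, then uniqueness at both of these sets identifies the
  two pairs. All weights are equal, so the inequality is a bound on their number.\<close>

lemma card_disjoint_pairs_le:
  assumes "finite V" "\<F> \<subseteq> {S. S \<subseteq> V \<and> card S = k}" "almost_intersecting \<F>"
  shows "card (disjoint_pairs \<F>) \<le> (2 * k) choose k"
proof -
  have "finite \<F>" using assms by (intro finite_subset[of \<F> "Pow V"]) auto
  then have fin: "finite (disjoint_pairs \<F>)"
    by (rule finite_disjoint_pairs)
  have "(\<Sum>i\<in>disjoint_pairs \<F>. 1 / real ((card (fst i) + card (snd i)) choose card (fst i))) \<le> 1"
  proof (rule bollobas_set_pairs[OF fin assms(1)])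
    fix i j assume ij: "i \<in> disjoint_pairs \<F>" "j \<in> disjoint_pairs \<F>" "i \<noteq> j"
    obtain X Y where ei: "i = (X, Y)" by (cases i)
    obtain X' Y' where ej: "j = (X', Y')" by (cases j)
    note e = ei ej
    show "fst i \<inter> snd j \<noteq> {}"
    proof
      assume "fst i \<inter> snd j = {}"
      then have "X \<inter> Y' = {}" using e by simp
      then have "Y = Y'" "X = X'"
        using ij e almost_intersecting_unique[OF assms(3), of X Y Y']
          almost_intersecting_unique[OF assms(3), of Y' X X'] unfolding disjoint_pairs_def by auto
      then show False using ij e by auto
    qed
  qed (use assms(2) in \<open>auto simp: disjoint_pairs_def dest!: subsetD[OF assms(2)]\<close>)
  moreover have "(\<Sum>i\<in>disjoint_pairs \<F>. 1 / real ((card (fst i) + card (snd i)) choose card (fst i)))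
      = (\<Sum>i\<in>disjoint_pairs \<F>. 1 / real ((2 * k) choose k))"
  proof (rule sum.cong[OF refl])
    fix i assume "i \<in> disjoint_pairs \<F>"
    then have "card (fst i) = k" "card (snd i) = k" using assms(2) by (auto simp: disjoint_pairs_def)
    then show "1 / real ((card (fst i) + card (snd i)) choose card (fst i)) = 1 / real ((2 * k) choose k)"
      by (simp add: mult_2)
  qed
  ultimately have "real (card (disjoint_pairs \<F>)) / real ((2 * k) choose k) \<le> 1" by simp
  then have "real (card (disjoint_pairs \<F>)) \<le> real ((2 * k) choose k)" by (simp add: divide_le_eq)
  then show ?thesis by simp
qed

lemma two_choose_half: "1 \<le> k \<Longrightarrow> (2 * k) choose k = 2 * ((2 * k - 1) choose (k - 1))"
  using times_binomial_minus1_eq[of k "2 * k"] by simp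

text \<open>A choice of partners in \<open>\<R>'\<close> is injective by uniqueness. As
  \<open>\<R>\<close> and \<open>\<R>'\<close> are disjoint, both orders of the chosen pairs can be
  counted, which gives the factor 2.\<close>

lemma disjoint_family_bound:
  assumes "finite V" "\<F> \<subseteq> {S. S \<subseteq> V \<and> card S = k}" "almost_intersecting \<F>" "1 \<le> k"
    and "\<R> \<subseteq> \<F>" "\<R>' \<subseteq> \<F>" "\<R> \<inter> \<R>' = {}" "\<And>R. R \<in> \<R> \<Longrightarrow> \<exists>R'\<in>\<R>'. R \<inter> R' = {}"
  shows "card \<R> \<le> (2 * k - 1) choose (k - 1)" "card \<R> \<le> card \<R>'"
proof -
  have fF: "finite \<F>" using assms by (intro finite_subset[of \<F> "Pow V"]) auto
  have fin: "finite \<R>" "finite \<R>'"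
    using finite_subset[OF assms(5) fF] finite_subset[OF assms(6) fF] by auto
  have fin_pairs: "finite (disjoint_pairs \<F>)"
    using fF by (rule finite_disjoint_pairs)
  obtain \<pi> where \<pi>: "\<And>R. R \<in> \<R> \<Longrightarrow> \<pi> R \<in> \<R>' \<and> R \<inter> \<pi> R = {}" using assms(8) by metis
  have inj: "inj_on \<pi> \<R>"
  proof (rule inj_onI)
    fix R S assume "R \<in> \<R>" "S \<in> \<R>" "\<pi> R = \<pi> S"
    then show "R = S" using \<pi>[of R] \<pi>[of S] assms(5,6)
      almost_intersecting_unique[OF assms(3), of "\<pi> R" R S] by (auto simp: Int_commute)
  qed
  then show "card \<R> \<le> card \<R>'" using \<pi> fin by (intro card_inj_on_le[of \<pi>]) auto
  let ?P = "(\<lambda>R. (R, \<pi> R)) ` \<R>" and ?Q = "(\<lambda>R. (\<pi> R, R)) ` \<R>"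
  have "?P \<inter> ?Q = {}" using \<pi> assms(7) by auto
  then have "card (?P \<union> ?Q) = card ?P + card ?Q" using fin by (intro card_Un_disjoint) auto
  also have "card ?P = card \<R>" by (intro card_image) (auto simp: inj_on_def)
  also have "card ?Q = card \<R>" by (intro card_image) (auto simp: inj_on_def)
  finally have "2 * card \<R> = card (?P \<union> ?Q)" by simp
  also have "\<dots> \<le> card (disjoint_pairs \<F>)"
    using \<pi> assms(5,6) fin_pairs by (intro card_mono) (auto simp: disjoint_pairs_def)
  also have "\<dots> \<le> (2 * k) choose k" by (rule card_disjoint_pairs_le[OF assms(1-3)])
  finally show "card \<R> \<le> (2 * k - 1) choose (k - 1)" using two_choose_half[OF assms(4)] by simp
qed

section \<open>Left-shifted intersecting families\<close>

definition left_shifted :: "nat set set \<Rightarrow> bool" where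
  "left_shifted \<G> \<longleftrightarrow>
     (\<forall>S\<in>\<G>. \<forall>i j. 1 \<le> i \<longrightarrow> i < j \<longrightarrow> j \<in> S \<longrightarrow> i \<notin> S \<longrightarrow> insert i (S - {j}) \<in> \<G>)"

lemma card_Int_atMost_Suc:
  "card (A \<inter> {1..Suc l}) = card (A \<inter> {1..l}) + (if Suc l \<in> A then 1 else 0)"
proof -
  have e: "{1..Suc l} = insert (Suc l) {1..l}" by auto
  show ?thesis unfolding e by (cases "Suc l \<in> A") auto
qed

lemma card_Int_Un_prefix:
  fixes A B :: "nat set"
  shows "card (A \<inter> {1..l}) + card (B \<inter> {1..l}) = card ((A \<union> B) \<inter> {1..l}) + card (A \<inter> B \<inter> {1..l})"
proof -
  have "card (A \<inter> {1..l}) + card (B \<inter> {1..l})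
      = card ((A \<inter> {1..l}) \<union> (B \<inter> {1..l})) + card ((A \<inter> {1..l}) \<inter> (B \<inter> {1..l}))"
    by (rule card_Un_Int) auto
  moreover have "(A \<inter> {1..l}) \<union> (B \<inter> {1..l}) = (A \<union> B) \<inter> {1..l}"
    "(A \<inter> {1..l}) \<inter> (B \<inter> {1..l}) = A \<inter> B \<inter> {1..l}" by auto
  ultimately show ?thesis by simp
qed

lemma card_prefix_exchange:
  fixes B :: "nat set"
  assumes "1 \<le> i" "i < j" "i \<notin> B" "j \<in> B"
  shows "card (insert i (B - {j}) \<inter> {1..l}) =
    card (B \<inter> {1..l}) + (if i \<le> l \<and> l < j then 1 else 0)"
proof -
  consider "l < i" | "i \<le> l" "l < j" | "j \<le> l" by linarith
  then show ?thesis
  proof cases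
    case 1
    then have "insert i (B - {j}) \<inter> {1..l} = B \<inter> {1..l}" using assms by auto
    then show ?thesis using 1 by simp
  next
    case 2
    then have "insert i (B - {j}) \<inter> {1..l} = insert i (B \<inter> {1..l})" using assms by auto
    then show ?thesis using 2 assms by simp
  next
    case 3
    then have e: "insert i (B - {j}) \<inter> {1..l} = insert i ((B \<inter> {1..l}) - {j})" using assms by auto
    have "card (insert i ((B \<inter> {1..l}) - {j})) = card (B \<inter> {1..l})"
      using 3 assms card_Suc_Diff1[of "B \<inter> {1..l}" j] by (subst card_insert_disjoint) auto
    then show ?thesis unfolding e using 3 assms by simp
  qed
qed

text \<open>Frankl's criterion: two members overfill some prefix. If they do not, let
  \<open>j\<close> be their first common element and \<open>i\<close> the last point before
  \<open>j\<close> missing from both. Replacing \<open>j\<close> by \<open>i\<close> in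
  \<open>B\<close> leaves fewer common elements, so induction applies; the prefix \<open>l\<close>
  that it yields satisfies \<open>i \<le> l < j\<close>, because elsewhere the exchange does not
  change the count.\<close>

lemma shifted_prefix_overlap:
  assumes sh: "left_shifted \<G>" and int: "intersecting \<G>" and V: "\<And>S. S \<in> \<G> \<Longrightarrow> S \<subseteq> {1..n}"
    and "A \<in> \<G>" "B \<in> \<G>"
  shows "\<exists>l. l < card (A \<inter> {1..l}) + card (B \<inter> {1..l})"
  using assms(5)
proof (induction "card (A \<inter> B)" arbitrary: B rule: less_induct)
  case less
  show ?case
  proof (rule ccontr)
    assume "\<not> ?case"
    then have le: "card (A \<inter> {1..l}) + card (B \<inter> {1..l}) \<le> l" for l by (meson not_less)
    have AB: "A \<inter> B \<noteq> {}" using int assms(4) less.prems unfolding intersecting_def by auto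
    have fin: "finite (A \<inter> B)" using V[OF assms(4)] finite_subset by blast
    define j where "j = Min (A \<inter> B)"
    have j: "j \<in> A" "j \<in> B" using Min_in[OF fin AB] unfolding j_def by auto
    have j1: "1 \<le> j" using j V[OF assms(4)] by auto
    have jmin: "z \<notin> A \<inter> B" if "z < j" for z using that fin unfolding j_def by (metis Min_le leD)
    define U where "U = {1..j} - (A \<union> B)"
    have "U \<noteq> {}"
    proof
      assume "U = {}"
      then have "(A \<union> B) \<inter> {1..j} = {1..j}" unfolding U_def by auto
      moreover have "A \<inter> B \<inter> {1..j} \<noteq> {}" using j j1 by auto
      then have "0 < card (A \<inter> B \<inter> {1..j})" by (simp add: card_gt_0_iff)
      ultimately show False using le[of j] card_Int_Un_prefix[of A j B] by simp
    qed
    have finU: "finite U" unfolding U_def by simp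
    define i where "i = Max U"
    have iU: "i \<in> U" unfolding i_def using finU \<open>U \<noteq> {}\<close> by simp
    have i: "1 \<le> i" "i < j" "i \<notin> A" "i \<notin> B" using iU j unfolding U_def
      by (auto simp: le_neq_implies_less) (metis le_neq_implies_less)
    have imax: "z \<in> A \<union> B" if "i < z" "z \<le> j" for z
    proof (rule ccontr)
      assume "z \<notin> A \<union> B"
      then have "z \<in> U" using that unfolding U_def by auto
      then show False using Max_ge[OF finU] that(1) unfolding i_def by (meson leD)
    qed
    define B' where "B' = insert i (B - {j})"
    have B': "B' \<in> \<G>" using sh less.prems i j unfolding left_shifted_def B'_def by auto
    have "A \<inter> B' = (A \<inter> B) - {j}" using i unfolding B'_def by auto
    then have "card (A \<inter> B') < card (A \<inter> B)" using fin j by (metis IntI card_Diff1_less)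
    from less.hyps[OF this B'] obtain l where l: "l < card (A \<inter> {1..l}) + card (B' \<inter> {1..l})" by auto
    then have il: "i \<le> l" "l < j" and ll: "l = card (A \<inter> {1..l}) + card (B \<inter> {1..l})"
      using le[of l] card_prefix_exchange[OF i(1,2,4) j(2), of l] unfolding B'_def by (auto split: if_splits)
    \<comment> \<open>Between \<open>l\<close> and \<open>j\<close> every point lies in exactly one
      of the two sets, so the count stays equal to the length up to \<open>j - 1\<close>. At
      \<open>j\<close> it rises by 2 and exceeds the length.\<close>
    have grow: "card (A \<inter> {1..l + d}) + card (B \<inter> {1..l + d}) = l + d" if "l + d < j" for d
      using that
    proof (induction d)
      case 0 then show ?case using ll by simp
    next
      case (Suc d)
      have z: "i < Suc (l + d)" "Suc (l + d) < j" using il Suc.prems by auto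
      have "Suc (l + d) \<in> A \<union> B" "Suc (l + d) \<notin> A \<inter> B" using imax[of "Suc (l + d)"] jmin z by auto
      then show ?case using Suc card_Int_atMost_Suc[of A "l + d"] card_Int_atMost_Suc[of B "l + d"] by auto
    qed
    have "card (A \<inter> {1..j - 1}) + card (B \<inter> {1..j - 1}) = j - 1"
      using grow[of "j - 1 - l"] il j1 by simp
    then have "card (A \<inter> {1..j}) + card (B \<inter> {1..j}) = j + 1"
      using card_Int_atMost_Suc[of A "j - 1"] card_Int_atMost_Suc[of B "j - 1"] j j1 by simp
    then show False using le[of j] by simp
  qed
qed

text \<open>The overlap criterion for two copies of \<open>A\<close> says that \<open>A\<close>
  fills more than half of some prefix; this is the last such prefix.\<close>

definition last_excess :: "nat \<Rightarrow> nat set \<Rightarrow> nat" where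
  "last_excess n A = (GREATEST l. l \<le> n \<and> l < 2 * card (A \<inter> {1..l}))"

text \<open>One step further the set no longer fills more than half, and the count does not
  decrease. Hence the excess is exactly one at this position, which is therefore odd.\<close>

lemma last_excess:
  assumes "\<exists>l. l < 2 * card (A \<inter> {1..l})" "A \<subseteq> {1..n}" "2 * card A \<le> n"
  shows "last_excess n A < n" "2 * card (A \<inter> {1..last_excess n A}) = last_excess n A + 1"
    "\<And>l. last_excess n A < l \<Longrightarrow> l \<le> n \<Longrightarrow> 2 * card (A \<inter> {1..l}) \<le> l"
proof -
  let ?P = "\<lambda>l. l \<le> n \<and> l < 2 * card (A \<inter> {1..l})"
  obtain l where l: "l < 2 * card (A \<inter> {1..l})" using assms by auto
  have "l \<le> n"
  proof (rule ccontr)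
    assume "\<not> l \<le> n"
    moreover have "card (A \<inter> {1..l}) \<le> card A"
      using assms(2) finite_subset by (intro card_mono) auto
    ultimately show False using l assms(3) by linarith
  qed
  then have "?P l" using l by simp
  then have P: "?P (last_excess n A)" unfolding last_excess_def
    by (rule GreatestI_nat[of ?P _ n]) auto
  show gr: "2 * card (A \<inter> {1..l}) \<le> l" if "last_excess n A < l" "l \<le> n" for l
  proof (rule ccontr)
    assume "\<not> ?thesis"
    then have "l \<le> last_excess n A" unfolding last_excess_def using that
      by (intro Greatest_le_nat[of ?P _ n]) auto
    then show False using that by simp
  qed
  have "A \<inter> {1..n} = A" using assms(2) by auto
  then show lt: "last_excess n A < n" using P assms(3) by (metis le_neq_implies_less leD)
  then have "2 * card (A \<inter> {1..Suc (last_excess n A)}) \<le> Suc (last_excess n A)" using gr by auto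
  then show "2 * card (A \<inter> {1..last_excess n A}) = last_excess n A + 1"
    using P card_Int_atMost_Suc[of A "last_excess n A"] by auto
qed

lemma last_excess_cong:
  assumes "\<And>l. last_excess n A \<le> l \<Longrightarrow> l \<le> n \<Longrightarrow> card (B \<inter> {1..l}) = card (A \<inter> {1..l})"
    and "\<exists>l. l < 2 * card (A \<inter> {1..l})" "A \<subseteq> {1..n}" "2 * card A \<le> n"
  shows "last_excess n B = last_excess n A"
  unfolding last_excess_def[of n B]
proof (rule Greatest_equality)
  note L = last_excess[OF assms(2-4)]
  show "last_excess n A \<le> n \<and> last_excess n A < 2 * card (B \<inter> {1..last_excess n A})"
    using assms(1)[of "last_excess n A"] L by auto
  fix y assume y: "y \<le> n \<and> y < 2 * card (B \<inter> {1..y})"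
  show "y \<le> last_excess n A"
  proof (rule ccontr)
    assume "\<not> ?thesis"
    then show False using L(3)[of y] assms(1)[of y] y by auto
  qed
qed

text \<open>Writing \<open>2i - 1\<close> for the last excess position of a set \<open>A\<close> avoiding \<open>1\<close>, there are \<open>i\<close> ways to
  exchange an element of \<open>A\<close> up to that position for \<open>1\<close>. The exchange keeps the position, so every
  set containing \<open>1\<close> arises in at most \<open>i - 1\<close> ways.\<close>

lemma shifted_card_avoiding_le:
  assumes sh: "left_shifted \<G>" and int: "intersecting \<G>"
    and G: "\<G> \<subseteq> {S. S \<subseteq> {1..n} \<and> card S = k}" and nk: "2 * k \<le> n"
  shows "card {S\<in>\<G>. 1 \<notin> S} \<le> card {S\<in>\<G>. 1 \<in> S}"
proof -
  let ?A = "{S\<in>\<G>. 1 \<notin> S}" and ?B = "{S\<in>\<G>. 1 \<in> S}"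
  have fG: "finite \<G>" using G by (rule finite_subset) auto
  define l where "l = last_excess n"
  define h where "h = (\<lambda>S. card (S \<inter> {1..l S}))"
  have ex: "\<exists>l. l < 2 * card (S \<inter> {1..l})" if "S \<in> \<G>" for S
    using shifted_prefix_overlap[OF sh int _ that that, of n] G by (auto simp: mult_2)
  have S: "S \<subseteq> {1..n}" "2 * card S \<le> n" if "S \<in> \<G>" for S using G nk that by auto
  have L: "2 * h S = l S + 1" if "S \<in> \<G>" for S
    using last_excess(2)[OF ex S] that unfolding l_def h_def by auto
  have E: "insert 1 (A - {y}) \<in> ?B \<and> l (insert 1 (A - {y})) = l A \<and> h (insert 1 (A - {y})) = h A"
    if A: "A \<in> ?A" and y: "y \<in> A" "y \<le> l A" for A y
  proof -
    have y1: "1 < y" using y A S[of A] by (metis (no_types, lifting) One_nat_def atLeastAtMost_iff le_neq_implies_less mem_Collect_eq subsetD)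
    have "insert 1 (A - {y}) \<in> \<G>" using sh A y y1 unfolding left_shifted_def by auto
    have same: "card (insert 1 (A - {y}) \<inter> {1..m}) = card (A \<inter> {1..m})" if "l A \<le> m" for m
      using card_prefix_exchange[of 1 y A m] y1 y A that by auto
    have "l (insert 1 (A - {y})) = l A"
      unfolding l_def by (rule last_excess_cong) (use same ex S A in \<open>auto simp: l_def\<close>)
    then show ?thesis using \<open>insert 1 (A - {y}) \<in> \<G>\<close> same[of "l A"] by (simp add: h_def)
  qed
  define R where "R = {(A, B). A \<in> ?A \<and> B \<in> ?B \<and> (\<exists>y\<in>A. y \<le> l A \<and> B = insert 1 (A - {y}))}"
  have fR: "finite R" unfolding R_def by (rule finite_subset[of _ "\<G> \<times> \<G>"]) (use fG in auto)
  have left: "card {B. (A, B) \<in> R} = h A" if A: "A \<in> ?A" for A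
  proof -
    have "{B. (A, B) \<in> R} = (\<lambda>y. insert 1 (A - {y})) ` (A \<inter> {1..l A})"
      using A E[OF A] S[of A] unfolding R_def by fastforce
    moreover have "inj_on (\<lambda>y. insert 1 (A - {y})) (A \<inter> {1..l A})"
    proof (rule inj_onI)
      fix y z assume y: "y \<in> A \<inter> {1..l A}" and eq: "insert 1 (A - {y}) = insert 1 (A - {z})"
      have "y \<notin> insert 1 (A - {y})" using y A by auto
      then show "y = z" unfolding eq using y by auto
    qed
    ultimately show ?thesis unfolding h_def by (simp add: card_image)
  qed
  have right: "card {A. (A, B) \<in> R} \<le> h B - 1" if B: "B \<in> ?B" for B
  proof -
    have "{A. (A, B) \<in> R} \<subseteq> (\<lambda>y. insert y (B - {1})) ` ({1..l B} - B)"
    proof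
      fix A assume "A \<in> {A. (A, B) \<in> R}"
      then obtain y where y: "A \<in> ?A" "y \<in> A" "y \<le> l A" "B = insert 1 (A - {y})" unfolding R_def by auto
      have lB: "l B = l A" using E[OF y(1-3)] y(4) by simp
      have "y \<in> {1..n}" "y \<noteq> 1" using y S[of A] by auto
      then have "y \<in> {1..l B} - B" unfolding lB using y(3,4) by auto
      moreover have "A = insert y (B - {1})" unfolding y(4) using y(1,2) by auto
      ultimately show "A \<in> (\<lambda>y. insert y (B - {1})) ` ({1..l B} - B)" by (rule image_eqI[rotated])
    qed
    then have "card {A. (A, B) \<in> R} \<le> card ({1..l B} - B)"
      by (rule surj_card_le[rotated]) simp
    also have "\<dots> = card {1..l B} - card (B \<inter> {1..l B})"
      by (subst card_Diff_subset_Int) (auto simp: Int_commute)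
    \<comment> \<open>Of the \<open>2 * h B - 1\<close> positions in the prefix, \<open>h B\<close>
      are occupied by \<open>B\<close>.\<close>
    also have "\<dots> = h B - 1" using L[of B] B unfolding h_def by auto
    finally show ?thesis .
  qed
  have hpos: "0 < h S" if "S \<in> \<G>" for S using L[OF that] by simp
  have hR: "h A = h B" if "(A, B) \<in> R" for A B using that E unfolding R_def by auto
  \<comment> \<open>Double counting with weight \<open>1 / h\<close>, which is the same at both ends
    of a related pair. Each set avoiding 1 carries total weight 1, each set containing 1 at most
    1.\<close>
  have "real (card ?A) = (\<Sum>A\<in>?A. \<Sum>B\<in>{B\<in>?B. (A, B) \<in> R}. 1 / real (h A))"
  proof -
    have one: "(\<Sum>B\<in>{B\<in>?B. (A, B) \<in> R}. 1 / real (h A)) = 1" if A: "A \<in> ?A" for A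
    proof -
      have "{B\<in>?B. (A, B) \<in> R} = {B. (A, B) \<in> R}" unfolding R_def by auto
      then show ?thesis using left[OF A] hpos[of A] A by simp
    qed
    have "(\<Sum>A\<in>?A. \<Sum>B\<in>{B\<in>?B. (A, B) \<in> R}. 1 / real (h A)) = (\<Sum>A\<in>?A. 1)"
      by (rule sum.cong[OF refl one])
    then show ?thesis by (simp only: sum_constant)
  qed
  also have "\<dots> = (\<Sum>A\<in>?A. \<Sum>B\<in>{B\<in>?B. (A, B) \<in> R}. 1 / real (h B))"
    using hR by (intro sum.cong) auto
  also have "\<dots> = (\<Sum>B\<in>?B. \<Sum>A\<in>{A\<in>?A. (A, B) \<in> R}. 1 / real (h B))"
    by (rule sum.swap_restrict) (use fG in auto)
  also have "\<dots> \<le> (\<Sum>B\<in>?B. 1)"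
  proof (rule sum_mono)
    fix B assume B: "B \<in> ?B"
    have "{A\<in>?A. (A, B) \<in> R} = {A. (A, B) \<in> R}" unfolding R_def by auto
    then have "card {A\<in>?A. (A, B) \<in> R} \<le> h B" using right[OF B] by simp
    then show "(\<Sum>A\<in>{A\<in>?A. (A, B) \<in> R}. 1 / real (h B)) \<le> 1" using hpos[of B] B by simp
  qed
  finally show ?thesis by simp
qed

section \<open>Bounds for cross-intersecting pairs and for shifted families of 4-sets\<close>

lemma binomial_le_of_sum_le:
  assumes "a \<le> b" "a + b \<le> x"
  shows "x choose a \<le> x choose b"
proof (cases "2 * b \<le> x")
  case True then show ?thesis using assms by (intro binomial_mono) auto
next
  case False
  then have "x choose a \<le> x choose (x - b)" using assms by (intro binomial_mono) auto
  also have "\<dots> = x choose b" using assms by (metis binomial_symmetric add_leD2)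
  finally show ?thesis .
qed

lemma choose_complement: "b \<le> x \<Longrightarrow> a = x - b \<Longrightarrow> x choose a = x choose b"
  using binomial_symmetric[of b x] by simp

lemma choose_pred_split:
  "1 \<le> x \<Longrightarrow> 1 \<le> q \<Longrightarrow> x choose q = ((x - 1) choose q) + ((x - 1) choose (q - 1))"
  by (cases x; cases q) auto

text \<open>The difference C(x, k-1) - C(x, n-1-k) has the same value at x = n-4 and x = n-3, so a
  line of slope 1 through both Kruskal--Katona points bounds the sum of the sizes. The size
  \<open>p\<close> is left open: the lemma serves for one deleted point with \<open>p = k\<close>
  and for two with \<open>p = k - 1\<close>.\<close>

lemma cross_intersecting_middle:
  assumes "3 \<le> k" "2 * k \<le> n" "finite V" "card V = p + (n - 1 - k)"
    and "\<A> \<subseteq> {S. S \<subseteq> V \<and> card S = p}" "\<B> \<subseteq> {S. S \<subseteq> V \<and> card S = k - 1}"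
    and "cross_intersecting \<A> \<B>"
    and "(n - 4) choose (k - 3) \<le> card \<A>" "card \<A> \<le> (n - 3) choose (k - 2)"
  shows "card \<B> + card \<A> + ((n - 3) choose (k - 1)) \<le> (card V choose (k - 1)) + ((n - 3) choose (k - 2))"
proof -
  let ?X = "real ((n - 3) choose (k - 1))" and ?Y = "real ((n - 3) choose (k - 2))"
  have e4: "(n - 4) choose (n - 1 - k) = (n - 4) choose (k - 3)"
    using assms(1,2) by (intro choose_complement) auto
  have e3: "(n - 3) choose (n - 1 - k) = (n - 3) choose (k - 2)"
    using assms(1,2) by (intro choose_complement) auto
  have X: "?X = real ((n - 4) choose (k - 1)) + real ((n - 4) choose (k - 2))"
    using choose_pred_split[of "n - 3" "k - 1"] assms(1,2) by (simp add: diff_diff_eq numeral_eq_Suc)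
  have Y: "?Y = real ((n - 4) choose (k - 2)) + real ((n - 4) choose (k - 3))"
    using choose_pred_split[of "n - 3" "k - 2"] assms(1,2) by (simp add: diff_diff_eq numeral_eq_Suc)
  have ar: "k - 1 \<le> n - 1 - k" "n - 1 - k \<le> n - 4" "n - 4 \<le> n - 3" using assms(1,2) by linarith+
  have "real (card \<B>) + 1 * real (card \<A>) + (?X - ?Y) \<le> real (card V choose (k - 1))"
  proof (rule kruskal_katona_linear[OF assms(3,4) ar assms(5,6,7)])
    fix x assume "n - 4 \<le> x" "x \<le> n - 3"
    then have "x = n - 4 \<or> x = n - 3" by auto
    then show "1 * real (x choose (n - 1 - k)) + (?X - ?Y) \<le> real (x choose (k - 1))"
      using e4 e3 X Y by auto
  qed (use assms(8,9) e3 e4 in simp_all)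
  then show ?thesis by linarith
qed

text \<open>For x \<le> n-4 the index x - (n-2-k) is at most k-2, and the two add up to at most x.
  Hence each set of \<open>\<A>\<close> costs \<open>\<B>\<close> at least one set on
  average.\<close>

lemma cross_intersecting_sum_le:
  assumes "2 \<le> k" "2 * k \<le> n" "finite V" "card V = n - 2"
    and "\<A> \<subseteq> {S. S \<subseteq> V \<and> card S = k}" "\<B> \<subseteq> {S. S \<subseteq> V \<and> card S = k - 2}"
    and "cross_intersecting \<A> \<B>" "card \<A> \<le> (n - 4) choose (k - 2)"
  shows "card \<A> + card \<B> \<le> (n - 2) choose (k - 2)"
proof (cases "card \<A> = 0")
  case True
  have "card \<B> \<le> card {S. S \<subseteq> V \<and> card S = k - 2}" using assms by (intro card_mono) auto
  then show ?thesis using True n_subsets[OF assms(3), of "k - 2"] assms(4) by simp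
next
  case False
  have nk: "k + 2 \<le> n" using assms False
    by (cases "k = 2") auto
  have ar: "card V = k + (n - 2 - k)" "k - 2 \<le> n - 2 - k" "n - 2 - k \<le> n - 2 - k" "n - 2 - k \<le> n - 4"
    using assms(1,2,4) nk by linarith+
  have "real (card \<B>) + 1 * real (card \<A>) + 0 \<le> real (card V choose (k - 2))"
  proof (rule kruskal_katona_linear[OF assms(3) ar assms(5,6,7)])
    have "(n - 4) choose (n - 2 - k) = (n - 4) choose (k - 2)"
      using assms(1,2) nk by (intro choose_complement) auto
    then show "card \<A> \<le> (n - 4) choose (n - 2 - k)" using assms by simp
    fix x assume x: "n - 2 - k \<le> x" "x \<le> n - 4"
    have "x choose (n - 2 - k) = x choose (x - (n - 2 - k))" using x by (intro binomial_symmetric)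
    also have "\<dots> \<le> x choose (k - 2)" using x assms by (intro binomial_le_of_sum_le) auto
    finally show "1 * real (x choose (n - 2 - k)) + 0 \<le> real (x choose (k - 2))" by simp
  qed (use False in simp_all)
  then show ?thesis using assms(4) by simp
qed

text \<open>If every set avoiding 1 contains 2 and 3, the bound is plain counting. Otherwise one
  exceptional set forces all those containing 2 and 3 to meet {4, 5, 6}, which loses C(n-6, 2) sets,
  while the sets not containing {2, 3} are only linearly many in \<open>n\<close>.\<close>

lemma shifted_four_avoiding:
  assumes sh: "left_shifted \<G>" and int: "intersecting \<G>"
    and G: "\<G> \<subseteq> {S. S \<subseteq> {1..n} \<and> card S = 4}" and n: "15 \<le> n"
  shows "card {S\<in>\<G>. 1 \<notin> S} \<le> (n - 3) choose 2"
proof -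
  let ?A = "{S\<in>\<G>. 1 \<notin> S}"
  have S: "S \<subseteq> {1..n}" "card S = 4" "finite S" if "S \<in> \<G>" for S
    using G that finite_subset[of S "{1..n}"] by auto
  define P where "P = {S. S \<subseteq> {4..n} \<and> card S = 2}"
  have fP: "finite P" and cP: "card P = (n - 3) choose 2"
    unfolding P_def using n_subsets[of "{4..n}" 2] by auto
  have with23: "S - {2, 3} \<in> P" "(S - {2, 3}) \<union> {2, 3} = S" if "S \<in> ?A" "{2, 3} \<subseteq> S" for S
  proof -
    have "S - {2, 3} \<subseteq> {4..n}"
    proof
      fix x assume x: "x \<in> S - {2, 3}"
      then have "x \<in> {1..n}" "x \<noteq> 1" using that S[of S] by auto
      then show "x \<in> {4..n}" using x by auto
    qed
    moreover have "card (S - {2, 3}) = 2" using that S[of S] by (simp add: card_Diff_subset)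
    ultimately show "S - {2, 3} \<in> P" by (simp add: P_def)
    show "(S - {2, 3}) \<union> {2, 3} = S" using that by auto
  qed
  show ?thesis
  proof (cases "\<forall>S\<in>?A. {2, 3} \<subseteq> S")
    case True
    have "?A \<subseteq> (\<lambda>T. T \<union> {2, 3}) ` P"
    proof
      fix S assume "S \<in> ?A"
      then show "S \<in> (\<lambda>T. T \<union> {2, 3}) ` P" using with23[of S] True by (intro image_eqI[of _ _ "S - {2, 3}"]) auto
    qed
    then have "card ?A \<le> card P" by (rule surj_card_le[OF fP])
    then show ?thesis using cP by simp
  next
    case False
    then obtain A where A: "A \<in> \<G>" "1 \<notin> A" "\<not> {2, 3} \<subseteq> A" by auto
    \<comment> \<open>Apart from 2 and 3, all elements of such an \<open>S\<close> would be at least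
      7, while \<open>A\<close> lacks 1 and one of 2, 3. The two sets would not overfill any
      prefix.\<close>
    have hit: "S \<inter> {4..6} \<noteq> {}" if "S \<in> ?A" "{2, 3} \<subseteq> S" for S
    proof
      assume no: "S \<inter> {4..6} = {}"
      have low: "z = 2 \<or> z = 3 \<or> 7 \<le> z" if "z \<in> S" for z
      proof -
        have "z \<noteq> 0" "z \<noteq> 1" "z \<notin> {4..6}" using that no \<open>S \<in> ?A\<close> S(1)[of S] by auto
        then show ?thesis by auto
      qed
      have SG: "S \<in> \<G>" using that by simp
      obtain l where l: "l < card (A \<inter> {1..l}) + card (S \<inter> {1..l})"
        using shifted_prefix_overlap[OF sh int S(1) A(1) SG] by blast
      have A4: "card (A \<inter> {1..l}) \<le> 4" and S4: "card (S \<inter> {1..l}) \<le> 4"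
        using card_mono[OF S(3)[OF A(1)] Int_lower1, of "{1..l}"] S(2)[OF A(1)]
          card_mono[OF S(3)[OF SG] Int_lower1, of "{1..l}"] S(2)[OF SG] by auto
      consider "l \<le> 1" | "l = 2" | "3 \<le> l" "l \<le> 6" | "l = 7" | "8 \<le> l" by linarith
      then show False
      proof cases
        case 1
        have "A \<inter> {1..l} \<subseteq> {}" "S \<inter> {1..l} \<subseteq> {}" using 1 A that by (auto simp: le_Suc_eq)
        then show False using l by simp
      next
        case 2
        have "A \<inter> {1..l} \<subseteq> {2}" "S \<inter> {1..l} \<subseteq> {2}" using 2 A that by (auto simp: le_Suc_eq numeral_eq_Suc)
        then have "card (A \<inter> {1..l}) \<le> card {2::nat}" "card (S \<inter> {1..l}) \<le> card {2::nat}"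
          by (auto intro!: card_mono simp del: card.insert)
        then show False using l 2 by simp
      next
        case 3
        have "S \<inter> {1..l} \<subseteq> {2, 3}" using 3 low by fastforce
        then have "card (S \<inter> {1..l}) \<le> card {2::nat, 3}" by (intro card_mono) auto
        moreover obtain z :: nat where z: "z \<in> {2, 3}" "z \<notin> A" using A by auto
        have "A \<inter> {1..l} \<subseteq> {1..l} - {1, z}" using z A by auto
        then have "card (A \<inter> {1..l}) \<le> card ({1..l} - {1, z})" by (intro card_mono) auto
        moreover have "card ({1..l} - {1, z}) = l - 2"
          using z 3 by (subst card_Diff_subset) auto
        ultimately show False using l 3 by simp
      next
        case 4
        have "S \<inter> {1..l} \<subseteq> {2, 3, 7}" using 4 low by fastforce
        then have "card (S \<inter> {1..l}) \<le> card {2::nat, 3, 7}" by (intro card_mono) auto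
        then show False using l 4 A4 by simp
      next
        case 5 then show False using l A4 S4 by simp
      qed
    qed
    define P' where "P' = {S. S \<subseteq> {7..n} \<and> card S = 2}"
    have P': "P' \<subseteq> P" "card P' = (n - 6) choose 2"
      unfolding P'_def P_def using n_subsets[of "{7..n}" 2] by auto
    have cPP: "card (P - P') = ((n - 3) choose 2) - ((n - 6) choose 2)"
      using P' fP cP by (simp add: card_Diff_subset finite_subset)
    define Q where "Q = {S. S \<subseteq> {2..7::nat} \<and> card S = 4}"
    have Q: "finite Q" "card Q = 15"
      unfolding Q_def using n_subsets[of "{2..7::nat}" 4] by (auto simp: eval_nat_numeral)
    define R where "R = (\<lambda>a x. {a, 4, 5, x::nat})"
    have cov: "?A \<subseteq> (\<lambda>T. T \<union> {2, 3}) ` (P - P') \<union> Q \<union> R 2 ` {6..n} \<union> R 3 ` {6..n}"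
    proof
      fix B assume B: "B \<in> ?A"
      note SB = S[of B]
      have B1: "1 \<notin> B" "0 \<notin> B" using B SB by auto
      show "B \<in> (\<lambda>T. T \<union> {2, 3}) ` (P - P') \<union> Q \<union> R 2 ` {6..n} \<union> R 3 ` {6..n}"
      proof (cases "{2, 3} \<subseteq> B")
        case True
        have "B - {2, 3} \<notin> P'" using hit[OF B True] unfolding P'_def by fastforce
        then have "B \<in> (\<lambda>T. T \<union> {2, 3}) ` (P - P')"
          using with23[OF B True] by (intro image_eqI[of _ _ "B - {2, 3}"]) auto
        then show ?thesis by blast
      next
        case no23: False
        have ex: "\<exists>l. l < 2 * card (B \<inter> {1..l})"
          using shifted_prefix_overlap[OF sh int S(1), of B B] B by (auto simp: mult_2)
        \<comment> \<open>With \<open>h\<close> elements up to position \<open>2 h - 1\<close>, none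
          of them 1: h = 2 forces {2, 3}, h = 3 forces 4 and 5 together with 2 or 3, and h = 4 puts
          all of \<open>B\<close> into {2..7}, which has 15 subsets of size 4.\<close>
        define l where "l = last_excess n B"
        have h: "2 * card (B \<inter> {1..l}) = l + 1"
          unfolding l_def using last_excess(2)[OF ex] SB B n by auto
        have "card (B \<inter> {1..l}) \<le> 4" using card_mono[OF SB(3) Int_lower1, of "{1..l}"] SB(2) B by auto
        then have "card (B \<inter> {1..l}) = 1 \<and> l = 1 \<or> card (B \<inter> {1..l}) = 2 \<and> l = 3
          \<or> card (B \<inter> {1..l}) = 3 \<and> l = 5 \<or> card (B \<inter> {1..l}) = 4 \<and> l = 7" using h by arith
        then consider "card (B \<inter> {1..l}) = 1" "l = 1" | "card (B \<inter> {1..l}) = 2" "l = 3"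
          | "card (B \<inter> {1..l}) = 3" "l = 5" | "card (B \<inter> {1..l}) = 4" "l = 7"
          by blast
        then show ?thesis
        proof cases
          case 1 then show ?thesis using B1 by auto
        next
          case 2
          have "B \<inter> {1..l} \<subseteq> {2, 3}" using 2 B1 by (auto simp: le_Suc_eq numeral_eq_Suc)
          then have "B \<inter> {1..l} = {2, 3}" using 2 by (intro card_subset_eq) auto
          then show ?thesis using no23 by auto
        next
          case 3
          have sub: "B \<inter> {1..l} \<subseteq> {2, 3, 4, 5}" using 3 B1 by (auto simp: le_Suc_eq numeral_eq_Suc)
          obtain a where a: "a \<in> {2, 3}" "B \<inter> {1..l} \<subseteq> {a, 4, 5}" using sub no23 by auto
          moreover have "card {a, 4, 5} = 3" using a by auto
          ultimately have e: "B \<inter> {1..l} = {a, 4, 5}" using 3 by (intro card_subset_eq) auto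
          have "card (B - {1..l}) = 1" using 3 SB B by (simp add: card_Diff_subset_Int)
          then obtain x where x: "B - {1..l} = {x}" by (auto simp: card_1_singleton_iff)
          have "B = {a, 4, 5, x}" using e x by auto
          moreover have "x \<in> {6..n}" using x 3 SB B B1 by fastforce
          ultimately show ?thesis using a unfolding R_def by auto
        next
          case 4
          have "B \<inter> {1..l} = B" using 4 SB B by (intro card_subset_eq) auto
          moreover have "B \<subseteq> {2..7}" using calculation 4 B1 by (metis (no_types, lifting) Int_iff One_nat_def Suc_1 Suc_leI atLeastAtMost_iff le_neq_implies_less subsetI)
          ultimately show ?thesis using SB B unfolding Q_def by auto
        qed
      qed
    qed
    have im: "card (f ` {6..n}) \<le> n - 5" for f :: "nat \<Rightarrow> nat set"
      using card_image_le[of "{6..n}" f] by simp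
    have imP: "card ((\<lambda>T. T \<union> {2, 3}) ` (P - P')) \<le> card (P - P')" using fP by (intro card_image_le) auto
    have "card ?A \<le> card ((\<lambda>T. T \<union> {2, 3}) ` (P - P') \<union> Q \<union> R 2 ` {6..n} \<union> R 3 ` {6..n})"
      using cov fP Q by (intro card_mono) auto
    also have "\<dots> \<le> card ((\<lambda>T. T \<union> {2, 3}) ` (P - P')) + card Q + card (R 2 ` {6..n}) + card (R 3 ` {6..n})"
      by (intro order.trans[OF card_Un_le] add_mono order.refl)
    also have "\<dots> \<le> ((n - 3) choose 2) - ((n - 6) choose 2) + 15 + (n - 5) + (n - 5)"
      using imP cPP Q im[of "R 2"] im[of "R 3"] by linarith
    \<comment> \<open>The gain has to cover the linear terms, 15 + 2(n-5) \<le> C(n-6, 2). At n = 15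
      this reads 35 \<le> 36.\<close>
    also have "\<dots> \<le> (n - 3) choose 2"
    proof -
      obtain t where t: "n = 15 + t" using n le_Suc_ex by blast
      have "15 + 2 * (n - 5) \<le> (n - 6) choose 2"
        unfolding choose_two t by (simp add: algebra_simps)
      moreover have "(n - 6) choose 2 \<le> (n - 3) choose 2" by (intro binomial_right_mono) auto
      ultimately show ?thesis by linarith
    qed
    finally show ?thesis .
  qed
qed

section \<open>Heavy elements of large intersecting families\<close>

lemma link_cross_intersecting:
  assumes "intersecting \<G>"
  shows "cross_intersecting {S\<in>\<G>. x \<notin> S} ((\<lambda>S. S - {x}) ` {S\<in>\<G>. x \<in> S})"
  unfolding cross_intersecting_def
proof (intro ballI)
  fix A B assume "A \<in> {S\<in>\<G>. x \<notin> S}" "B \<in> (\<lambda>S. S - {x}) ` {S\<in>\<G>. x \<in> S}"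
  then obtain T where "A \<in> \<G>" "x \<notin> A" "T \<in> \<G>" "B = T - {x}" by auto
  then show "A \<inter> B \<noteq> {}" using assms unfolding intersecting_def by auto
qed

lemma card_shift_avoiding_ge:
  assumes "finite \<G>" "x \<noteq> i"
  shows "card {S\<in>\<G>. x \<notin> S} \<le> card {S\<in>shift i j \<G>. x \<notin> S}"
proof (rule card_inj_on_le[of "shift_set i j \<G>"])
  show "inj_on (shift_set i j \<G>) {S\<in>\<G>. x \<notin> S}"
    using inj_on_shift_set by (rule inj_on_subset) auto
  show "shift_set i j \<G> ` {S\<in>\<G>. x \<notin> S} \<subseteq> {S\<in>shift i j \<G>. x \<notin> S}"
    using assms(2) unfolding shift_def by (auto simp: shift_set_def)
  show "finite {S\<in>shift i j \<G>. x \<notin> S}" using assms(1) unfolding shift_def by simp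
qed

lemma card_avoiding_both_le_shift:
  assumes "finite \<G>"
  shows "card {S\<in>\<G>. i \<notin> S \<and> j \<notin> S} \<le> card {S\<in>shift i j \<G>. i \<notin> S}"
proof (rule card_mono)
  show "finite {S\<in>shift i j \<G>. i \<notin> S}" using assms unfolding shift_def by simp
  show "{S\<in>\<G>. i \<notin> S \<and> j \<notin> S} \<subseteq> {S\<in>shift i j \<G>. i \<notin> S}"
  proof
    fix S assume S: "S \<in> {S\<in>\<G>. i \<notin> S \<and> j \<notin> S}"
    then have "shift_set i j \<G> S = S" by (simp add: shift_set_def)
    then show "S \<in> {S\<in>shift i j \<G>. i \<notin> S}" using S unfolding shift_def by force
  qed
qed

text \<open>\<open>X\<close>, \<open>Y\<close>, \<open>Z\<close> count the k-sets meeting a fixed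
  triple in exactly one prescribed point, in two prescribed points, and in all three. The full star
  has X + 2Y + Z sets, and \<open>w\<close> is the permitted deficit from it. Since the family of
  sets with at least two points in the triple has 3Y + Z members, \<open>gap\<close> says that a
  large family exceeds that family. The inequality in \<open>shifted_gap\<close> is what the
  argument for shifted families requires.\<close>

locale large_intersecting =
  fixes n k w :: nat and X Y Z :: nat
  assumes k4: "4 \<le> k" and n2k: "2 * k \<le> n"
    and X_eq: "X = (n - 3) choose (k - 1)" and Y_eq: "Y = (n - 3) choose (k - 2)"
    and Z_eq: "Z = (n - 3) choose (k - 3)"
    and gap: "w + Y < X"
    and shifted_gap: "(k = 4 \<and> 15 \<le> n) \<or>
      real w * (real X + real Y) < (real X - real Y) * (real X - real Z)"
begin

lemma choose_identities:
  "(n - 2) choose (k - 1) = X + Y" "(n - 2) choose (k - 2) = Y + Z"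
  "(n - 1) choose (k - 1) = X + 2 * Y + Z"
  "Y = ((n - 4) choose (k - 2)) + ((n - 4) choose (k - 3))"
  "(n - 4) choose (k - 3) \<le> (n - 4) choose (k - 2)"
proof -
  have e: "n - 2 - 1 = n - 3" "n - 1 - 1 = n - 2" "n - 3 - 1 = n - 4"
    "k - 1 - 1 = k - 2" "k - 2 - 1 = k - 3" by auto
  show 1: "(n - 2) choose (k - 1) = X + Y"
    using choose_pred_split[of "n - 2" "k - 1"] k4 n2k unfolding X_eq Y_eq e by simp
  show 2: "(n - 2) choose (k - 2) = Y + Z"
    using choose_pred_split[of "n - 2" "k - 2"] k4 n2k unfolding Y_eq Z_eq e by simp
  show "(n - 1) choose (k - 1) = X + 2 * Y + Z"
    using choose_pred_split[of "n - 1" "k - 1"] k4 n2k 1 2 unfolding e by simp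
  show "Y = ((n - 4) choose (k - 2)) + ((n - 4) choose (k - 3))"
    using choose_pred_split[of "n - 3" "k - 2"] k4 n2k unfolding Y_eq e by simp
  show "(n - 4) choose (k - 3) \<le> (n - 4) choose (k - 2)"
    using k4 n2k by (intro binomial_le_of_sum_le) auto
qed

definition large :: "nat set set \<Rightarrow> bool" where
  "large \<G> \<longleftrightarrow> \<G> \<subseteq> {S. S \<subseteq> {1..n} \<and> card S = k} \<and> intersecting \<G> \<and>
     (n - 1) choose (k - 1) \<le> card \<G> + w"

lemma large_finite: "large \<G> \<Longrightarrow> finite \<G>"
  unfolding large_def using finite_subsets[of "{1..n}"] by blast

lemma punctured:
  assumes "x \<in> {1..n}" "large \<G>"
  shows "finite ({1..n} - {x})" "card ({1..n} - {x}) = n - 1"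
    "{S\<in>\<G>. x \<notin> S} \<subseteq> {S. S \<subseteq> {1..n} - {x} \<and> card S = k}"
    "(\<lambda>S. S - {x}) ` {S\<in>\<G>. x \<in> S} \<subseteq> {S. S \<subseteq> {1..n} - {x} \<and> card S = k - 1}"
    "cross_intersecting {S\<in>\<G>. x \<notin> S} ((\<lambda>S. S - {x}) ` {S\<in>\<G>. x \<in> S})"
    "card \<G> = card {S\<in>\<G>. x \<notin> S} + card ((\<lambda>S. S - {x}) ` {S\<in>\<G>. x \<in> S})"
proof -
  show "card ({1..n} - {x}) = n - 1" using assms by simp
  show "{S\<in>\<G>. x \<notin> S} \<subseteq> {S. S \<subseteq> {1..n} - {x} \<and> card S = k}"
    using assms unfolding large_def by auto
  show "(\<lambda>S. S - {x}) ` {S\<in>\<G>. x \<in> S} \<subseteq> {S. S \<subseteq> {1..n} - {x} \<and> card S = k - 1}"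
    using assms k4 by (intro link_subsets) (auto simp: large_def)
  show "cross_intersecting {S\<in>\<G>. x \<notin> S} ((\<lambda>S. S - {x}) ` {S\<in>\<G>. x \<in> S})"
    using assms link_cross_intersecting unfolding large_def by auto
  show "card \<G> = card {S\<in>\<G>. x \<notin> S} + card ((\<lambda>S. S - {x}) ` {S\<in>\<G>. x \<in> S})"
    using card_split_at[OF large_finite[OF assms(2)]] .
qed simp

text \<open>A number of avoiding sets between C(n-4, k-3) and \<open>Y\<close> would limit the
  family to 3Y + Z sets, contrary to \<open>gap\<close>. Falling to the threshold thus means falling
  well below it.\<close>

lemma avoiding_small:
  assumes "x \<in> {1..n}" "large \<G>" "card {S\<in>\<G>. x \<notin> S} \<le> Y"
  shows "card {S\<in>\<G>. x \<notin> S} < (n - 4) choose (k - 3)"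
proof (rule ccontr)
  assume "\<not> ?thesis"
  then have lo: "(n - 4) choose (k - 3) \<le> card {S\<in>\<G>. x \<notin> S}" by simp
  note P = punctured[OF assms(1,2)]
  have Vp: "card ({1..n} - {x}) = k + (n - 1 - k)" unfolding P(2) using n2k k4 by linarith
  have "3 \<le> k" using k4 by simp
  from cross_intersecting_middle[OF this n2k P(1) Vp P(3,4,5) lo assms(3)[unfolded Y_eq]]
  have "card ((\<lambda>S. S - {x}) ` {S\<in>\<G>. x \<in> S}) + card {S\<in>\<G>. x \<notin> S} + X \<le> ((n - 1) choose (k - 1)) + Y"
    unfolding P(2) X_eq Y_eq .
  then show False using assms(2) gap P(6) unfolding large_def by linarith
qed

text \<open>A shift towards \<open>i\<close> can only create a heavy element at \<open>i\<close>. In that case almost every set meets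
  \<open>{i, j}\<close>, and the two families of sets meeting it in exactly one point are both large and
  cross-intersecting, which costs too much.\<close>

lemma shift_creates_no_heavy_element:
  assumes "large \<G>" "i \<in> {1..n}" "j \<in> {1..n}" "i \<noteq> j"
    and i: "Y < card {S\<in>\<G>. i \<notin> S}" and j: "Y < card {S\<in>\<G>. j \<notin> S}"
  shows "Y < card {S\<in>shift i j \<G>. i \<notin> S}"
proof (rule ccontr)
  assume neg: "\<not> ?thesis"
  have G: "\<G> \<subseteq> {S. S \<subseteq> {1..n} \<and> card S = k}" "intersecting \<G>" "finite \<G>"
    using assms(1) large_finite unfolding large_def by auto
  have "large (shift i j \<G>)"
    using assms(1,2) intersecting_shift shift_subsets[OF G(1), of i j]
    unfolding large_def by (auto simp: card_shift)
  then have E'': "card {S\<in>shift i j \<G>. i \<notin> S} < (n - 4) choose (k - 3)"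
    using avoiding_small assms(2) neg by (simp add: not_less)
  let ?V = "{1..n} - {i, j}"
  \<comment> \<open>The family is split by its trace on {i, j}: \<open>D\<close> has both points,
    \<open>Q\<close> only \<open>j\<close>, \<open>P\<close> only \<open>i\<close>, and
    \<open>E\<close> neither, with the trace removed each time.\<close>
  define D where "D = (\<lambda>S. S - {i}) ` {S\<in>(\<lambda>S. S - {j}) ` {S\<in>\<G>. j \<in> S}. i \<in> S}"
  define Q where "Q = {S\<in>(\<lambda>S. S - {j}) ` {S\<in>\<G>. j \<in> S}. i \<notin> S}"
  define P where "P = (\<lambda>S. S - {i}) ` {S\<in>{S\<in>\<G>. j \<notin> S}. i \<in> S}"
  define E where "E = {S\<in>{S\<in>\<G>. j \<notin> S}. i \<notin> S}"
  have V: "finite ?V" "card ?V = n - 2" using assms by (auto simp: card_Diff_subset)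
  have cG: "card \<G> = card E + card P + card Q + card D"
    using card_split_at[OF G(3), of j] card_split_at[of "{S\<in>\<G>. j \<notin> S}" i]
      card_split_at[of "(\<lambda>S. S - {j}) ` {S\<in>\<G>. j \<in> S}" i] G(3)
    unfolding D_def P_def Q_def E_def by auto
  have lj: "(\<lambda>S. S - {j}) ` {S\<in>\<G>. j \<in> S} \<subseteq> {S. S \<subseteq> {1..n} - {j} \<and> card S = Suc (k - 2)}"
    using G(1) k4 by (intro link_subsets) auto
  have Vij: "{1..n} - {j} - {i} = ?V" by auto
  have sub: "E \<subseteq> {S. S \<subseteq> ?V \<and> card S = k}" "P \<subseteq> {S. S \<subseteq> ?V \<and> card S = k - 1}"
    "Q \<subseteq> {S. S \<subseteq> ?V \<and> card S = k - 1}" "D \<subseteq> {S. S \<subseteq> ?V \<and> card S = k - 2}"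
  proof -
    show "E \<subseteq> {S. S \<subseteq> ?V \<and> card S = k}" using G(1) unfolding E_def by auto
    have "{S\<in>\<G>. j \<notin> S} \<subseteq> {S. S \<subseteq> {1..n} - {j} \<and> card S = Suc (k - 1)}" using G(1) k4 by auto
    then show "P \<subseteq> {S. S \<subseteq> ?V \<and> card S = k - 1}"
      using link_subsets[of _ "{1..n} - {j}" "k - 1" i] unfolding P_def Vij by blast
    have "Suc (k - 2) = k - 1" using k4 by simp
    then show "Q \<subseteq> {S. S \<subseteq> ?V \<and> card S = k - 1}" using lj unfolding Q_def by auto
    show "D \<subseteq> {S. S \<subseteq> ?V \<and> card S = k - 2}" using link_subsets[OF lj, of i] unfolding D_def Vij .
  qed
  have cPQ: "cross_intersecting P Q"
    unfolding cross_intersecting_def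
  proof (intro ballI)
    fix A B assume "A \<in> P" "B \<in> Q"
    then obtain S T where ST: "S \<in> \<G>" "j \<notin> S" "A = S - {i}" "T \<in> \<G>" "B = T - {j}" "i \<notin> B"
      unfolding P_def Q_def by auto
    then have "S \<inter> T \<noteq> {}" using G(2) unfolding intersecting_def by auto
    then show "A \<inter> B \<noteq> {}" using ST assms(4) by auto
  qed
  have cED: "cross_intersecting E D"
    unfolding cross_intersecting_def
  proof (intro ballI)
    fix A B assume "A \<in> E" "B \<in> D"
    then obtain T where ST: "A \<in> \<G>" "j \<notin> A" "i \<notin> A" "T \<in> \<G>" "B = T - {j} - {i}"
      unfolding E_def D_def by auto
    then have "A \<inter> T \<noteq> {}" using G(2) unfolding intersecting_def by auto
    then show "A \<inter> B \<noteq> {}" using ST by auto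
  qed
  have "E = {S\<in>\<G>. i \<notin> S \<and> j \<notin> S}" unfolding E_def by auto
  then have Esmall: "card E < (n - 4) choose (k - 3)"
    using card_avoiding_both_le_shift[OF G(3), of i j] E'' by simp
  have "card {S\<in>\<G>. j \<notin> S} = card E + card P"
    using card_split_at[of "{S\<in>\<G>. j \<notin> S}" i] G(3) unfolding E_def P_def by auto
  then have Pbig: "(n - 4) choose (k - 3) \<le> card P" using j Esmall choose_identities(4,5) by linarith
  have "card {S\<in>\<G>. i \<notin> S} = card E + card Q"
  proof -
    have "{S\<in>\<G>. i \<notin> S} = E \<union> {S\<in>{S\<in>\<G>. i \<notin> S}. j \<in> S}" unfolding E_def by auto
    moreover have "Q = (\<lambda>S. S - {j}) ` {S\<in>{S\<in>\<G>. i \<notin> S}. j \<in> S}"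
      unfolding Q_def using assms(4) by auto
    moreover have "E = {S\<in>{S\<in>\<G>. i \<notin> S}. j \<notin> S}" unfolding E_def by auto
    ultimately show ?thesis using card_split_at[of "{S\<in>\<G>. i \<notin> S}" j] G(3) by simp
  qed
  then have Qbig: "(n - 4) choose (k - 3) \<le> card Q" using i Esmall choose_identities(4,5) by linarith
  have Vp: "card ?V = (k - 1) + (n - 1 - k)" unfolding V(2) using n2k k4 by linarith
  have mid: "card \<B> + card \<A> + X \<le> ((n - 2) choose (k - 1)) + Y"
    if "\<A> \<subseteq> {S. S \<subseteq> ?V \<and> card S = k - 1}" "\<B> \<subseteq> {S. S \<subseteq> ?V \<and> card S = k - 1}"
      "cross_intersecting \<A> \<B>" "(n - 4) choose (k - 3) \<le> card \<A>" "card \<A> \<le> Y" for \<A> \<B>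
    using cross_intersecting_middle[OF _ n2k V(1) Vp that(1-4)] that(5) k4 unfolding V(2) X_eq Y_eq by simp
  \<comment> \<open>The middle range applies to whichever of \<open>P\<close> and \<open>Q\<close>
    has at most \<open>Y\<close> members: if \<open>P\<close> has more, Kruskal--Katona leaves at
    most \<open>Y\<close> for \<open>Q\<close>. With the bound on \<open>E\<close> and
    \<open>D\<close> the whole family again has at most 3Y + Z sets.\<close>
  have PQ: "card P + card Q + X \<le> ((n - 2) choose (k - 1)) + Y"
  proof (cases "card P \<le> Y")
    case True then show ?thesis using mid[OF sub(2,3) cPQ Pbig] by simp
  next
    case False
    have "(n - 3) choose (n - 1 - k) = (n - 3) choose (k - 2)"
      using n2k k4 by (intro choose_complement) auto
    then have "interp 0 (n - 3) (n - 1 - k) \<le> real (card P)"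
      using False Y_eq unfolding interp_def by simp
    then have "real (card Q) + interp 0 (n - 3) (k - 1) \<le> real (card ?V choose (k - 1))"
      using n2k k4 by (intro kruskal_katona_cross[OF V(1) Vp _ _ sub(2,3) cPQ]) auto
    then have "card Q + X \<le> (n - 2) choose (k - 1)" unfolding V(2) interp_def X_eq by simp
    then have "card Q \<le> Y" using choose_identities(1) by simp
    then show ?thesis using mid[OF sub(3,2) cross_intersecting_sym[OF cPQ] Qbig] by simp
  qed
  have "card E + card D \<le> (n - 2) choose (k - 2)"
    using cross_intersecting_sum_le[OF _ n2k V sub(1,4) cED] k4 Esmall choose_identities(5) by simp
  then have "card \<G> + X \<le> ((n - 1) choose (k - 1)) + Y" using PQ cG choose_identities(1,2,3) by linarith
  then show False using assms(1) gap unfolding large_def by linarith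
qed

text \<open>With \<open>a\<close> sets avoiding 1 and \<open>d\<close> containing it, shiftedness
  gives \<open>a \<le> d\<close> and Kruskal--Katona bounds \<open>d\<close> by a decreasing line in
  \<open>a\<close>. Along the line \<open>a + d\<close> grows, because Y < X, so it is largest where
  a = d. That this value is too small for a large family is precisely w(X + Y) < (X - Y)(X -
  Z).\<close>

lemma shifted_first_element_heavy:
  assumes "large \<G>" "left_shifted \<G>"
  shows "card {S\<in>\<G>. 1 \<notin> S} \<le> Y"
proof (rule ccontr)
  assume neg: "\<not> ?thesis"
  have G: "\<G> \<subseteq> {S. S \<subseteq> {1..n} \<and> card S = k}" "intersecting \<G>"
    using assms(1) unfolding large_def by auto
  have "1 \<in> {1..n}" using k4 n2k by auto
  note P = punctured[OF this assms(1)]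
  define a where "a = card {S\<in>\<G>. 1 \<notin> S}"
  define d where "d = card ((\<lambda>S. S - {1}) ` {S\<in>\<G>. 1 \<in> S})"
  have Ya: "Y < a" using neg a_def by simp
  have ad: "a \<le> d" using shifted_card_avoiding_le[OF assms(2) G(2,1) n2k] unfolding a_def d_def card_link .
  have size: "(n - 1) choose (k - 1) \<le> a + d + w"
    using assms(1) P(6) unfolding large_def a_def d_def by simp
  have "\<not> (k = 4 \<and> 15 \<le> n)"
    using shifted_four_avoiding[OF assms(2) G(2)] G(1) Ya unfolding a_def Y_eq by fastforce
  then have w: "real w * (real X + real Y) < (real X - real Y) * (real X - real Z)" using shifted_gap by blast
  have Vp: "card ({1..n} - {1}) = k + (n - 1 - k)" unfolding P(2) using n2k k4 by linarith
  have e3: "(n - 3) choose (n - 1 - k) = Y" unfolding Y_eq using n2k k4 by (intro choose_complement) auto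
  have e2: "(n - 2) choose (n - 1 - k) = X + Y"
    unfolding choose_identities(1)[symmetric] using n2k k4 by (intro choose_complement) auto
  have ar: "k - 1 \<le> n - 1 - k" "n - 1 - k \<le> n - 2" "n - 1 - k \<le> n - 3" "n - 3 \<le> n - 2" using n2k k4 by linarith+
  have aXY: "a \<le> X + Y"
  proof (rule ccontr)
    assume big: "\<not> ?thesis"
    have "real d + interp 0 (n - 2) (k - 1) \<le> real (card ({1..n} - {1}) choose (k - 1))"
      unfolding d_def
      by (rule kruskal_katona_cross[OF P(1) Vp ar(1,2) P(3,4,5)])
        (use big e2 in \<open>simp_all add: interp_def a_def\<close>)
    then have "d + (X + Y) \<le> X + 2 * Y + Z"
      unfolding P(2) interp_def using choose_identities(1,3) by simp
    moreover have "Z \<le> X" unfolding Z_eq X_eq using n2k k4 by (intro binomial_le_of_sum_le) auto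
    ultimately show False using ad big by linarith
  qed
  have X0: "0 < real X" using gap by simp
  \<comment> \<open>The chord through the points (Y, 2Y + Z) and (X + Y, Y + Z) for (a, d),
    belonging to the neighbouring values n-3 and n-2 of \<open>x\<close>.\<close>
  have "real d + (real Y / real X) * real a + (real X - real Y * real Y / real X)
      \<le> real (card ({1..n} - {1}) choose (k - 1))"
    unfolding d_def a_def
  proof (rule kruskal_katona_linear[OF P(1) Vp ar(1,3,4) P(3,4,5)])
    fix x assume "n - 3 \<le> x" "x \<le> n - 2"
    then have "x = n - 3 \<or> x = n - 2" using ar(4) by arith
    then show "real Y / real X * real (x choose (n - 1 - k)) + (real X - real Y * real Y / real X)
        \<le> real (x choose (k - 1))"
      using e2 e3 X0 choose_identities(1) X_eq by (auto simp: field_simps)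
  qed (use Ya aXY e2 e3 in \<open>simp_all add: a_def\<close>)
  then have "(real d + (real Y / real X) * real a + (real X - real Y * real Y / real X)) * real X
      \<le> (real X + 2 * real Y + real Z) * real X"
    unfolding P(2) using choose_identities(3) X0 by (intro mult_right_mono) auto
  then have kk: "real d * real X + real Y * real a + real X * real X - real Y * real Y
      \<le> (real X + 2 * real Y + real Z) * real X"
    using X0 by (simp add: algebra_simps)
  have "real X + 2 * real Y + real Z \<le> real a + real d + real w"
    using size choose_identities(3) by linarith
  then have 1: "(real X + real Y) * (real X + 2 * real Y + real Z)
      \<le> (real X + real Y) * (real a + real d + real w)"
    by (intro mult_left_mono) auto
  have 2: "0 \<le> (real X - real Y) * (real d - real a)" using gap ad by (intro mult_nonneg_nonneg) auto
  show False using 1 2 kk w by (simp add: algebra_simps)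
qed

text \<open>Among the counterexamples take one with the least total of all elements. A shift to the
  left lowers this total and cannot produce a heavy point, so the minimal family is left-shifted,
  and then 1 is heavy.\<close>

lemma heavy_element:
  assumes "large \<G>"
  shows "\<exists>x\<in>{1..n}. card {S\<in>\<G>. x \<notin> S} \<le> Y"
proof (rule ccontr)
  define bad where "bad = (\<lambda>\<G>. large \<G> \<and> (\<forall>x\<in>{1..n}. Y < card {S\<in>\<G>. x \<notin> S}))"
  define \<mu> where "\<mu> = (\<lambda>\<G> :: nat set set. \<Sum>S\<in>\<G>. \<Sum>S)"
  assume "\<not> ?thesis"
  then have "bad \<G>" unfolding bad_def using assms by auto
  then obtain \<H> where H: "bad \<H>" and min: "\<And>\<H>'. bad \<H>' \<Longrightarrow> \<mu> \<H> \<le> \<mu> \<H>'"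
    using ex_has_least_nat[of bad \<G> \<mu>] by auto
  have L: "large \<H>" and Hx: "\<And>x. x \<in> {1..n} \<Longrightarrow> Y < card {S\<in>\<H>. x \<notin> S}"
    using H unfolding bad_def by auto
  have sub: "S \<subseteq> {1..n}" "finite S" if "S \<in> \<H>" for S
    using L that finite_subset[of S "{1..n}"] unfolding large_def by auto
  have fH: "finite \<H>" using L large_finite by auto
  have "left_shifted \<H>"
    unfolding left_shifted_def
  proof (intro ballI allI impI)
    fix S i j assume S: "S \<in> \<H>" "1 \<le> i" "i < j" "j \<in> S" "i \<notin> S"
    have ij: "i \<in> {1..n}" "j \<in> {1..n}" "i \<noteq> j" using S sub(1)[of S] by auto
    show "insert i (S - {j}) \<in> \<H>"
    proof (rule ccontr)
      assume new: "insert i (S - {j}) \<notin> \<H>"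
      let ?f = "shift_set i j \<H>"
      have moved: "\<Sum>(insert i (T - {j})) < \<Sum>T" if "T \<in> \<H>" "j \<in> T" "i \<notin> T" for T
        using that sub(2)[of T] S(3) by (simp add: sum.remove[of T j])
      have "\<mu> (shift i j \<H>) = (\<Sum>T\<in>\<H>. \<Sum>(?f T))"
        unfolding \<mu>_def shift_def by (subst sum.reindex[OF inj_on_shift_set]) simp
      also have "\<dots> < (\<Sum>T\<in>\<H>. \<Sum>T)"
      proof (rule sum_strict_mono_ex1[OF fH])
        show "\<forall>T\<in>\<H>. \<Sum>(?f T) \<le> \<Sum>T" using moved unfolding shift_set_def by (auto intro: less_imp_le)
        show "\<exists>T\<in>\<H>. \<Sum>(?f T) < \<Sum>T"
          using S new moved[OF S(1,4,5)] by (intro bexI[of _ S]) (auto simp: shift_set_def)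
      qed
      finally have "\<mu> (shift i j \<H>) < \<mu> \<H>" unfolding \<mu>_def .
      moreover have "bad (shift i j \<H>)"
        unfolding bad_def
      proof (intro conjI ballI)
        show "large (shift i j \<H>)"
          using L ij shift_subsets[of \<H> "{1..n}" k i j] intersecting_shift
          unfolding large_def by (auto simp: card_shift)
        fix x assume x: "x \<in> {1..n}"
        show "Y < card {S\<in>shift i j \<H>. x \<notin> S}"
        proof (cases "x = i")
          case True
          then show ?thesis using shift_creates_no_heavy_element[OF L ij Hx Hx] ij by simp
        next
          case False
          then show ?thesis using card_shift_avoiding_ge[OF fH, of x i j] Hx[OF x] by linarith
        qed
      qed
      ultimately show False using min by (meson leD)
    qed
  qed
  then have "card {S\<in>\<H>. 1 \<notin> S} \<le> Y" using shifted_first_element_heavy L by simp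
  moreover have "1 \<in> {1..n}" using k4 n2k by auto
  ultimately show False using Hx by (meson leD)
qed

end

section \<open>Almost intersecting families with few sets avoiding a point\<close>

text \<open>By maximality every discarded set has a partner among the kept ones, so the bound for
  partnered families applies to the discarded sets.\<close>

lemma maximal_intersecting_subfamily:
  assumes "finite V" "\<F> \<subseteq> {S. S \<subseteq> V \<and> card S = k}" "almost_intersecting \<F>" "1 \<le> k"
  obtains \<G> where "\<G> \<subseteq> \<F>" "intersecting \<G>" "card \<F> \<le> card \<G> + ((2 * k - 1) choose (k - 1))"
    "card (\<F> - \<G>) \<le> (2 * k - 1) choose (k - 1)"
proof -
  have fF: "finite \<F>" using assms finite_subsets by blast
  let ?P = "\<lambda>\<G>. \<G> \<subseteq> \<F> \<and> intersecting \<G>"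
  have "?P {}" by (simp add: intersecting_def)
  then obtain \<G> where G: "?P \<G>" and max: "\<And>\<H>. ?P \<H> \<Longrightarrow> card \<H> \<le> card \<G>"
    using ex_has_greatest_nat[of ?P "{}" card "Suc (card \<F>)"] card_mono[OF fF]
    by (auto simp: less_Suc_eq_le)
  have fG: "finite \<G>" using G fF finite_subset by auto
  have partner: "\<exists>T\<in>\<G>. R \<inter> T = {}" if R: "R \<in> \<F> - \<G>" for R
  proof (rule ccontr)
    assume no: "\<not> ?thesis"
    have "card R = k" using R assms(2) by auto
    then have "R \<noteq> {}" using assms(4) by auto
    have "intersecting (insert R \<G>)"
      using G no \<open>R \<noteq> {}\<close> unfolding intersecting_def by auto
    then have "card (insert R \<G>) \<le> card \<G>" using max G R by auto
    then show False using fG R by simp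
  qed
  have "card (\<F> - \<G>) \<le> (2 * k - 1) choose (k - 1)"
    by (rule disjoint_family_bound(1)[OF assms, of _ \<G>]) (use partner G in auto)
  moreover have "card \<F> = card \<G> + card (\<F> - \<G>)"
    using G fF fG by (simp add: card_Diff_subset card_mono)
  ultimately show thesis using that[of \<G>] G by simp
qed

text \<open>C(x, k-1) - C(x, n-1-k) does not decrease in x: its increment is C(x, k-2) - C(x,
  n-2-k), and up to x = n-4 the first index is at least as close to the middle.\<close>

lemma binomial_difference_mono:
  assumes "1 \<le> k" "2 * k \<le> n" "n - 1 - k \<le> y" "y \<le> x" "x \<le> n - 3"
  shows "(x choose (n - 1 - k)) + (y choose (k - 1)) \<le> (x choose (k - 1)) + (y choose (n - 1 - k))"
proof (cases "k = 1")
  case True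
  then have "n \<le> 2" using assms by linarith
  then show ?thesis using assms True by (cases "n = 2") auto
next
  case False
  define r where "r = n - 1 - k"
  have r: "1 \<le> r" "1 \<le> k - 1" unfolding r_def using assms False by auto
  have "((y + d) choose r) + (y choose (k - 1)) \<le> ((y + d) choose (k - 1)) + (y choose r)" if "y + d \<le> n - 3" for d
    using that
  proof (induction d)
    case (Suc d)
    have "(y + d) choose (r - 1) = (y + d) choose (y + d - (r - 1))"
      using assms(3) r_def by (intro binomial_symmetric) linarith
    also have "\<dots> \<le> (y + d) choose (k - 1 - 1)"
      by (rule binomial_le_of_sum_le; use Suc.prems assms(1-3) False r r_def in linarith)
    finally show ?case
      using Suc choose_pred_split[of "Suc (y + d)" r] choose_pred_split[of "Suc (y + d)" "k - 1"] r
      by simp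
  qed simp
  from this[of "x - y"] show ?thesis using assms(4,5) unfolding r_def by simp
qed

text \<open>Write |\<F>| = a + |Bp| + |L| with \<open>Bp\<close> the partnered and \<open>L\<close>
  the partnerless sets through a heavy point. Up to a = C(x1, n-1-k) the bound |Bp| \<le> a is
  combined with \<open>slope\<close>, whose line passes through the point for a = 1; beyond that,
  |Bp| \<le> M is combined with \<open>mid\<close>. The hypothesis \<open>few\<close> ensures that
  restoring the discarded sets keeps \<open>a\<close> at most \<open>Y\<close>.\<close>

lemma single_avoiding_set:
  fixes n k x1 w :: nat and \<kappa> :: real
  assumes F: "\<F> \<subseteq> {S. S \<subseteq> {1..n} \<and> card S = k}" and ai: "almost_intersecting \<F>"
    and k4: "4 \<le> k" and n2k: "2 * k \<le> n"
    and size: "((n - 1) choose (k - 1)) + 2 \<le> card \<F> + ((n - k - 1) choose (k - 1))"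
    and x1: "n - 1 - k \<le> x1" "x1 \<le> n - 3"
    and w_eq: "w + 2 = ((n - k - 1) choose (k - 1)) + ((2 * k - 1) choose (k - 1))"
    and \<kappa>: "2 < \<kappa>"
    and slope: "\<And>x. n - 1 - k \<le> x \<Longrightarrow> x \<le> x1 \<Longrightarrow>
      \<kappa> * real (x choose (n - 1 - k)) + (real ((n - k - 1) choose (k - 1)) - \<kappa>) \<le> real (x choose (k - 1))"
    and mid: "w + (x1 choose (n - 1 - k)) < x1 choose (k - 1)"
    and few: "(2 * k - 1) choose (k - 1) \<le> (n - 4) choose (k - 2)"
    and shifted_gap: "(k = 4 \<and> 15 \<le> n) \<or>
      real w * (real ((n - 3) choose (k - 1)) + real ((n - 3) choose (k - 2))) <
      (real ((n - 3) choose (k - 1)) - real ((n - 3) choose (k - 2))) *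
      (real ((n - 3) choose (k - 1)) - real ((n - 3) choose (k - 3)))"
  shows "\<exists>x\<in>{1..n}. card {S\<in>\<F>. x \<notin> S} = 1"
proof -
  define r where "r = n - 1 - k"
  define M where "M = (2 * k - 1) choose (k - 1)"
  define f1 where "f1 = (n - k - 1) choose (k - 1)"
  define X where "X = (n - 3) choose (k - 1)"
  define Y where "Y = (n - 3) choose (k - 2)"
  define Z where "Z = (n - 3) choose (k - 3)"
  have k1: "1 \<le> k" using k4 by simp
  have Yr: "(n - 3) choose r = Y" unfolding Y_def r_def using k4 n2k by (intro choose_complement) auto
  have gap: "w + Y < X"
    using binomial_difference_mono[OF k1 n2k x1(1,2) order.refl] mid Yr unfolding X_def r_def by linarith
  interpret large_intersecting n k w X Y Z
    by unfold_locales (use k4 n2k gap shifted_gap in \<open>auto simp: X_def Y_def Z_def\<close>)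
  obtain \<G> where G: "\<G> \<subseteq> \<F>" "intersecting \<G>" "card \<F> \<le> card \<G> + M" "card (\<F> - \<G>) \<le> M"
    unfolding M_def by (rule maximal_intersecting_subfamily[OF finite_atLeastAtMost F ai k1])
  have fF: "finite \<F>" using F finite_subsets[of "{1..n}"] by blast
  have "large \<G>" unfolding large_def
    using G F size w_eq unfolding M_def by auto
  then obtain x where x: "x \<in> {1..n}" "card {S\<in>\<G>. x \<notin> S} \<le> Y" using heavy_element by blast
  then have Gx: "card {S\<in>\<G>. x \<notin> S} < (n - 4) choose (k - 3)" using avoiding_small \<open>large \<G>\<close> by blast
  define A where "A = {S\<in>\<F>. x \<notin> S}"
  define Bp where "Bp = {S\<in>\<F>. x \<in> S \<and> (\<exists>T\<in>\<F>. S \<inter> T = {})}"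
  define B0 where "B0 = {S\<in>\<F>. \<forall>T\<in>\<F>. S \<inter> T \<noteq> {}}"
  define L where "L = (\<lambda>S. S - {x}) ` {S\<in>B0. x \<in> S}"
  define a where "a = card A"
  have aY: "a \<le> Y"
  proof -
    have "A \<subseteq> {S\<in>\<G>. x \<notin> S} \<union> (\<F> - \<G>)" unfolding A_def by auto
    then have "a \<le> card ({S\<in>\<G>. x \<notin> S} \<union> (\<F> - \<G>))" unfolding a_def
      using fF finite_subset[OF G(1) fF] by (intro card_mono) auto
    also have "\<dots> \<le> card {S\<in>\<G>. x \<notin> S} + card (\<F> - \<G>)" by (rule card_Un_le)
    finally show ?thesis using Gx G(4) few choose_identities(4) unfolding M_def by linarith
  qed
  have a1: "1 \<le> a"
  proof -
    obtain S T where ST: "S \<in> \<F>" "T \<in> \<F>" "S \<inter> T = {}"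
      using ai unfolding almost_intersecting_def intersecting_def by auto
    then have "S \<in> A \<or> T \<in> A" unfolding A_def by auto
    then have "A \<noteq> {}" by auto
    then show ?thesis unfolding a_def using fF by (simp add: A_def card_gt_0_iff Suc_le_eq)
  qed
  have "card {S\<in>\<F>. x \<in> S} = card Bp + card {S\<in>B0. x \<in> S}"
  proof -
    have u: "{S\<in>\<F>. x \<in> S} = Bp \<union> {S\<in>B0. x \<in> S}" and d: "Bp \<inter> {S\<in>B0. x \<in> S} = {}"
      unfolding Bp_def B0_def by auto
    have "finite Bp" "finite {S\<in>B0. x \<in> S}" using fF unfolding Bp_def B0_def by auto
    then show ?thesis unfolding u using d by (rule card_Un_disjoint)
  qed
  moreover have "card \<F> = card A + card {S\<in>\<F>. x \<in> S}"
    using card_split_at[OF fF, of x] unfolding A_def card_link .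
  ultimately have cF: "card \<F> = a + card Bp + card L" unfolding a_def L_def card_link by simp
  have partner: "\<exists>T\<in>A. S \<inter> T = {}" if "S \<in> Bp" for S using that unfolding Bp_def A_def by auto
  have sub: "Bp \<subseteq> \<F>" "A \<subseteq> \<F>" "Bp \<inter> A = {}" unfolding Bp_def A_def by auto
  have Bp: "card Bp \<le> M" "card Bp \<le> a"
    unfolding M_def a_def
    using disjoint_family_bound[OF finite_atLeastAtMost F ai k1 sub partner] by auto
  define V where "V = {1..n} - {x}"
  have V: "finite V" "card V = n - 1" unfolding V_def using x by auto
  have Vp: "card V = k + r" unfolding V(2) r_def using n2k k4 by linarith
  have subA: "A \<subseteq> {S. S \<subseteq> V \<and> card S = k}" unfolding A_def V_def using F by auto
  have subL: "L \<subseteq> {S. S \<subseteq> V \<and> card S = k - 1}"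
    unfolding L_def V_def using F k4 by (intro link_subsets) (auto simp: B0_def)
  have cross: "cross_intersecting A L"
    unfolding cross_intersecting_def
  proof (intro ballI)
    fix S T assume "S \<in> A" "T \<in> L"
    then obtain U where "S \<in> \<F>" "x \<notin> S" "U \<in> B0" "T = U - {x}" unfolding A_def L_def by auto
    then show "S \<inter> T \<noteq> {}" unfolding B0_def by auto
  qed
  have qr: "k - 1 \<le> r" unfolding r_def using n2k k4 by linarith
  have "a = 1"
  proof (cases "a \<le> x1 choose r")
    case True
    have "real (card L) + \<kappa> * real (card A) + (real f1 - \<kappa>) \<le> real (card V choose (k - 1))"
      using slope True a1 x1 unfolding r_def[symmetric] f1_def[symmetric] a_def
      by (intro kruskal_katona_linear[OF V(1) Vp qr order.refl x1(1)[folded r_def] subA subL cross]) simp_all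
    moreover have "real ((n - 1) choose (k - 1)) + 2 \<le> real a + real a + real (card L) + real f1"
      using size cF Bp(2) unfolding f1_def by linarith
    \<comment> \<open>The line is normalised at a = 1, so the constants cancel and only the excess
      of the slope over 2 remains.\<close>
    ultimately have "(\<kappa> - 2) * (real a - 1) \<le> 0" unfolding V(2) a_def by (simp add: algebra_simps)
    then show ?thesis using \<kappa> a1 by (simp add: mult_le_0_iff)
  next
    case False
    have "real (card L) + 1 * real (card A) + (real (x1 choose (k - 1)) - real (x1 choose r))
        \<le> real (card V choose (k - 1))"
    proof (rule kruskal_katona_linear[OF V(1) Vp qr _ x1(2) subA subL cross])
      fix y assume "x1 \<le> y" "y \<le> n - 3"
      then show "1 * real (y choose r) + (real (x1 choose (k - 1)) - real (x1 choose r)) \<le> real (y choose (k - 1))"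
        using binomial_difference_mono[OF k1 n2k x1(1), of y] unfolding r_def by linarith
    qed (use x1 False aY Yr in \<open>simp_all add: r_def a_def\<close>)
    moreover have "real ((n - 1) choose (k - 1)) + 2 \<le> real a + real M + real (card L) + real f1"
      using size cF Bp(1) unfolding f1_def by linarith
    moreover have "real w + 2 = real f1 + real M" using w_eq unfolding f1_def M_def by linarith
    ultimately show ?thesis using mid unfolding V(2) a_def r_def by linarith
  qed
  then show ?thesis using x unfolding a_def A_def by blast
qed

section \<open>Isomorphism with the extremal family\<close>

lemma permutation_of_blocks:
  assumes "finite V" "x \<in> V" "A \<subseteq> V" "C \<subseteq> V" "x \<notin> A" "x \<notin> C" "A \<inter> C = {}"
    and "x' \<in> V" "A' \<subseteq> V" "C' \<subseteq> V" "x' \<notin> A'" "x' \<notin> C'" "A' \<inter> C' = {}"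
    and "card A = card A'" "card C = card C'"
  obtains \<pi> where "\<pi> permutes V" "\<pi> x = x'" "\<pi> ` A = A'" "\<pi> ` C = C'"
proof -
  have fin: "finite A" "finite C" "finite A'" "finite C'"
    using assms(3,4,9,10) finite_subset[OF _ assms(1)] by auto
  define D where "D = V - (insert x A \<union> C)"
  define D' where "D' = V - (insert x' A' \<union> C')"
  have "card (insert x A \<union> C) = card (insert x' A' \<union> C')"
    using fin assms by (subst (1 2) card_Un_disjoint) auto
  then have cD: "card D = card D'" unfolding D_def D'_def
    using assms fin by (subst (1 2) card_Diff_subset) auto
  obtain g where g: "bij_betw g A A'" using fin assms(14) finite_same_card_bij by blast
  obtain h where h: "bij_betw h C C'" using fin assms(15) finite_same_card_bij by blast
  obtain e where e: "bij_betw e D D'" using cD assms(1) finite_same_card_bij[of D D'] unfolding D_def D'_def by auto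
  define \<pi> where "\<pi> y = (if y = x then x' else if y \<in> A then g y else if y \<in> C then h y else if y \<in> D then e y else y)" for y
  have b1: "bij_betw \<pi> {x} {x'}" by (simp add: \<pi>_def bij_betw_def)
  have b2: "bij_betw \<pi> A A'" using g assms(5) by (subst bij_betw_cong[of _ _ g]) (auto simp: \<pi>_def)
  have b3: "bij_betw \<pi> C C'" using h assms(6,7) by (subst bij_betw_cong[of _ _ h]) (auto simp: \<pi>_def)
  have b4: "bij_betw \<pi> D D'" using e by (subst bij_betw_cong[of _ _ e]) (auto simp: \<pi>_def D_def)
  have "bij_betw \<pi> ((({x} \<union> A) \<union> C) \<union> D) ((({x'} \<union> A') \<union> C') \<union> D')"
    using assms by (intro bij_betw_combine b1 b2 b3 b4) (auto simp: D'_def)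
  moreover have "(({x} \<union> A) \<union> C) \<union> D = V" "(({x'} \<union> A') \<union> C') \<union> D' = V"
    unfolding D_def D'_def using assms by auto
  ultimately have "bij_betw \<pi> V V" by simp
  then have "\<pi> permutes V"
    by (rule bij_imp_permutes) (use assms in \<open>auto simp: \<pi>_def D_def\<close>)
  then show thesis using that b2 b3 by (auto simp: bij_betw_def \<pi>_def)
qed

lemma card_containing_avoiding:
  assumes "finite V" "x \<in> V" "A \<subseteq> V - {x}" "1 \<le> k"
  shows "card {S. S \<subseteq> V \<and> card S = k \<and> x \<in> S \<and> S \<inter> A = {}} = (card V - 1 - card A) choose (k - 1)"
proof -
  let ?L = "{S. S \<subseteq> V \<and> card S = k \<and> x \<in> S \<and> S \<inter> A = {}}"
  let ?R = "{S. S \<subseteq> V - {x} - A \<and> card S = k - 1}"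
  have "bij_betw (\<lambda>S. S - {x}) ?L ?R"
  proof (rule bij_betw_byWitness[where f' = "insert x"])
    show "(\<lambda>S. S - {x}) ` ?L \<subseteq> ?R" by auto
    show "insert x ` ?R \<subseteq> ?L"
    proof
      fix T assume "T \<in> insert x ` ?R"
      then obtain S where S: "T = insert x S" "S \<subseteq> V - {x} - A" "card S = k - 1" by auto
      then have "finite S" "x \<notin> S" using finite_subset[of S V] assms(1) by auto
      then have "card T = k" using S assms(4) by simp
      then show "T \<in> ?L" using S assms by auto
    qed
  qed auto
  then have "card ?L = card ?R" by (rule bij_betw_same_card)
  also have "\<dots> = card (V - {x} - A) choose (k - 1)" using assms(1) by (intro n_subsets) auto
  also have "card (V - {x} - A) = card V - 1 - card A"
    using assms finite_subset[OF assms(3)] by (subst card_Diff_subset) auto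
  finally show ?thesis .
qed

text \<open>If \<open>A\<close> is the only set avoiding \<open>x\<close>, all other members meet
  \<open>A\<close> in a set through \<open>x\<close>, except for at most one partner of
  \<open>A\<close>. Equality forces every set through \<open>x\<close> meeting \<open>A\<close>, and
  the partner, to be present; a permutation then carries \<open>x\<close>, \<open>A\<close> and the
  partner to 1, {2..k+1} and any prescribed \<open>B\<close>.\<close>

lemma single_avoiding_structure:
  assumes F: "\<F> \<subseteq> ksubsets n k" and ai: "almost_intersecting \<F>" and k: "1 \<le> k"
    and x: "x \<in> {1..n}" and one: "card {S\<in>\<F>. x \<notin> S} = 1"
  shows "int (card \<F>) \<le>
           int ((n - 1) choose (k - 1)) - int ((n - k - 1) choose (k - 1)) + 2 \<and>
         (int (card \<F>) =
            int ((n - 1) choose (k - 1)) - int ((n - k - 1) choose (k - 1)) + 2 \<longrightarrow>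
          (\<forall>B. admissible_extra n k B \<longrightarrow> isomorphic_families n \<F> (B_plus n k B)))"
proof -
  obtain A where A: "{S\<in>\<F>. x \<notin> S} = {A}" using one by (auto simp: card_1_singleton_iff)
  have AF: "A \<in> \<F>" "x \<notin> A" using A by auto
  have AV: "A \<subseteq> {1..n}" "card A = k" using AF F unfolding ksubsets_def by auto
  have fin: "finite (ksubsets n k)" unfolding ksubsets_def by auto
  define T where "T = {S\<in>ksubsets n k. x \<in> S \<and> S \<inter> A \<noteq> {}}"
  define E where "E = {S\<in>\<F>. x \<in> S \<and> S \<inter> A = {}}"
  have fT: "finite T" unfolding T_def using fin by simp
  have fE: "finite E" unfolding E_def using finite_subset[OF F fin] by auto
  have eq: "\<F> = insert A ((\<F> \<inter> T) \<union> E)"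
  proof
    show "\<F> \<subseteq> insert A ((\<F> \<inter> T) \<union> E)" using A F unfolding T_def E_def by blast
    show "insert A ((\<F> \<inter> T) \<union> E) \<subseteq> \<F>" using AF unfolding E_def by auto
  qed
  have cE: "card E \<le> 1"
  proof -
    have "S = S'" if "S \<in> E" "S' \<in> E" for S S'
      using almost_intersecting_unique[OF ai AF(1), of S S'] that unfolding E_def by (auto simp: Int_commute)
    then show ?thesis using card_le_Suc0_iff_eq[OF fE] by auto
  qed
  have "card \<F> = card (insert A ((\<F> \<inter> T) \<union> E))" using eq by simp
  also have "\<dots> = 1 + (card (\<F> \<inter> T) + card E)"
  proof -
    have "A \<notin> (\<F> \<inter> T) \<union> E" "(\<F> \<inter> T) \<inter> E = {}" using AF unfolding T_def E_def by auto
    then show ?thesis using fT fE by (simp add: card_Un_disjoint)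
  qed
  finally have cF: "card \<F> = 1 + card (\<F> \<inter> T) + card E" by simp
  have cFT: "card (\<F> \<inter> T) \<le> card T" using fT by (intro card_mono) auto
  have cT: "int (card T) = int ((n - 1) choose (k - 1)) - int ((n - k - 1) choose (k - 1))"
  proof -
    let ?N = "{S. S \<subseteq> {1..n} \<and> card S = k \<and> x \<in> S \<and> S \<inter> A = {}}"
    have c1: "card {S. S \<subseteq> {1..n} \<and> card S = k \<and> x \<in> S \<and> S \<inter> {} = {}} = (n - 1) choose (k - 1)"
      using card_containing_avoiding[of "{1..n}" x "{}" k] x k by simp
    have "A \<subseteq> {1..n} - {x}" using AV AF by auto
    then have c2: "card ?N = (n - k - 1) choose (k - 1)"
      using card_containing_avoiding[of "{1..n}" x A k] x k AV by (simp add: diff_commute)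
    have u: "{S. S \<subseteq> {1..n} \<and> card S = k \<and> x \<in> S \<and> S \<inter> {} = {}} = T \<union> ?N"
      unfolding T_def ksubsets_def by auto
    have "card (T \<union> ?N) = card T + card ?N"
      using fT by (intro card_Un_disjoint) (auto simp: T_def)
    then show ?thesis using c1 c2 unfolding u by simp
  qed
  show ?thesis
  proof (intro conjI impI allI)
    show "int (card \<F>) \<le> int ((n - 1) choose (k - 1)) - int ((n - k - 1) choose (k - 1)) + 2"
      using cF cFT cT cE by linarith
    fix B assume full: "int (card \<F>) = int ((n - 1) choose (k - 1)) - int ((n - k - 1) choose (k - 1)) + 2"
      and B: "admissible_extra n k B"
    have "card (\<F> \<inter> T) = card T" "card E = 1" using full cF cFT cT cE by linarith+
    then have FT: "\<F> \<inter> T = T" using fT by (intro card_subset_eq) auto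
    obtain B0 where B0: "E = {B0}" using \<open>card E = 1\<close> by (auto simp: card_1_singleton_iff)
    have B0F: "B0 \<in> \<F>" "x \<in> B0" "B0 \<inter> A = {}" using B0 unfolding E_def by auto
    have B0V: "B0 \<subseteq> {1..n}" "card B0 = k" using B0F F unfolding ksubsets_def by auto
    have BV: "B \<subseteq> {1..n}" "card B = k" "1 \<in> B" "B \<inter> {2..k+1} = {}"
      using B unfolding admissible_extra_def ksubsets_def by auto
    have finB: "finite B" "finite B0" using finite_subset[OF BV(1)] finite_subset[OF B0V(1)] by auto
    \<comment> \<open>The disjoint k-sets \<open>A\<close> and \<open>B0\<close> supply 2k \<le> n,
      so that {2..k+1} lies in the ground set.\<close>
    have "card (A \<union> B0) = 2 * k" using AV B0V B0F finB finite_subset[OF AV(1)] by (subst card_Un_disjoint) auto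
    moreover have "card (A \<union> B0) \<le> card {1..n}" using AV B0V by (intro card_mono) auto
    ultimately have "2 * k \<le> n" by simp
    then have kn: "{2..k+1} \<subseteq> {1..n}" using k by auto
    have "1 \<in> {1..n}" using x by auto
    have c: "card (B0 - {x}) = card (B - {1})" using finB B0V BV B0F by simp
    obtain \<pi> where \<pi>: "\<pi> permutes {1..n}" "\<pi> x = 1" "\<pi> ` A = {2..k+1}" "\<pi> ` (B0 - {x}) = B - {1}"
      by (rule permutation_of_blocks[of "{1..n}" x A "B0 - {x}" 1 "{2..k+1}" "B - {1}"])
        (use x AV AF B0V B0F BV kn c \<open>1 \<in> {1..n}\<close> in auto)
    have inj: "inj \<pi>" using \<pi>(1) by (rule permutes_inj)
    have img: "\<pi> ` S \<in> ksubsets n k \<longleftrightarrow> S \<in> ksubsets n k" for S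
    proof -
      have "card (\<pi> ` S) = card S" using inj by (intro card_image) (auto intro: inj_on_subset)
      moreover have "\<pi> ` S \<subseteq> {1..n} \<longleftrightarrow> S \<subseteq> {1..n}"
        using permutes_in_image[OF \<pi>(1)] by (auto simp: image_subset_iff)
      ultimately show ?thesis unfolding ksubsets_def by simp
    qed
    have "\<pi> ` B0 = insert (\<pi> x) (\<pi> ` (B0 - {x}))" using B0F by auto
    then have piB: "\<pi> ` B0 = B" using \<pi> BV by auto
    have mem: "1 \<in> \<pi> ` S \<longleftrightarrow> x \<in> S" for S using inj_image_mem_iff[OF inj, of x S] \<pi>(2) by simp
    have meet: "\<pi> ` S \<inter> {2..k+1} \<noteq> {} \<longleftrightarrow> S \<inter> A \<noteq> {}" for S
      unfolding \<pi>(3)[symmetric] image_Int[OF inj, symmetric] by simp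
    have piT: "(\<lambda>S. \<pi> ` S) ` T = {B\<in>ksubsets n k. 1 \<in> B \<and> B \<inter> {2..k+1} \<noteq> {}}" (is "_ = ?R")
    proof
      show "(\<lambda>S. \<pi> ` S) ` T \<subseteq> ?R" using img mem meet unfolding T_def by auto
      show "?R \<subseteq> (\<lambda>S. \<pi> ` S) ` T"
      proof
        fix S assume S: "S \<in> ?R"
        have "\<pi> ` (inv \<pi> ` S) = S" using \<pi>(1) permutes_surj by (metis image_f_inv_f)
        then show "S \<in> (\<lambda>S. \<pi> ` S) ` T"
          using S img[of "inv \<pi> ` S"] mem[of "inv \<pi> ` S"] meet[of "inv \<pi> ` S"]
          by (intro image_eqI[of _ _ "inv \<pi> ` S"]) (auto simp: T_def)
      qed
    qed
    have "(\<lambda>S. \<pi> ` S) ` \<F> = (\<lambda>S. \<pi> ` S) ` (insert A (T \<union> {B0}))" using eq FT B0 by simp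
    also have "\<dots> = insert {2..k+1} (?R \<union> {B})" unfolding piT[symmetric] using \<pi>(3) piB by auto
    also have "\<dots> = B_plus n k B" unfolding B_plus_def hilton_milner_def by auto
    finally show "isomorphic_families n \<F> (B_plus n k B)"
      unfolding isomorphic_families_def using \<pi>(1) by metis
  qed
qed

section \<open>Binomial estimates\<close>

lemma choose_Suc_absorb: "Suc d * (m choose Suc d) = (m choose d) * (m - d)"
  using binomial_absorption[of d m] binomial_absorb_comp[of m d] by (simp add: mult.commute)

lemma choose_Suc_absorb_real:
  "j \<le> m \<Longrightarrow> real (m choose Suc j) * real (Suc j) = real (m choose j) * (real m - real j)"
  using choose_Suc_absorb[of j m] by (metis mult.commute of_nat_diff of_nat_mult)

text \<open>Each factor obeys (v - j)/(a - j) \<le> v/a; the denominators are cleared.\<close>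

lemma binomial_ratio_power:
  assumes "v \<le> a"
  shows "(v choose d) * a ^ d \<le> (a choose d) * v ^ d"
proof (induction d)
  case (Suc d)
  have absorb: "Suc d * ((m choose Suc d) * z ^ Suc d) = ((m choose d) * z ^ d) * ((m - d) * z)" for m z
  proof -
    have "Suc d * ((m choose Suc d) * z ^ Suc d) = (Suc d * (m choose Suc d)) * (z * z ^ d)"
      by (simp only: mult.assoc power_Suc)
    then show ?thesis unfolding choose_Suc_absorb by (simp only: mult_ac)
  qed
  have step: "(v - d) * a \<le> (a - d) * v"
    using assms by (simp add: diff_mult_distrib mult.commute[of a v] diff_le_mono2 mult_le_mono2)
  have "Suc d * ((v choose Suc d) * a ^ Suc d) = ((v choose d) * a ^ d) * ((v - d) * a)"
    by (rule absorb)
  also have "\<dots> \<le> ((a choose d) * v ^ d) * ((a - d) * v)"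
    by (rule mult_le_mono[OF Suc.IH step])
  also have "\<dots> = Suc d * ((a choose Suc d) * v ^ Suc d)"
    by (rule absorb[symmetric])
  finally show ?case using Suc_mult_le_cancel1 by blast
qed simp

text \<open>With a = q - u and d = v - u, the quotient C(q, v)/C(q, u) equals C(a, d)/C(v, d), which
  is at least (a/v)^d and by Bernoulli at least 1 + d(a/v - 1).\<close>

lemma binomial_ratio_linear:
  assumes "u \<le> v" "u + v \<le> q" "1 \<le> v"
  shows "(q choose u) * (v + (v - u) * (q - u - v)) \<le> v * (q choose v)"
proof -
  define a where "a = q - u"
  define d where "d = v - u"
  have va: "v \<le> a" unfolding a_def using assms by simp
  have "(q choose v) * (v choose u) = (q choose u) * (a choose d)"
    unfolding a_def d_def using assms by (intro choose_mult) auto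
  moreover have "v choose u = v choose d" unfolding d_def using assms by (intro binomial_symmetric)
  ultimately have id: "(q choose v) * (v choose d) = (q choose u) * (a choose d)" by simp
  have "((q choose u) * a ^ d) * (v choose d) \<le> (q choose u) * ((a choose d) * v ^ d)"
    using binomial_ratio_power[OF va, of d] by (simp add: mult_ac)
  also have "\<dots> = ((q choose v) * v ^ d) * (v choose d)" using id by (simp add: mult_ac)
  finally have pow: "(q choose u) * a ^ d \<le> (q choose v) * v ^ d"
    unfolding d_def using assms by simp
  have "1 + real d * (real a / real v - 1) \<le> (1 + (real a / real v - 1)) ^ d"
    using va assms(3) by (intro Bernoulli_inequality) (simp add: field_simps)
  then have "1 + real d * (real a / real v - 1) \<le> (real a / real v) ^ d" by simp
  then have "real (q choose u) * (1 + real d * (real a / real v - 1)) \<le> real (q choose u) * (real a / real v) ^ d"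
    by (intro mult_left_mono) auto
  also have "\<dots> \<le> real (q choose v)"
    using pow assms(3) by (simp add: power_divide divide_simps of_nat_mult[symmetric] of_nat_power[symmetric] del: of_nat_mult of_nat_power)
  finally have "real (q choose u) * (real v + real d * (real a - real v)) \<le> real v * real (q choose v)"
    using assms(3) by (simp add: field_simps)
  moreover have "real a - real v = real (q - u - v)" unfolding a_def using assms by simp
  ultimately have "real ((q choose u) * (v + d * (q - u - v))) \<le> real (v * (q choose v))" by simp
  then show ?thesis unfolding d_def by (simp only: of_nat_le_iff)
qed

lemma binomial_lower_step:
  assumes "1 \<le> m"
  shows "real ((m - 1) choose c) * real m = real (m choose c) * (real m - real c)"
proof (cases "c \<le> m")
  case True
  have "(m - c) * (m choose c) = m * ((m - 1) choose c)" by (rule binomial_absorb_comp)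
  then have "real (m - c) * real (m choose c) = real m * real ((m - 1) choose c)"
    by (metis of_nat_mult)
  then show ?thesis using True by (simp add: of_nat_diff mult.commute)
qed (simp add: binomial_eq_0)

text \<open>C(m-1, c)/C(m, c) = 1 - c/m, and over m \<le> q this factor is largest at q, where
  \<open>\<theta>\<close> bounds it.\<close>

lemma binomial_geometric_decay:
  fixes \<theta> :: real
  assumes "d \<le> q" "real q - real c \<le> \<theta> * real q" "0 \<le> \<theta>" "\<theta> \<le> 1"
  shows "real ((q - d) choose c) \<le> \<theta> ^ d * real (q choose c)"
  using assms(1)
proof (induction d)
  case (Suc d)
  let ?m = "q - d"
  have m: "1 \<le> ?m" "?m - 1 = q - Suc d" using Suc.prems by auto
  have "real ?m - real c \<le> \<theta> * real ?m"
  proof -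
    have "\<theta> * real d \<le> real d" using assms(3,4) by (simp add: mult_left_le_one_le)
    then show ?thesis using assms(2) Suc.prems by (simp add: of_nat_diff algebra_simps)
  qed
  then have "real ((q - Suc d) choose c) * real ?m \<le> real (?m choose c) * (\<theta> * real ?m)"
    using binomial_lower_step[OF m(1), of c] m(2) by (simp add: mult_left_mono)
  then have "real ((q - Suc d) choose c) * real ?m \<le> (\<theta> * real (?m choose c)) * real ?m"
    by (simp only: mult_ac)
  moreover have "0 < real ?m" using m(1) by linarith
  ultimately have "real ((q - Suc d) choose c) \<le> \<theta> * real (?m choose c)" by (rule mult_right_le_imp_le)
  also have "\<dots> \<le> \<theta> * (\<theta> ^ d * real (q choose c))" using Suc assms(3) by (intro mult_left_mono) auto
  finally show ?case by simp
qed simp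

text \<open>With N = 2k-1, two Pascal steps give C(N+2, k-2) \<ge> C(N, k-2) + 2 C(N, k-3). By the
  exact ratios of neighbouring coefficients this dominates C(N, k-1) as soon as (k+2)(k+1) \<le>
  (k-1)(3k-2), that is, for k \<ge> 4.\<close>

lemma half_binomial_le:
  assumes "4 \<le> k" "2 * k + 1 \<le> m"
  shows "(2 * k - 1) choose (k - 1) \<le> m choose (k - 2)"
proof -
  define N where "N = 2 * k - 1"
  note absorb = choose_Suc_absorb_real[of _ N]
  have N: "real N = 2 * real k - 1" unfolding N_def using assms by (simp add: of_nat_diff)
  have e: "Suc (k - 2) = k - 1" "Suc (k - 3) = k - 2" using assms by auto
  let ?M = "real (N choose (k - 1))" and ?B = "real (N choose (k - 2))" and ?C = "real (N choose (k - 3))"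
  have r: "real (k - 2) = real k - 2" "real (k - 3) = real k - 3" "real (k - 1) = real k - 1"
    using assms by (auto simp: of_nat_diff)
  have jN: "k - 2 \<le> N" "k - 3 \<le> N" unfolding N_def using assms by linarith+
  have 1: "?M * (real k - 1) = ?B * (real k + 1)"
    using absorb[OF jN(1)] unfolding e r N by simp
  have 2: "?B * (real k - 2) = ?C * (real k + 2)"
    using absorb[OF jN(2)] unfolding e r N by simp
  have "?M \<le> ?B + 2 * ?C"
  proof -
    have k: "4 \<le> real k" using assms by simp
    have "(?B + 2 * ?C) * (real k + 2) = ?B * (3 * real k - 2)" using 2 by (simp add: algebra_simps)
    then have "(?B + 2 * ?C) * ((real k + 2) * (real k + 1)) = (?B * (real k + 1)) * (3 * real k - 2)"
      by (simp add: mult_ac)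
    also have "\<dots> = ?M * ((real k - 1) * (3 * real k - 2))" using 1 by (simp add: mult_ac)
    also have "\<dots> \<ge> ?M * ((real k + 2) * (real k + 1))"
    proof (rule mult_left_mono)
      have "4 * real k \<le> real k * real k" using k by (intro mult_right_mono) auto
      then show "(real k + 2) * (real k + 1) \<le> (real k - 1) * (3 * real k - 2)" by (simp add: algebra_simps)
    qed simp
    finally show ?thesis using k by (simp add: mult_le_cancel_right_pos)
  qed
  also have "?B + 2 * ?C \<le> real (Suc (Suc N) choose Suc (k - 3))"
  proof -
    have "Suc (Suc N) choose Suc (k - 3) = (N choose Suc (k - 3)) + (N choose (k - 3)) + (Suc N choose (k - 3))" by simp
    moreover have "N choose (k - 3) \<le> Suc N choose (k - 3)" by (intro binomial_right_mono) auto
    ultimately show ?thesis unfolding e by linarith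
  qed
  finally have "(2 * k - 1) choose (k - 1) \<le> Suc (Suc N) choose (k - 2)" unfolding e N_def by simp
  also have "\<dots> \<le> m choose (k - 2)" using assms by (intro binomial_right_mono) (auto simp: N_def)
  finally show ?thesis .
qed

text \<open>The slope is checked increment by increment. The linear ratio bound for the indices x -
  (n-2-k) and k-2 gives 2 + 1/(k-2) once (n-4-x)(n-2k) \<ge> k-1. The parameter \<open>t\<close>
  keeps \<open>x\<close> far enough below n-4 for that.\<close>

lemma slope_bound:
  assumes k: "4 \<le> k" and n: "2 * k \<le> n" and t: "k - 1 \<le> (t + 1) * (n - 2 * k)"
    and x: "n - 1 - k \<le> x" "x + t + 4 \<le> n"
  shows "(2 + 1 / real (k - 2)) * real (x choose (n - 1 - k)) +
    (real ((n - k - 1) choose (k - 1)) - (2 + 1 / real (k - 2))) \<le> real (x choose (k - 1))"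
proof -
  define \<kappa> where "\<kappa> = 2 + 1 / real (k - 2)"
  define r where "r = n - 1 - k"
  have rk: "k - 1 \<le> r" "n - k - 1 = r" unfolding r_def using k n by linarith+
  have "\<kappa> * real ((r + d) choose r) + (real (r choose (k - 1)) - \<kappa>) \<le> real ((r + d) choose (k - 1))"
    if "r + d + t + 4 \<le> n" for d
    using that
  proof (induction d)
    case (Suc d)
    let ?x = "r + d"
    have u: "Suc d \<le> k - 2" using Suc.prems rk unfolding r_def by linarith
    have eq: "?x - Suc d - (k - 2) = n - 2 * k" "k - 2 - Suc d = n - 4 - ?x"
      unfolding r_def using k n u Suc.prems by linarith+
    have "(?x choose Suc d) * ((k - 2) + (k - 2 - Suc d) * (?x - Suc d - (k - 2))) \<le> (k - 2) * (?x choose (k - 2))"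
      using u rk k by (intro binomial_ratio_linear) linarith+
    moreover have "2 * (k - 2) + 1 \<le> (k - 2) + (k - 2 - Suc d) * (?x - Suc d - (k - 2))"
    proof -
      have "t + 1 \<le> n - 4 - ?x" using Suc.prems by linarith
      then have "(t + 1) * (n - 2 * k) \<le> (n - 4 - ?x) * (n - 2 * k)" by (rule mult_le_mono1)
      then show ?thesis unfolding eq using t k by linarith
    qed
    ultimately have "(?x choose Suc d) * (2 * (k - 2) + 1) \<le> (k - 2) * (?x choose (k - 2))"
      by (meson le_trans mult_le_mono2)
    then have "real ((?x choose Suc d) * (2 * (k - 2) + 1)) \<le> real ((k - 2) * (?x choose (k - 2)))"
      by (simp only: of_nat_le_iff)
    then have "\<kappa> * real (?x choose Suc d) \<le> real (?x choose (k - 2))"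
      unfolding \<kappa>_def using k by (simp add: field_simps)
    moreover have "?x choose Suc d = ?x choose (r - 1)"
      using rk k by (intro choose_complement) linarith+
    ultimately have inc: "\<kappa> * real (?x choose (r - 1)) \<le> real (?x choose (k - 2))" by simp
    have p1: "real (Suc ?x choose r) = real (?x choose r) + real (?x choose (r - 1))"
      using choose_pred_split[of "Suc ?x" r] rk k by simp
    have "k - 1 - 1 = k - 2" by simp
    then have p2: "real (Suc ?x choose (k - 1)) = real (?x choose (k - 1)) + real (?x choose (k - 2))"
      using choose_pred_split[of "Suc ?x" "k - 1"] k by simp
    have "\<kappa> * real (?x choose r) + (real (r choose (k - 1)) - \<kappa>) \<le> real (?x choose (k - 1))"
      using Suc by simp
    then show ?case using inc p1 p2 by (simp add: distrib_left)
  qed simp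
  from this[of "x - r"] show ?thesis using x rk unfolding \<kappa>_def r_def by simp
qed

text \<open>With P = n-k-1 and c = k-1 the ratios are Y/X = c/P and Z/X = c(c-1)/(P(P+1)). Since
  P(P+1) - c(c-1) = (P+c)(P+1-c), a common factor P + c cancels.\<close>

lemma shifted_gap_criterion:
  fixes n k w :: nat
  assumes k: "3 \<le> k" and n: "2 * k \<le> n"
    and R: "real w * ((real n - real k - 1) * (real n - real k)) <
      real ((n - 3) choose (k - 1)) * ((real n - 2 * real k) * (real n - 2 * real k + 1))"
  shows "real w * (real ((n - 3) choose (k - 1)) + real ((n - 3) choose (k - 2))) <
      (real ((n - 3) choose (k - 1)) - real ((n - 3) choose (k - 2))) *
      (real ((n - 3) choose (k - 1)) - real ((n - 3) choose (k - 3)))"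
proof -
  let ?X = "real ((n - 3) choose (k - 1))" and ?Y = "real ((n - 3) choose (k - 2))" and ?Z = "real ((n - 3) choose (k - 3))"
  note absorb = choose_Suc_absorb_real
  define P where "P = real n - real k - 1"
  define c where "c = real k - 1"
  have e: "Suc (k - 2) = k - 1" "Suc (k - 3) = k - 2" "real (k - 2) = real k - 2" "real (k - 3) = real k - 3"
    "real (k - 1) = real k - 1" "real (n - 3) = real n - 3" using k n by (auto simp: of_nat_diff)
  have j: "k - 2 \<le> n - 3" "k - 3 \<le> n - 3" using k n by linarith+
  have Y: "?X * c = ?Y * P" using absorb[OF j(1)] unfolding e P_def c_def by simp
  have Z: "?Y * (c - 1) = ?Z * (P + 1)" using absorb[OF j(2)] unfolding e P_def c_def by simp
  have P0: "0 < P" "0 < c" unfolding P_def c_def using k n by linarith+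
  have X0: "0 < ?X" using k n by simp
  have Yv: "?Y = ?X * c / P" using Y P0 by (simp add: field_simps)
  have "?Z = ?Y * (c - 1) / (P + 1)" using Z P0 by (simp add: eq_divide_eq)
  then have Zv: "?Z = ?X * c * (c - 1) / (P * (P + 1))" unfolding Yv by simp
  have A: "?X + ?Y = ?X * (P + c) / P" unfolding Yv using P0 by (simp add: field_simps)
  have "(?X - ?Y) * (?X - ?Z) = (?X * (P - c) / P) * (?X * ((P + c) * (P + 1 - c)) / (P * (P + 1)))"
  proof -
    have "?X - ?Y = ?X * (P - c) / P" unfolding Yv using P0 by (simp add: field_simps)
    moreover have "?X - ?Z = ?X * ((P + c) * (P + 1 - c)) / (P * (P + 1))"
      unfolding Zv using P0 by (simp add: divide_simps) (simp add: algebra_simps)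
    ultimately show ?thesis by simp
  qed
  also have "\<dots> = (?X * (P + c) / (P * P * (P + 1))) * (?X * ((P - c) * (P + 1 - c)))" by (simp add: mult_ac)
  also have "\<dots> > (?X * (P + c) / (P * P * (P + 1))) * (real w * (P * (P + 1)))"
  proof (rule mult_strict_left_mono)
    show "real w * (P * (P + 1)) < ?X * ((P - c) * (P + 1 - c))"
      using R unfolding P_def c_def by (simp add: algebra_simps)
    show "0 < ?X * (P + c) / (P * P * (P + 1))" using X0 P0 by simp
  qed
  finally have "(?X * (P + c) / (P * P * (P + 1))) * (real w * (P * (P + 1))) < (?X - ?Y) * (?X - ?Z)" .
  moreover have "(?X * (P + c) / (P * P * (P + 1))) * (real w * (P * (P + 1))) = real w * (?X + ?Y)"
  proof -
    have "u / (P * q) * (real w * q) = real w * (u / P)" if "q \<noteq> 0" for u q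
      using that P0 by (simp add: field_simps)
    from this[of "P * (P + 1)"] show ?thesis unfolding A using P0 by (simp add: mult.assoc)
  qed
  ultimately show ?thesis by simp
qed

text \<open>A step in \<open>k\<close> multiplies the left side by at most 4 and the right side by
  at least 4. The base k = 7 is 8 * 1716 \<le> 15504; at k = 6 the inequality is false.\<close>

lemma central_binomial_growth:
  assumes "7 \<le> k"
  shows "8 * ((2 * k - 1) choose (k - 1)) \<le> (3 * k - 1) choose (k - 2)"
  using assms
proof (induction k rule: nat_induct_at_least)
  case base
  have "(13::nat) choose 6 = 1716" "(20::nat) choose 5 = 15504"
    by (simp_all add: binomial_fact' fact_numeral)
  then show ?case by simp
next
  case (Suc k)
  define i where "i = k - 2"
  have i: "k = i + 2" unfolding i_def using Suc.hyps by simp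
  have e: "2 * Suc k - 1 = Suc (Suc (2 * k - 1))" "Suc k - 1 = Suc (Suc i)" "k - 1 = Suc i"
    "3 * Suc k - 1 = Suc (Suc (Suc (3 * k - 1)))" "Suc k - 2 = Suc i" "k - 2 = i" using i by auto
  let ?N = "2 * k - 1" and ?L = "3 * k - 1"
  have "?N choose Suc (Suc i) = ?N choose Suc i" using i by (intro choose_complement) auto
  moreover have "?N choose i \<le> ?N choose Suc i" using i by (intro binomial_le_of_sum_le) auto
  ultimately have 1: "Suc (Suc ?N) choose Suc (Suc i) \<le> 4 * (?N choose Suc i)" by simp
  have "?L choose i \<le> ?L choose Suc i" using i by (intro binomial_le_of_sum_le) auto
  then have 2: "4 * (?L choose i) \<le> Suc (Suc (Suc ?L)) choose Suc i"
    by (cases i) auto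
  show ?case using Suc.IH 1 2 unfolding e by linarith
qed

text \<open>Rests on the factorisation (2u-1)^2 - u^6 = (1-u)(u^2+u-1)(2u-1+u^3), whose last factor
  is at least 1/2 for u \<ge> 2/3.\<close>

lemma one_variable_estimate:
  fixes u \<beta> \<gamma> :: real
  assumes "2 / 3 \<le> u" "u \<le> 1" "\<gamma> * u\<^sup>2 \<le> u\<^sup>2 + u - 1" "0 \<le> \<gamma>" "\<beta> \<le> \<gamma> / 2"
  shows "(u ^ 4 + (1 - u) * \<beta>) * u\<^sup>2 \<le> (2 * u - 1)\<^sup>2"
proof -
  have "(2 / 3) ^ 3 \<le> u ^ 3" using assms by (intro power_mono) auto
  then have c: "1 / 2 \<le> 2 * u - 1 + u ^ 3" using assms by (simp add: power_divide)
  have "\<beta> * u\<^sup>2 \<le> \<gamma> / 2 * u\<^sup>2" using assms by (intro mult_right_mono) auto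
  also have "\<dots> = (\<gamma> * u\<^sup>2) * (1 / 2)" by simp
  also have "\<dots> \<le> (u\<^sup>2 + u - 1) * (2 * u - 1 + u ^ 3)"
  proof (rule mult_mono[OF assms(3) c])
    have "0 \<le> \<gamma> * u\<^sup>2" using assms(4) by simp
    then show "0 \<le> u\<^sup>2 + u - 1" using assms(3) by linarith
  qed simp
  finally have "(1 - u) * (\<beta> * u\<^sup>2) \<le> (1 - u) * ((u\<^sup>2 + u - 1) * (2 * u - 1 + u ^ 3))"
    using assms by (intro mult_left_mono) auto
  also have "\<dots> = (2 * u - 1)\<^sup>2 - u ^ 6"
    by (simp add: power2_eq_square power3_eq_cube eval_nat_numeral algebra_simps)
  finally show ?thesis by (simp add: algebra_simps power_add[symmetric])
qed

text \<open>Everything is expressed through u = 1 - (k-1)/(n-3), which is at least 2/3. The first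
  coefficient is at most u^4 X by four decay steps, the second at most \<beta>(1-u)X, and the right
  side is at least X((2u-1)/u)^2 times the quadratic factor on the left.\<close>

lemma shifted_gap_ge_six:
  assumes k: "6 \<le> k" and n: "3 * k + 3 \<le> n"
  shows "real (((n - k - 1) choose (k - 1)) + ((2 * k - 1) choose (k - 1))) * ((real n - real k - 1) * (real n - real k))
    \<le> real ((n - 3) choose (k - 1)) * ((real n - 2 * real k) * (real n - 2 * real k + 1))"
proof -
  define q where "q = n - 3"
  define c where "c = k - 1"
  let ?q = "real q" and ?c = "real c"
  have qc: "?q = real n - 3" "?c = real k - 1" unfolding q_def c_def using k n by (auto simp: of_nat_diff)
  have q3: "3 * k \<le> q" "1 \<le> q" "1 \<le> c" unfolding q_def c_def using k n by linarith+
  have q0: "0 < ?q" using q3 by simp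
  define u where "u = 1 - ?c / ?q"
  have uq: "u * ?q = ?q - ?c" unfolding u_def using q0 by (simp add: algebra_simps)
  define X where "X = real (q choose c)"
  have X0: "0 \<le> X" unfolding X_def by simp
  have c3: "3 * ?c \<le> ?q" using q3(1) qc(2) by linarith
  have u23: "2 / 3 \<le> u" "u \<le> 1" unfolding u_def using c3 q0 by (auto simp: field_simps)
  have f1: "real ((n - k - 1) choose (k - 1)) \<le> u ^ 4 * X"
  proof -
    have "(n - k - 1) choose (k - 1) \<le> (q - 4) choose c"
      unfolding c_def q_def using k n by (intro binomial_right_mono) linarith
    moreover have "real ((q - 4) choose c) \<le> u ^ 4 * real (q choose c)"
      by (rule binomial_geometric_decay) (use uq u23 q3 k in auto)
    ultimately show ?thesis unfolding X_def by linarith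
  qed
  have cX: "?c * X = ?q * real ((q - 1) choose (c - 1))"
    unfolding X_def using times_binomial_minus1_eq[of c q] q3(3) by (metis of_nat_mult less_eq_Suc_le One_nat_def)
  have "\<exists>\<beta> \<gamma>. real ((2 * k - 1) choose (k - 1)) \<le> \<beta> * real ((q - 1) choose (c - 1)) \<and>
      \<gamma> * u\<^sup>2 \<le> u\<^sup>2 + u - 1 \<and> 0 \<le> \<gamma> \<and> \<beta> \<le> \<gamma> / 2"
  proof (cases "k = 6")
    case True
    have "(11::nat) choose 5 = 462" "(17::nat) choose 4 = 2380"
      by (simp_all add: binomial_fact' fact_numeral)
    moreover have "(17::nat) choose 4 \<le> (q - 1) choose (c - 1)"
      unfolding c_def True using q3 True by (simp add: binomial_right_mono)
    ultimately have 1: "real ((2 * k - 1) choose (k - 1)) \<le> (1 / 5) * real ((q - 1) choose (c - 1))"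
      unfolding True by simp
    have "13 / 18 \<le> u" unfolding u_def c_def True using q3(1) True q0 by (simp add: field_simps)
    then have "(13 / 18) * (13 / 18) \<le> u * u" by (intro mult_mono) auto
    then have "(2 / 5) * u\<^sup>2 \<le> u\<^sup>2 + u - 1" using \<open>13 / 18 \<le> u\<close> by (simp add: power2_eq_square)
    then show ?thesis using 1 by (intro exI[of _ "1 / 5"] exI[of _ "2 / 5"]) auto
  next
    case False
    then have "8 * ((2 * k - 1) choose (k - 1)) \<le> (3 * k - 1) choose (k - 2)"
      using k by (intro central_binomial_growth) simp
    also have "\<dots> \<le> (q - 1) choose (c - 1)"
      unfolding c_def using q3(1) by (simp add: binomial_right_mono numeral_2_eq_2)
    finally have 1: "real ((2 * k - 1) choose (k - 1)) \<le> (1 / 8) * real ((q - 1) choose (c - 1))" by linarith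
    have "(2 / 3) * (2 / 3) \<le> u * u" using u23 by (intro mult_mono) auto
    then have "(1 / 4) * u\<^sup>2 \<le> u\<^sup>2 + u - 1" using u23 by (simp add: power2_eq_square)
    then show ?thesis using 1 by (intro exI[of _ "1 / 8"] exI[of _ "1 / 4"]) auto
  qed
  then obtain \<beta> \<gamma> where \<beta>: "real ((2 * k - 1) choose (k - 1)) \<le> \<beta> * real ((q - 1) choose (c - 1))"
    and \<gamma>: "\<gamma> * u\<^sup>2 \<le> u\<^sup>2 + u - 1" "0 \<le> \<gamma>" "\<beta> \<le> \<gamma> / 2" by blast
  have "real ((q - 1) choose (c - 1)) = (1 - u) * X"
    unfolding u_def using cX q0 by (simp add: field_simps)
  with \<beta> have "real ((2 * k - 1) choose (k - 1)) \<le> \<beta> * ((1 - u) * X)" by (simp only:)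
  then have W: "real (((n - k - 1) choose (k - 1)) + ((2 * k - 1) choose (k - 1))) \<le> X * (u ^ 4 + (1 - u) * \<beta>)"
    using f1 by (simp add: algebra_simps)
  define P where "P = real n - real k - 1"
  have P: "P = ?q - ?c + 1" unfolding P_def qc by simp
  have p0: "0 < ?q - ?c" using c3 q0 by linarith
  define z where "z = (2 * u - 1) / u"
  have u0: "0 < u" using u23 by simp
  have z0: "0 \<le> z" unfolding z_def using u23 by simp
  have zp: "z * (?q - ?c) = ?q - 2 * ?c"
  proof -
    have "z * (u * ?q) = (2 * u - 1) * ?q" unfolding z_def using u0 by simp
    also have "\<dots> = 2 * (u * ?q) - ?q" by (simp add: algebra_simps)
    finally show ?thesis unfolding uq by simp
  qed
  have "z \<le> 1" unfolding z_def using u0 u23 by simp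
  then have z1: "z * P \<le> P - ?c" "z * (P + 1) \<le> P + 1 - ?c"
    unfolding P using zp z0 by (simp_all add: algebra_simps)
  have est: "u ^ 4 + (1 - u) * \<beta> \<le> z\<^sup>2"
    unfolding z_def power_divide using one_variable_estimate[OF u23 \<gamma>] u0 by (simp add: pos_le_divide_eq)
  have PP: "0 \<le> P" "0 \<le> P * (P + 1)" using p0 unfolding P by auto
  have "real (((n - k - 1) choose (k - 1)) + ((2 * k - 1) choose (k - 1))) * (P * (P + 1))
      \<le> (X * z\<^sup>2) * (P * (P + 1))"
    using W mult_left_mono[OF est X0] PP by (intro mult_right_mono) auto
  also have "\<dots> = X * ((z * P) * (z * (P + 1)))" by (simp add: power2_eq_square mult_ac)
  also have "\<dots> \<le> X * ((P - ?c) * (P + 1 - ?c))"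
  proof (intro mult_left_mono mult_mono X0 z1)
    show "0 \<le> P - ?c" unfolding P using c3 q0 by linarith
    show "0 \<le> z * (P + 1)" using z0 PP(1) by simp
  qed
  finally show ?thesis unfolding P_def X_def c_def[symmetric] q_def[symmetric] qc(2)
    by (simp add: algebra_simps)
qed

lemma real_choose_four: "real (m choose 4) * 24 = real m * (real m - 1) * (real m - 2) * (real m - 3)"
proof -
  have "fact 4 * (real m gchoose 4) = (\<Prod>i = 0..<4. real m - real i)" by (rule gbinomial_mult_fact)
  moreover have "{0..<4::nat} = {0, 1, 2, 3}" by auto
  ultimately show ?thesis by (simp add: binomial_gbinomial fact_numeral mult_ac)
qed

text \<open>Here C(9, 4) - 2 = 124. With m = n-6, after multiplication by 24, the claim reduces to
  2976 < (m-3)(4m^2 - 16m - 24), whose right side is 3240 at m = 12.\<close>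

lemma shifted_gap_five:
  assumes n: "18 \<le> n"
  shows "(real ((n - 6) choose 4) + 124) * ((real n - 6) * (real n - 5))
    < real ((n - 3) choose 4) * ((real n - 10) * (real n - 9))"
proof -
  define m where "m = real n - 6"
  have m: "12 \<le> m" unfolding m_def using n by simp
  have r: "real (n - 6) = m" "real (n - 3) = m + 3" unfolding m_def using n by (auto simp: of_nat_diff)
  have A: "real ((n - 6) choose 4) * 24 = m * (m - 1) * (m - 2) * (m - 3)" using real_choose_four[of "n - 6"] unfolding r .
  have B: "real ((n - 3) choose 4) * 24 = (m + 3) * (m + 2) * (m + 1) * m"
    using real_choose_four[of "n - 3"] unfolding r by (simp add: algebra_simps)
  have "12 * 12 \<le> m * m" using m by (intro mult_mono) auto
  moreover have "12 * m \<le> m * m" using m by (intro mult_right_mono) auto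
  ultimately have "360 \<le> 4 * (m * m) - 16 * m - 24" using m by linarith
  then have "9 * 360 \<le> (m - 3) * (4 * (m * m) - 16 * m - 24)" using m by (intro mult_mono) linarith+
  then have "m * (m - 1) * (m - 2) * (m - 3) + 2976 < (m + 3) * (m + 2) * (m - 4) * (m - 3)"
    by (simp add: algebra_simps)
  then have "(m * (m - 1) * (m - 2) * (m - 3) + 2976) * (m * (m + 1)) < ((m + 3) * (m + 2) * (m - 4) * (m - 3)) * (m * (m + 1))"
    using m by (intro mult_strict_right_mono) auto
  moreover have "(m * (m - 1) * (m - 2) * (m - 3) + 2976) * (m * (m + 1)) = 24 * ((real ((n - 6) choose 4) + 124) * (m * (m + 1)))"
    unfolding A[symmetric] by (simp add: algebra_simps)
  moreover have "((m + 3) * (m + 2) * (m - 4) * (m - 3)) * (m * (m + 1)) = 24 * (real ((n - 3) choose 4) * ((m - 4) * (m - 3)))"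
  proof -
    have "24 * (real ((n - 3) choose 4) * ((m - 4) * (m - 3))) = (real ((n - 3) choose 4) * 24) * ((m - 4) * (m - 3))" by simp
    then show ?thesis unfolding B by (simp only: mult_ac)
  qed
  ultimately have "(real ((n - 6) choose 4) + 124) * (m * (m + 1)) < real ((n - 3) choose 4) * ((m - 4) * (m - 3))" by linarith
  then show ?thesis unfolding m_def by (simp add: algebra_simps)
qed

lemma power_decay:
  assumes "7 \<le> s"
  shows "(7 / 10 :: real) ^ s * (real s + 2)\<^sup>2 \<le> 10"
  using assms
proof (induction s rule: nat_induct_at_least)
  case base then show ?case by (simp add: power_divide)
next
  case (Suc s)
  have "7 / 10 * (real (Suc s) + 2)\<^sup>2 \<le> (real s + 2)\<^sup>2"
  proof -
    have s: "7 \<le> real s" using Suc.hyps by simp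
    have "7 * real s \<le> real s * real s" using s by (intro mult_right_mono) auto
    moreover have "(real s + 2)\<^sup>2 - 7 / 10 * (real (Suc s) + 2)\<^sup>2 = 3 / 10 * (real s * real s) - 1 / 5 * real s - 23 / 10"
      by (simp add: power2_eq_square field_simps)
    ultimately show ?thesis using s by linarith
  qed
  then have "(7 / 10) ^ s * (7 / 10 * (real (Suc s) + 2)\<^sup>2) \<le> (7 / 10) ^ s * (real s + 2)\<^sup>2"
    by (intro mult_left_mono) auto
  moreover have "(7 / 10) ^ s * (7 / 10 * (real (Suc s) + 2)\<^sup>2) = (7 / 10) ^ Suc s * (real (Suc s) + 2)\<^sup>2"
    by (simp only: power_Suc mult_ac)
  ultimately show ?case using Suc.IH by linarith
qed

text \<open>\<open>s\<close> is the excess of \<open>n\<close> over 2k+4. The range n > 2k + 2 sqrt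
  k + 4 becomes 4k < s^2, and n < 3k+3 becomes s+2 \<le> k. The latter makes 7/10 a valid decay
  factor, so both unwanted coefficients are exponentially small in \<open>s\<close>, while s^2 > 4k
  keeps the polynomial loss of order s^2.\<close>

lemma near_double_gaps:
  fixes k s :: nat
  assumes k: "10 \<le> k" and s: "4 * k < s * s" and sk: "s + 2 \<le> k" and n: "n = 2 * k + s + 4"
  shows "7 \<le> s"
    and "real (((n - k - 1) choose (k - 1)) + ((2 * k - 1) choose (k - 1))) * ((real n - real k - 1) * (real n - real k))
    \<le> real ((n - 3) choose (k - 1)) * ((real n - 2 * real k) * (real n - 2 * real k + 1))"
    and "k - 1 \<le> (s div 4 + 1) * (n - 2 * k)"
    and "((n - k - 1) choose (k - 1)) + ((2 * k - 1) choose (k - 1)) + ((n - 4 - s div 4) choose (n - 1 - k))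
      \<le> (n - 4 - s div 4) choose (k - 1)"
proof -
  show s7: "7 \<le> s"
  proof (rule ccontr)
    assume "\<not> 7 \<le> s"
    then have "s * s \<le> 6 * 6" by (intro mult_le_mono) auto
    then show False using k s by simp
  qed
  define c where "c = k - 1"
  define \<theta> where "\<theta> = (7 / 10 :: real)"
  have decay: "real ((q - d) choose c) \<le> \<theta> ^ d * real (q choose c)" if "d \<le> q" "q \<le> n - 3" for q d
  proof (rule binomial_geometric_decay[OF that(1)])
    have "3 * q \<le> 10 * c" using that(2) n sk k unfolding c_def by linarith
    then have "3 * real q \<le> 10 * real c" by linarith
    then show "real q - real c \<le> \<theta> * real q" unfolding \<theta>_def by simp
  qed (auto simp: \<theta>_def)
  have \<theta>mono: "\<theta> ^ i \<le> \<theta> ^ j" if "j \<le> i" for i j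
    unfolding \<theta>_def using that by (intro power_decreasing) auto
  define X where "X = real ((n - 3) choose c)"
  have X0: "0 \<le> X" unfolding X_def by simp
  have "n - 3 - (k - 2) = n - k - 1" "k - 2 \<le> n - 3" using n k by linarith+
  then have a: "real ((n - k - 1) choose c) \<le> \<theta> ^ (k - 2) * X" using decay[of "k - 2" "n - 3"] unfolding X_def by simp
  have "n - 3 - (s + 2) = 2 * k - 1" "s + 2 \<le> n - 3" using n k by linarith+
  then have b: "real ((2 * k - 1) choose c) \<le> \<theta> ^ (s + 2) * X" using decay[of "s + 2" "n - 3"] unfolding X_def by simp
  \<comment> \<open>The two terms contribute the factors 1 and 49/100 of
    \<open>\<theta> ^ s\<close>, together below 3/2.\<close>
  have "\<theta> ^ (k - 2) * X \<le> \<theta> ^ s * X" using sk X0 by (intro mult_right_mono \<theta>mono) auto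
  then have W: "real (((n - k - 1) choose c) + ((2 * k - 1) choose c)) \<le> (3 / 2 * \<theta> ^ s) * X"
    using a b X0 unfolding power_add by (simp add: \<theta>_def power2_eq_square)
  let ?s = "real s" and ?k = "real k"
  have kk: "4 * ?k \<le> ?s * ?s" using s by (metis less_imp_le of_nat_le_iff of_nat_mult of_nat_numeral)
  have s7r: "7 \<le> ?s" using s7 by simp
  have e: "4 * (?k + ?s + 3) \<le> (?s + 4) * (?s + 2)" "4 * (?k + ?s + 4) \<le> (?s + 5) * (?s + 2)"
    using kk s7r by (auto simp: algebra_simps)
  have "(4 * (?k + ?s + 3)) * (4 * (?k + ?s + 4)) \<le> ((?s + 4) * (?s + 2)) * ((?s + 5) * (?s + 2))"
    by (rule mult_mono[OF e]) auto
  then have prod: "(?k + ?s + 3) * (?k + ?s + 4) \<le> ((?s + 4) * (?s + 5)) * ((?s + 2)\<^sup>2 / 16)"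
    by (simp add: power2_eq_square algebra_simps)
  have "(3 / 2 * \<theta> ^ s) * ((?k + ?s + 3) * (?k + ?s + 4)) \<le> (3 / 2 * \<theta> ^ s) * (((?s + 4) * (?s + 5)) * ((?s + 2)\<^sup>2 / 16))"
    using prod by (intro mult_left_mono) (auto simp: \<theta>_def)
  also have "\<dots> = ((?s + 4) * (?s + 5)) * (3 / 32 * (\<theta> ^ s * (?s + 2)\<^sup>2))" by simp
  also have "\<dots> \<le> ((?s + 4) * (?s + 5)) * 1"
    using power_decay[OF s7] unfolding \<theta>_def by (intro mult_left_mono) auto
  finally have est: "(3 / 2 * \<theta> ^ s) * ((?k + ?s + 3) * (?k + ?s + 4)) \<le> (?s + 4) * (?s + 5)" by simp
  have nr: "real n = 2 * ?k + ?s + 4" using n by simp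
  have "real (((n - k - 1) choose c) + ((2 * k - 1) choose c)) * ((?k + ?s + 3) * (?k + ?s + 4))
      \<le> ((3 / 2 * \<theta> ^ s) * X) * ((?k + ?s + 3) * (?k + ?s + 4))"
    using W by (intro mult_right_mono) auto
  also have "\<dots> = X * ((3 / 2 * \<theta> ^ s) * ((?k + ?s + 3) * (?k + ?s + 4)))" by (simp add: mult_ac)
  also have "\<dots> \<le> X * ((?s + 4) * (?s + 5))" using est X0 by (intro mult_left_mono) auto
  finally show "real (((n - k - 1) choose (k - 1)) + ((2 * k - 1) choose (k - 1))) * ((real n - real k - 1) * (real n - real k))
    \<le> real ((n - 3) choose (k - 1)) * ((real n - 2 * real k) * (real n - 2 * real k + 1))"
    unfolding nr X_def c_def by (simp add: algebra_simps)
  \<comment> \<open>A compromise: (t+1)(s+4) has to reach k-1, for which s^2 > 4k suffices, while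
    \<open>s - t + 1\<close> and \<open>k - 3 - t\<close> must stay at least 5 so that the decay at
    \<open>x1\<close> is strong enough.\<close>
  define t where "t = s div 4"
  have t: "4 * t \<le> s" "s + 1 \<le> 4 * (t + 1)" unfolding t_def by presburger+
  have n2k: "n - 2 * k = s + 4" using n by simp
  have "(s + 1) * (s + 4) \<le> (4 * (t + 1)) * (s + 4)" using t(2) by (rule mult_le_mono1)
  then have tk: "k - 1 \<le> (t + 1) * (s + 4)" using s by (simp add: algebra_simps)
  then show "k - 1 \<le> (s div 4 + 1) * (n - 2 * k)" unfolding n2k t_def .
  define x1 where "x1 = n - 4 - t"
  have x1: "x1 = 2 * k + s - t" unfolding x1_def n by simp
  have tk3: "t + 3 \<le> k" "t \<le> s" using t sk k by linarith+
  let ?u = "k - 3 - t"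
  have "(x1 choose ?u) * (c + (c - ?u) * (x1 - ?u - c)) \<le> c * (x1 choose c)"
    unfolding c_def x1 using tk3 k by (intro binomial_ratio_linear) linarith+
  moreover have "2 * c \<le> c + (c - ?u) * (x1 - ?u - c)"
  proof -
    have "c - ?u = t + 2" "x1 - ?u - c = s + 4" unfolding c_def x1 using tk3 k by linarith+
    then show ?thesis using tk unfolding c_def by (simp add: algebra_simps)
  qed
  ultimately have "(x1 choose ?u) * (2 * c) \<le> c * (x1 choose c)" by (meson le_trans mult_le_mono2)
  then have half: "2 * (x1 choose ?u) \<le> x1 choose c" using k unfolding c_def by simp
  have comp: "x1 choose (n - 1 - k) = x1 choose ?u"
    unfolding x1 n using tk3 by (intro choose_complement) linarith+
  have "x1 - ?u = n - k - 1" "?u \<le> x1" "x1 - (s - t + 1) = 2 * k - 1" "s - t + 1 \<le> x1" "x1 \<le> n - 3"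
    unfolding x1 n using tk3 k by linarith+
  then have "real ((n - k - 1) choose c) \<le> \<theta> ^ ?u * real (x1 choose c)"
    "real ((2 * k - 1) choose c) \<le> \<theta> ^ (s - t + 1) * real (x1 choose c)"
    using decay[of ?u x1] decay[of "s - t + 1" x1] by simp_all
  moreover have "5 \<le> ?u" "5 \<le> s - t + 1" using t s7 sk k by linarith+
  then have "\<theta> ^ ?u * real (x1 choose c) \<le> \<theta> ^ 5 * real (x1 choose c)"
    "\<theta> ^ (s - t + 1) * real (x1 choose c) \<le> \<theta> ^ 5 * real (x1 choose c)"
    by (intro mult_right_mono \<theta>mono; simp)+
  moreover have "\<theta> ^ 5 \<le> 17 / 100" unfolding \<theta>_def by (simp add: power_divide)
  then have "\<theta> ^ 5 * real (x1 choose c) \<le> 17 / 100 * real (x1 choose c)" by (intro mult_right_mono) auto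
  ultimately have "real ((n - k - 1) choose c) + real ((2 * k - 1) choose c) \<le> 1 / 2 * real (x1 choose c)"
    by linarith
  then have "((n - k - 1) choose c) + ((2 * k - 1) choose c) + (x1 choose (n - 1 - k)) \<le> x1 choose c"
    using half unfolding comp by linarith
  then show "((n - k - 1) choose (k - 1)) + ((2 * k - 1) choose (k - 1)) + ((n - 4 - s div 4) choose (n - 1 - k))
      \<le> (n - 4 - s div 4) choose (k - 1)"
    unfolding c_def x1_def t_def by simp
qed

section \<open>The case of triples\<close>

lemma card_le_of_cover:
  assumes "A \<subseteq> B \<union> C" "finite B" "finite C" "card B \<le> b" "card C \<le> c"
  shows "card A \<le> b + c"
proof -
  have "card A \<le> card (B \<union> C)" using assms by (intro card_mono) auto
  also have "\<dots> \<le> card B + card C" by (rule card_Un_le)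
  finally show ?thesis using assms by linarith
qed

text \<open>For \<open>x\<close> of maximum degree, consider the points \<open>H\<close> that share
  at least 5 triples with \<open>x\<close>. Each of them lies in every triple avoiding
  \<open>x\<close>, so |H| \<le> 3. Three such points determine the only avoiding triple; with
  fewer, two or more avoiding triples leave the family too small.\<close>

lemma three_single_avoiding_set:
  assumes F: "\<F> \<subseteq> {S. S \<subseteq> {1..n} \<and> card S = 3}" and ai: "almost_intersecting \<F>"
    and n: "13 \<le> n" and size: "3 * n \<le> card \<F> + 7"
  shows "\<exists>x\<in>{1..n}. card {S\<in>\<F>. x \<notin> S} = 1"
proof -
  have fF: "finite \<F>" using F by (rule finite_subset) auto
  have S3: "card S = 3" "S \<subseteq> {1..n}" "finite S" if "S \<in> \<F>" for S
    using F that finite_subset[of S "{1..n}"] by auto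
  have dj: "card {T\<in>\<F>. S \<inter> T = {}} \<le> 1" if "S \<in> \<F>" for S
    using almost_intersecting_unique[OF ai that] fF card_le_Suc0_iff_eq[of "{T\<in>\<F>. S \<inter> T = {}}"] by auto
  have dj': "card {T\<in>\<F>. P T \<and> S \<inter> T = {}} \<le> 1" if "S \<in> \<F>" for S P
  proof -
    have "card {T\<in>\<F>. P T \<and> S \<inter> T = {}} \<le> card {T\<in>\<F>. S \<inter> T = {}}" using fF by (intro card_mono) auto
    then show ?thesis using dj[OF that] by simp
  qed
  have pair: "card {S\<in>\<F>. x \<in> S \<and> y \<in> S \<and> S \<inter> W \<noteq> {}} \<le> card W"
    if "x \<noteq> y" "x \<notin> W" "y \<notin> W" "finite W" for x y W
  proof (rule surj_card_le[OF that(4), of _ "\<lambda>z. {x, y, z}"])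
    show "{S\<in>\<F>. x \<in> S \<and> y \<in> S \<and> S \<inter> W \<noteq> {}} \<subseteq> (\<lambda>z. {x, y, z}) ` W"
    proof
      fix S assume "S \<in> {S\<in>\<F>. x \<in> S \<and> y \<in> S \<and> S \<inter> W \<noteq> {}}"
      then obtain z where S: "S \<in> \<F>" "x \<in> S" "y \<in> S" "z \<in> S" "z \<in> W" by auto
      have "z \<noteq> x" "z \<noteq> y" using that S by auto
      then have "card {x, y, z} = 3" using that(1) by simp
      then have "{x, y, z} = S" using S S3[of S] by (intro card_subset_eq) auto
      then show "S \<in> (\<lambda>z. {x, y, z}) ` W" using S by auto
    qed
  qed
  have third: "S \<inter> ({1..n} - {x, y}) \<noteq> {}" if "S \<in> \<F>" for S x y
  proof
    assume "S \<inter> ({1..n} - {x, y}) = {}"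
    then have "S \<subseteq> {x, y}" using S3[OF that] by auto
    then have "card S \<le> card {x, y}" by (intro card_mono) auto
    also have "\<dots> \<le> 2" by (simp add: card_insert_if)
    finally show False using S3[OF that] by simp
  qed
  define deg where "deg x = card {S\<in>\<F>. x \<in> S}" for x
  have "{1..n} \<noteq> {}" using n by simp
  then obtain x where x: "x \<in> {1..n}" and xmax: "\<And>y. y \<in> {1..n} \<Longrightarrow> deg y \<le> deg x"
    using ex_has_greatest_nat[of "\<lambda>y. y \<in> {1..n}" 1 deg "Suc (card \<F>)"] n fF
    by (auto simp: deg_def card_mono less_Suc_eq_le)
  define d where "d = deg x"
  define A where "A = {S\<in>\<F>. x \<notin> S}"
  define a where "a = card A"
  have fA: "finite A" unfolding A_def using fF by simp
  have ad: "card \<F> = a + d"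
  proof -
    have "card (A \<union> {S\<in>\<F>. x \<in> S}) = card A + card {S\<in>\<F>. x \<in> S}"
      using fF by (intro card_Un_disjoint) (auto simp: A_def)
    moreover have "A \<union> {S\<in>\<F>. x \<in> S} = \<F>" unfolding A_def by auto
    ultimately show ?thesis unfolding a_def d_def deg_def by simp
  qed
  obtain T0 where T0: "T0 \<in> A"
    using ai unfolding almost_intersecting_def intersecting_def A_def by blast
  have a1: "1 \<le> a" unfolding a_def using T0 fA by (metis One_nat_def Suc_leI card_gt_0_iff empty_iff)
  have AF: "T \<in> \<F>" "x \<notin> T" if "T \<in> A" for T using that unfolding A_def by auto
  have cover3: "card {S\<in>\<F>. P S} \<le> (\<Sum>y\<in>T. card {S\<in>\<F>. P S \<and> y \<in> S}) + 1" if T: "T \<in> \<F>" for T P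
  proof -
    have "card (\<Union>y\<in>T. {S\<in>\<F>. P S \<and> y \<in> S}) \<le> (\<Sum>y\<in>T. card {S\<in>\<F>. P S \<and> y \<in> S})"
      using S3[OF T] by (intro card_UN_le) auto
    moreover have "{S\<in>\<F>. P S} \<subseteq> (\<Union>y\<in>T. {S\<in>\<F>. P S \<and> y \<in> S}) \<union> {S\<in>\<F>. P S \<and> T \<inter> S = {}}" by auto
    ultimately show ?thesis using dj'[OF T, of P] fF S3[OF T]
      by (intro card_le_of_cover[of "{S\<in>\<F>. P S}" _ "{S\<in>\<F>. P S \<and> T \<inter> S = {}}"]) auto
  qed
  have d_lower: "n - 2 \<le> d"
  proof -
    have "card \<F> \<le> (\<Sum>y\<in>T0. deg y) + 1" using cover3[of T0 "\<lambda>_. True"] AF[OF T0] unfolding deg_def by simp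
    also have "(\<Sum>y\<in>T0. deg y) \<le> (\<Sum>y\<in>T0. d)"
      unfolding d_def using xmax S3[OF AF(1)[OF T0]] by (intro sum_mono) auto
    also have "\<dots> = 3 * d" using S3[OF AF(1)[OF T0]] by simp
    finally show ?thesis using size by linarith
  qed
  define cd where "cd y = card {S\<in>\<F>. x \<in> S \<and> y \<in> S}" for y
  have cd_max: "cd y \<le> n - 2" if "y \<in> {1..n}" "y \<noteq> x" for y
  proof -
    have "cd y = card {S\<in>\<F>. x \<in> S \<and> y \<in> S \<and> S \<inter> ({1..n} - {x, y}) \<noteq> {}}"
      unfolding cd_def using third by (intro arg_cong[of _ _ card]) blast
    also have "\<dots> \<le> card ({1..n} - {x, y})" using that by (intro pair) auto
    also have "\<dots> = n - 2" using that x by (subst card_Diff_subset) auto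
    finally show ?thesis .
  qed
  \<comment> \<open>If \<open>T\<close> avoids both \<open>x\<close> and \<open>y\<close>, at most 3
    triples through \<open>x\<close> and \<open>y\<close> meet \<open>T\<close> and at most one
    misses it.\<close>
  have in_T: "y \<in> T" if y: "y \<noteq> x" "5 \<le> cd y" and T: "T \<in> A" for y T
  proof (rule ccontr)
    assume "y \<notin> T"
    have "card {S\<in>\<F>. x \<in> S \<and> y \<in> S \<and> S \<inter> T \<noteq> {}} \<le> 3"
      using pair[of x y T] y \<open>y \<notin> T\<close> AF[OF T] S3[OF AF(1)[OF T]] by simp
    then have "cd y \<le> 3 + 1" unfolding cd_def using dj'[OF AF(1)[OF T], of "\<lambda>_. True"] fF
      by (intro card_le_of_cover[of _ "{S\<in>\<F>. x \<in> S \<and> y \<in> S \<and> S \<inter> T \<noteq> {}}" "{S\<in>\<F>. True \<and> T \<inter> S = {}}"]) auto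
    then show False using y by simp
  qed
  define H where "H = {y\<in>{1..n} - {x}. 5 \<le> cd y}"
  have HT: "H \<subseteq> T" if "T \<in> A" for T using in_T that unfolding H_def by auto
  have fH: "finite H" unfolding H_def by simp
  have H3: "card H \<le> 3" using card_mono[OF _ HT[OF T0]] S3[OF AF(1)[OF T0]] by simp
  have low: "cd y \<le> 4" if "y \<in> {1..n}" "y \<noteq> x" "y \<notin> H" for y using that unfolding H_def by auto
  consider "card H = 3" | "card H = 2" | "card H = 1" | "card H = 0" using H3 by linarith
  then have "a = 1"
  proof cases
    case 1
    have "T = H" if "T \<in> A" for T
      using HT[OF that] 1 S3[OF AF(1)[OF that]] by (metis card_subset_eq)
    then have "A = {H}" using T0 by auto
    then show ?thesis unfolding a_def by simp
  next
    case 2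
    then obtain y z where yz: "H = {y, z}" "y \<noteq> z" by (auto simp: card_2_iff)
    have yzx: "y \<in> {1..n}" "z \<in> {1..n}" "y \<noteq> x" "z \<noteq> x" using yz unfolding H_def by auto
    have A_yz: "y \<in> T" "z \<in> T" if "T \<in> A" for T using HT[OF that] yz by auto
    show ?thesis
    proof (rule ccontr)
      assume "a \<noteq> 1"
      then have "2 \<le> a" using a1 by simp
      define R where "R = {1..n} - {x, y, z}"
      have R: "finite R" "card R = n - 3" unfolding R_def using x yzx yz by (auto simp: card_Diff_subset)
      have form: "\<exists>u\<in>R. T = {y, z, u}" if T: "T \<in> A" for T
      proof -
        obtain u where u: "u \<in> T" "u \<in> {1..n} - {y, z}" using third[OF AF(1)[OF T], of y z] by blast
        have "card {y, z, u} = 3" using u yz by auto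
        then have "{y, z, u} = T" using u A_yz[OF T] S3[OF AF(1)[OF T]] by (intro card_subset_eq) auto
        moreover have "u \<noteq> x" using u AF[OF T] by auto
        ultimately show ?thesis using u unfolding R_def by auto
      qed
      have a_max: "a \<le> n - 3"
        unfolding a_def R(2)[symmetric] using form by (intro surj_card_le[OF R(1), of _ "\<lambda>u. {y, z, u}"]) auto
      \<comment> \<open>If {y, z, u} and {y, z, v} avoid \<open>x\<close>, a member of
        \<open>Q\<close> meeting both is {x, u, v}, and at most two others occur. With four avoiding
        triples \<open>Q\<close> is empty: a member has only two points besides \<open>x\<close>, so
        it would miss two of them.\<close>
      define Q where "Q = {S\<in>\<F>. x \<in> S \<and> y \<notin> S \<and> z \<notin> S}"
      have zny: "card {S\<in>\<F>. x \<in> S \<and> z \<in> S \<and> y \<notin> S} \<le> n - 3"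
      proof -
        have "{S\<in>\<F>. x \<in> S \<and> z \<in> S \<and> y \<notin> S} \<subseteq> {S\<in>\<F>. x \<in> S \<and> z \<in> S \<and> S \<inter> R \<noteq> {}}"
          using third[of _ x z] unfolding R_def by fastforce
        then have "card {S\<in>\<F>. x \<in> S \<and> z \<in> S \<and> y \<notin> S} \<le> card {S\<in>\<F>. x \<in> S \<and> z \<in> S \<and> S \<inter> R \<noteq> {}}"
          using fF by (intro card_mono) auto
        also have "\<dots> \<le> card R" using yzx R by (intro pair) (auto simp: R_def)
        finally show ?thesis using R by simp
      qed
      have "d \<le> (n - 2) + (n - 3) + card Q"
      proof -
        have "card ({S\<in>\<F>. x \<in> S \<and> y \<in> S} \<union> {S\<in>\<F>. x \<in> S \<and> z \<in> S \<and> y \<notin> S}) \<le> (n - 2) + (n - 3)"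
          using cd_max[OF yzx(1,3)] zny fF unfolding cd_def by (intro card_le_of_cover[OF order.refl]) auto
        then show ?thesis unfolding d_def deg_def
          by - (rule card_le_of_cover[of _ "{S\<in>\<F>. x \<in> S \<and> y \<in> S} \<union> {S\<in>\<F>. x \<in> S \<and> z \<in> S \<and> y \<notin> S}" Q];
            use fF in \<open>auto simp: Q_def\<close>)
      qed
      moreover have "card Q \<le> 3"
      proof -
        have "\<not> card A \<le> Suc 0" using \<open>2 \<le> a\<close> unfolding a_def by simp
        then obtain T1 T2 where T12: "T1 \<in> A" "T2 \<in> A" "T1 \<noteq> T2"
          using card_le_Suc0_iff_eq[OF fA] by blast
        obtain u v where uv: "u \<in> R" "T1 = {y, z, u}" "v \<in> R" "T2 = {y, z, v}"
          using form[OF T12(1)] form[OF T12(2)] by auto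
        have "u \<noteq> v" using uv T12 by auto
        have c1: "card {S\<in>\<F>. x \<in> S \<and> u \<in> S \<and> S \<inter> {v} \<noteq> {}} \<le> 1"
          using pair[of x u "{v}"] uv \<open>u \<noteq> v\<close> unfolding R_def by auto
        have "card ({S\<in>\<F>. True \<and> T1 \<inter> S = {}} \<union> {S\<in>\<F>. True \<and> T2 \<inter> S = {}}) \<le> 1 + 1"
          using dj'[OF AF(1)[OF T12(1)], of "\<lambda>_. True"] dj'[OF AF(1)[OF T12(2)], of "\<lambda>_. True"] fF
          by (intro card_le_of_cover[OF order.refl]) auto
        then have "card Q \<le> 1 + 1 + 1" using c1 fF
          by (intro card_le_of_cover[of Q "{S\<in>\<F>. True \<and> T1 \<inter> S = {}} \<union> {S\<in>\<F>. True \<and> T2 \<inter> S = {}}" "{S\<in>\<F>. x \<in> S \<and> u \<in> S \<and> S \<inter> {v} \<noteq> {}}"])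
            (auto simp: Q_def uv)
        then show ?thesis by simp
      qed
      moreover have "card Q = 0" if "4 \<le> a"
      proof -
        have False if "S \<in> Q" for S
        proof -
          have S: "S \<in> \<F>" "x \<in> S" "y \<notin> S" "z \<notin> S" using that unfolding Q_def by auto
          have "card {T\<in>A. S \<inter> T \<noteq> {}} \<le> card (S - {x})"
          proof (rule surj_card_le[of _ _ "\<lambda>u. {y, z, u}"])
            show "{T\<in>A. S \<inter> T \<noteq> {}} \<subseteq> (\<lambda>u. {y, z, u}) ` (S - {x})"
            proof
              fix T assume T: "T \<in> {T\<in>A. S \<inter> T \<noteq> {}}"
              then obtain u where "u \<in> R" "T = {y, z, u}" using form by auto
              then show "T \<in> (\<lambda>u. {y, z, u}) ` (S - {x})" using T S unfolding R_def by auto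
            qed
          qed (use S3[OF S(1)] in auto)
          then have "card {T\<in>A. S \<inter> T \<noteq> {}} \<le> 2" using S3[OF S(1)] S by simp
          then have "a \<le> 2 + 1" unfolding a_def using dj'[OF S(1), of "\<lambda>T. T \<in> A"] fF fA
            by (intro card_le_of_cover[of A "{T\<in>A. S \<inter> T \<noteq> {}}" "{T\<in>\<F>. T \<in> A \<and> S \<inter> T = {}}"])
              (auto simp: A_def)
          then show False using \<open>4 \<le> a\<close> by simp
        qed
        then have "Q = {}" by auto
        then show ?thesis by simp
      qed
      ultimately show False using ad size n a_max by (cases "4 \<le> a") auto
    qed
  next
    case 3
    then obtain y where y: "H = {y}" by (auto simp: card_1_singleton_iff)
    have yx: "y \<in> {1..n}" "y \<noteq> x" using y unfolding H_def by auto
    have yT: "y \<in> T" if "T \<in> A" for T using HT[OF that] y by auto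
    define e where "e = card {S\<in>\<F>. x \<in> S \<and> y \<notin> S}"
    have "d = cd y + e"
    proof -
      have "card ({S\<in>\<F>. x \<in> S \<and> y \<in> S} \<union> {S\<in>\<F>. x \<in> S \<and> y \<notin> S}) = cd y + e"
        unfolding cd_def e_def using fF by (intro card_Un_disjoint) auto
      moreover have "{S\<in>\<F>. x \<in> S \<and> y \<in> S} \<union> {S\<in>\<F>. x \<in> S \<and> y \<notin> S} = {S\<in>\<F>. x \<in> S}" by auto
      ultimately show ?thesis unfolding d_def deg_def by simp
    qed
    moreover have "deg y = cd y + a"
    proof -
      have "card ({S\<in>\<F>. x \<in> S \<and> y \<in> S} \<union> A) = cd y + a"
        unfolding cd_def a_def using fF by (intro card_Un_disjoint) (auto simp: A_def)
      moreover have "{S\<in>\<F>. x \<in> S \<and> y \<in> S} \<union> A = {S\<in>\<F>. y \<in> S}" using yT unfolding A_def by auto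
      ultimately show ?thesis unfolding deg_def by simp
    qed
    moreover have "deg y \<le> d" using xmax yx unfolding d_def by simp
    \<comment> \<open>Maximality of the degree of \<open>x\<close> against \<open>y\<close>: the
      triples through both cancel.\<close>
    ultimately have "a \<le> e" by simp
    moreover have "e \<le> 9"
    proof -
      have "e \<le> (\<Sum>u\<in>T0. card {S\<in>\<F>. (x \<in> S \<and> y \<notin> S) \<and> u \<in> S}) + 1"
        unfolding e_def by (rule cover3[OF AF(1)[OF T0]])
      also have "(\<Sum>u\<in>T0. card {S\<in>\<F>. (x \<in> S \<and> y \<notin> S) \<and> u \<in> S})
          = (\<Sum>u\<in>T0 - {y}. card {S\<in>\<F>. (x \<in> S \<and> y \<notin> S) \<and> u \<in> S})"
        using S3[OF AF(1)[OF T0]] by (intro sum.mono_neutral_right) auto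
      also have "\<dots> \<le> (\<Sum>u\<in>T0 - {y}. 4)"
      proof (rule sum_mono)
        fix u assume u: "u \<in> T0 - {y}"
        have "card {S\<in>\<F>. (x \<in> S \<and> y \<notin> S) \<and> u \<in> S} \<le> cd u"
          unfolding cd_def using fF by (intro card_mono) auto
        moreover have "cd u \<le> 4" using u y AF[OF T0] S3[OF AF(1)[OF T0]] by (intro low) auto
        ultimately show "card {S\<in>\<F>. (x \<in> S \<and> y \<notin> S) \<and> u \<in> S} \<le> 4" by simp
      qed
      also have "\<dots> = 8" using yT[OF T0] S3[OF AF(1)[OF T0]] by simp
      finally show ?thesis by simp
    qed
    ultimately show ?thesis using ad \<open>d = cd y + e\<close> cd_max[OF yx] size n by linarith
  next
    case 4
    then have H0: "H = {}" using fH by simp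
    have cd4: "cd y \<le> 4" if "y \<noteq> x" "y \<in> {1..n}" for y using low that H0 by auto
    have "d \<le> (\<Sum>u\<in>T0. card {S\<in>\<F>. x \<in> S \<and> u \<in> S}) + 1"
      unfolding d_def deg_def by (rule cover3[OF AF(1)[OF T0]])
    also have "(\<Sum>u\<in>T0. card {S\<in>\<F>. x \<in> S \<and> u \<in> S}) \<le> (\<Sum>u\<in>T0. 4)"
    proof (rule sum_mono)
      fix u assume "u \<in> T0"
      then have "u \<noteq> x" "u \<in> {1..n}" using AF[OF T0] S3[OF AF(1)[OF T0]] by auto
      then show "card {S\<in>\<F>. x \<in> S \<and> u \<in> S} \<le> 4" using cd4[of u] unfolding cd_def by simp
    qed
    also have "\<dots> = 12" using S3[OF AF(1)[OF T0]] by simp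
    finally have d13: "d \<le> 13" by simp
    have avoid: "\<exists>g h. {x, g, h} \<in> \<F> \<and> g \<noteq> h \<and> g \<noteq> x \<and> h \<noteq> x \<and> {g, h} \<inter> {p, q} = {}"
      if "p \<in> {1..n}" "q \<in> {1..n}" "p \<noteq> x" "q \<noteq> x" for p q
    proof (rule ccontr)
      assume no: "\<not> ?thesis"
      have sub: "{S\<in>\<F>. x \<in> S} \<subseteq> {S\<in>\<F>. x \<in> S \<and> p \<in> S} \<union> {S\<in>\<F>. x \<in> S \<and> q \<in> S}"
      proof
        fix S assume S: "S \<in> {S\<in>\<F>. x \<in> S}"
        have "card (S - {x}) = 2" using S S3[of S] by simp
        then obtain g h where gh: "S - {x} = {g, h}" "g \<noteq> h" by (auto simp: card_2_iff)
        then have "S = {x, g, h}" "g \<noteq> x" "h \<noteq> x" using S by auto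
        then show "S \<in> {S\<in>\<F>. x \<in> S \<and> p \<in> S} \<union> {S\<in>\<F>. x \<in> S \<and> q \<in> S}" using no gh S by auto
      qed
      have "d \<le> 4 + 4" unfolding d_def deg_def
        using fF cd4[of p] cd4[of q] that unfolding cd_def by (intro card_le_of_cover[OF sub]) auto
      then show False using d_lower n by simp
    qed
    obtain p q where pq: "{x, p, q} \<in> \<F>" "p \<noteq> q" "p \<noteq> x" "q \<noteq> x"
    proof -
      obtain y where y: "y \<in> T0" using S3[OF AF(1)[OF T0]] by fastforce
      then have "y \<in> {1..n}" "y \<noteq> x" using S3[OF AF(1)[OF T0]] AF[OF T0] by auto
      then show thesis using avoid[of y y] that by blast
    qed
    have pqn: "p \<in> {1..n}" "q \<in> {1..n}" using S3(2)[OF pq(1)] by auto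
    obtain r s where rs: "{x, r, s} \<in> \<F>" "r \<noteq> x" "s \<noteq> x" "{r, s} \<inter> {p, q} = {}"
      using avoid[OF pqn pq(3,4)] by blast
    have rsn: "r \<in> {1..n}" "s \<in> {1..n}" using S3(2)[OF rs(1)] by auto
    have c3: "card {T\<in>A. u \<in> T \<and> v \<in> T} \<le> 3"
      if uv: "u \<in> {1..n}" "v \<in> {1..n}" "u \<noteq> x" "v \<noteq> x" "u \<noteq> v" for u v
    proof -
      obtain g h where gh: "{x, g, h} \<in> \<F>" "{g, h} \<inter> {u, v} = {}" using avoid[OF uv(1-4)] by blast
      have "card {S\<in>\<F>. u \<in> S \<and> v \<in> S \<and> S \<inter> {g, h} \<noteq> {}} \<le> card {g, h}"
        using gh uv by (intro pair) auto
      also have "\<dots> \<le> 2" by (simp add: card_insert_if)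
      finally have "card {T\<in>A. u \<in> T \<and> v \<in> T} \<le> 2 + 1"
        using dj'[OF gh(1), of "\<lambda>T. T \<in> A"] fF fA
        by (intro card_le_of_cover[of _ "{S\<in>\<F>. u \<in> S \<and> v \<in> S \<and> S \<inter> {g, h} \<noteq> {}}" "{T\<in>\<F>. T \<in> A \<and> {x, g, h} \<inter> T = {}}"])
          (auto simp: A_def)
      then show ?thesis by simp
    qed
    \<comment> \<open>An avoiding triple that meets both {x, p, q} and {x, r, s} contains one of
      four pairs. Each pair lies in at most 3 avoiding triples, and at most 2 avoiding triples miss
      one of the two sets, so a \<le> 14.\<close>
    let ?E = "\<lambda>u v. {T\<in>A. u \<in> T \<and> v \<in> T}"
    have f: "finite (?E u v)" for u v using fA by simp
    have "card (?E p r \<union> ?E p s) \<le> 3 + 3" "card (?E q r \<union> ?E q s) \<le> 3 + 3"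
      by (intro card_le_of_cover[OF order.refl f f] c3; use pqn rsn pq rs in auto)+
    then have "card ((?E p r \<union> ?E p s) \<union> (?E q r \<union> ?E q s)) \<le> (3 + 3) + (3 + 3)"
      by - (rule card_le_of_cover[OF order.refl]; simp add: fA)
    moreover have "card ({T\<in>\<F>. T \<in> A \<and> {x, p, q} \<inter> T = {}} \<union> {T\<in>\<F>. T \<in> A \<and> {x, r, s} \<inter> T = {}}) \<le> 1 + 1"
      using dj'[OF pq(1), of "\<lambda>T. T \<in> A"] dj'[OF rs(1), of "\<lambda>T. T \<in> A"] fF
      by (intro card_le_of_cover[OF order.refl]) auto
    ultimately have "a \<le> ((3 + 3) + (3 + 3)) + (1 + 1)" unfolding a_def
      by - (rule card_le_of_cover[of A "(?E p r \<union> ?E p s) \<union> (?E q r \<union> ?E q s)" "{T\<in>\<F>. T \<in> A \<and> {x, p, q} \<inter> T = {}} \<union> {T\<in>\<F>. T \<in> A \<and> {x, r, s} \<inter> T = {}}"];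
        use fF fA AF in auto)
    then show ?thesis using ad d13 size n by linarith
  qed
  then show ?thesis using x unfolding a_def A_def by blast
qed

section \<open>Choice of the parameters and conclusion\<close>

lemma gap_of_shifted_gap:
  fixes w X Y Z :: real
  assumes "w * (X + Y) < (X - Y) * (X - Z)" "0 \<le> Y" "Y \<le> X" "0 < X" "0 \<le> Z"
  shows "w < X - Y"
proof -
  have "(X - Y) * (X - Z) \<le> (X - Y) * (X + Y)" using assms by (intro mult_left_mono) auto
  then have "w * (X + Y) < (X - Y) * (X + Y)" using assms(1) by linarith
  then show ?thesis using assms by (simp add: mult_less_cancel_right)
qed

text \<open>The crossover is x1 = n - 4 - t, with t = 0 for n \<ge> 3k+3 and t = s div 4 near 2k.
  The subtraction of 2 in \<open>w\<close> matches the \<open>+ 2\<close> of the bound.\<close>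

lemma single_avoiding_set_in_range:
  assumes F: "\<F> \<subseteq> {S. S \<subseteq> {1..n} \<and> card S = k}" and ai: "almost_intersecting \<F>" and k4: "4 \<le> k"
    and size: "((n - 1) choose (k - 1)) + 2 \<le> card \<F> + ((n - k - 1) choose (k - 1))"
    and range: "3 * k + 3 \<le> n \<or> (k \<ge> 10 \<and> real n > 2 * real k + 2 * sqrt (real k) + 4)"
  shows "\<exists>x\<in>{1..n}. card {S\<in>\<F>. x \<notin> S} = 1"
proof -
  define M where "M = (2 * k - 1) choose (k - 1)"
  define f1 where "f1 = (n - k - 1) choose (k - 1)"
  define w where "w = f1 + M - 2"
  have "2 * real k \<le> real n"
    using range k4 real_sqrt_ge_zero[of "real k"] by linarith
  then have n2k: "2 * k \<le> n" by linarith
  have pos: "1 \<le> M" "1 \<le> f1" unfolding M_def f1_def using n2k k4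
    by (simp_all add: Suc_le_eq)
  have w_eq: "w + 2 = f1 + M" unfolding w_def using pos by linarith
  have \<kappa>: "2 < 2 + 1 / real (k - 2)" using k4 by simp
  have main: ?thesis
    if t: "k - 1 \<le> (t + 1) * (n - 2 * k)" "n - 1 - k \<le> n - 4 - t" "t + 4 \<le> n"
      and mid: "w + ((n - 4 - t) choose (n - 1 - k)) < (n - 4 - t) choose (k - 1)"
      and few: "2 * k + 1 \<le> n - 4"
      and gap: "(k = 4 \<and> 15 \<le> n) \<or>
        real w * (real ((n - 3) choose (k - 1)) + real ((n - 3) choose (k - 2))) <
        (real ((n - 3) choose (k - 1)) - real ((n - 3) choose (k - 2))) *
        (real ((n - 3) choose (k - 1)) - real ((n - 3) choose (k - 3)))" for t
  proof (rule single_avoiding_set[OF F ai k4 n2k size t(2) _ w_eq[unfolded f1_def M_def] \<kappa> _ mid half_binomial_le[OF k4 few] gap])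
    show "n - 4 - t \<le> n - 3" by simp
    fix x assume "n - 1 - k \<le> x" "x \<le> n - 4 - t"
    then show "(2 + 1 / real (k - 2)) * real (x choose (n - 1 - k)) +
        (real ((n - k - 1) choose (k - 1)) - (2 + 1 / real (k - 2))) \<le> real (x choose (k - 1))"
      using slope_bound[OF k4 n2k t(1)] t(3) by simp
  qed
  show ?thesis
  proof (cases "3 * k + 3 \<le> n")
    case large: True
    show ?thesis
    proof (cases "k = 4")
      case True
      have n15: "15 \<le> n" using large True by simp
      have "(7::nat) choose 3 = 35" by (simp add: binomial_fact' fact_numeral)
      then have w: "w + 2 = ((n - 5) choose 3) + 35" using w_eq unfolding f1_def M_def True by simp
      have "w + ((n - 4) choose (n - 5)) < (n - 4) choose 3"
      proof -
        have "(n - 4) choose 3 = ((n - 5) choose 3) + ((n - 5) choose 2)"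
          using choose_pred_split[of "n - 4" 3] n15 by (simp add: numeral_eq_Suc)
        moreover have "(n - 4) choose (n - 5) = n - 4"
          using choose_complement[of 1 "n - 4" "n - 5"] n15 by simp
        \<comment> \<open>Equality at n = 15, where both sides are 45.\<close>
        moreover have "n + 30 \<le> (n - 5) choose 2"
        proof -
          obtain j where "n = 15 + j" using n15 le_Suc_ex by blast
          then show ?thesis unfolding choose_two by (simp add: algebra_simps)
        qed
        ultimately show ?thesis using w n15 by linarith
      qed
      then show ?thesis using n15 True by (intro main[of 0]) auto
    next
      case False
      then have k5: "5 \<le> k" using k4 by simp
      have R: "real w * ((real n - real k - 1) * (real n - real k)) <
        real ((n - 3) choose (k - 1)) * ((real n - 2 * real k) * (real n - 2 * real k + 1))"
      proof (cases "k = 5")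
        case True
        have "(9::nat) choose 4 = 126" by (simp add: binomial_fact' fact_numeral)
        then have "real w = real ((n - 6) choose 4) + 124" using w_eq unfolding f1_def M_def True by simp
        then show ?thesis using shifted_gap_five[of n] large unfolding True by (simp add: algebra_simps)
      next
        case False
        have "0 < (real n - real k - 1) * (real n - real k)" using large k4 by (intro mult_pos_pos) auto
        then have "real w * ((real n - real k - 1) * (real n - real k))
            < real (f1 + M) * ((real n - real k - 1) * (real n - real k))"
          using w_eq by (intro mult_strict_right_mono) auto
        also have "\<dots> \<le> real ((n - 3) choose (k - 1)) * ((real n - 2 * real k) * (real n - 2 * real k + 1))"
          unfolding f1_def M_def using False k5 by (intro shifted_gap_ge_six[OF _ large]) simp
        finally show ?thesis .
      qed
      have gap: "real w * (real ((n - 3) choose (k - 1)) + real ((n - 3) choose (k - 2))) <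
        (real ((n - 3) choose (k - 1)) - real ((n - 3) choose (k - 2))) *
        (real ((n - 3) choose (k - 1)) - real ((n - 3) choose (k - 3)))"
        using k4 by (intro shifted_gap_criterion[OF _ n2k R]) simp
      have "(n - 3) choose (k - 2) \<le> (n - 3) choose (k - 1)" using k4 n2k large by (intro binomial_le_of_sum_le) auto
      then have "real w < real ((n - 3) choose (k - 1)) - real ((n - 3) choose (k - 2))"
        using k4 n2k large by (intro gap_of_shifted_gap[OF gap]) auto
      \<comment> \<open>C(x, k-1) - C(x, n-1-k) does not change from n-4 to n-3, so the gap at n-3
        carries over to x1 = n-4.\<close>
      moreover have "((n - 3) choose (n - 1 - k)) + ((n - 4) choose (k - 1)) \<ge>
          ((n - 3) choose (k - 1)) + ((n - 4) choose (n - 1 - k))"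
      proof -
        have e: "n - 3 - 1 = n - 4" "k - 1 - 1 = k - 2" "n - 1 - k - 1 = n - 2 - k" using large by auto
        have 1: "(n - 3) choose (k - 1) = ((n - 4) choose (k - 1)) + ((n - 4) choose (k - 2))"
          using choose_pred_split[of "n - 3" "k - 1"] k4 large unfolding e by simp
        have 2: "(n - 3) choose (n - 1 - k) = ((n - 4) choose (n - 1 - k)) + ((n - 4) choose (n - 2 - k))"
          using choose_pred_split[of "n - 3" "n - 1 - k"] k4 large unfolding e by simp
        have "(n - 4) choose (n - 2 - k) = (n - 4) choose (k - 2)" using k4 large by (intro choose_complement) auto
        then show ?thesis using 1 2 by simp
      qed
      moreover have "(n - 3) choose (n - 1 - k) = (n - 3) choose (k - 2)" using k4 large by (intro choose_complement) auto
      ultimately have "w + ((n - 4) choose (n - 1 - k)) < (n - 4) choose (k - 1)" by linarith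
      moreover have "k - 1 \<le> n - 2 * k" "n - 1 - k \<le> n - 4" "4 \<le> n" "2 * k + 1 \<le> n - 4"
        using k4 large by linarith+
      ultimately show ?thesis using gap by (intro main[of 0]) simp_all
    qed
  next
    case small: False
    then have k10: "10 \<le> k" and nr: "2 * real k + 2 * sqrt (real k) + 4 < real n" using range by auto
    have "0 \<le> sqrt (real k)" by simp
    then have "2 * k + 4 \<le> n" using nr by linarith
    then obtain s where n: "n = 2 * k + s + 4" by (metis add.assoc add.commute le_Suc_ex)
    have "2 * sqrt (real k) < real s" using nr n by simp
    then have "(2 * sqrt (real k)) * (2 * sqrt (real k)) < real s * real s"
      by (intro mult_strict_mono') auto
    then have "4 * real k < real s * real s" by simp
    then have s: "4 * k < s * s" by (metis of_nat_less_iff of_nat_mult of_nat_numeral)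
    have sk: "s + 2 \<le> k" using small n by linarith
    note N = near_double_gaps[OF k10 s sk n]
    have "0 < (real n - real k - 1) * (real n - real k)" using n k4 by (intro mult_pos_pos) auto
    then have "real w * ((real n - real k - 1) * (real n - real k))
        < real (f1 + M) * ((real n - real k - 1) * (real n - real k))"
      using w_eq by (intro mult_strict_right_mono) auto
    then have R: "real w * ((real n - real k - 1) * (real n - real k)) <
        real ((n - 3) choose (k - 1)) * ((real n - 2 * real k) * (real n - 2 * real k + 1))"
      using N(2) unfolding f1_def M_def by linarith
    have k3: "3 \<le> k" using k4 by simp
    have mid: "w + ((n - 4 - s div 4) choose (n - 1 - k)) < (n - 4 - s div 4) choose (k - 1)"
      using N(4) w_eq unfolding f1_def M_def by linarith
    have "s div 4 \<le> s" by simp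
    then have "n - 1 - k \<le> n - 4 - s div 4" "s div 4 + 4 \<le> n" "2 * k + 1 \<le> n - 4"
      using n sk N(1) by linarith+
    then show ?thesis using main[OF N(3) _ _ mid] shifted_gap_criterion[OF k3 n2k R] by blast
  qed
qed

theorem theorem1p6:
  fixes n k :: nat and \<F> :: "nat set set"
  assumes "k \<ge> 3"
    and "\<F> \<subseteq> ksubsets n k"
    and "almost_intersecting \<F>"
    and "(k = 3 \<and> n \<ge> 13) \<or> (k \<ge> 4 \<and> n \<ge> 3 * k + 3) \<or>
         (k \<ge> 10 \<and> real n > 2 * real k + 2 * sqrt (real k) + 4)"
  shows "int (card \<F>) \<le>
           int ((n - 1) choose (k - 1)) - int ((n - k - 1) choose (k - 1)) + 2 \<and>
         (int (card \<F>) =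
            int ((n - 1) choose (k - 1)) - int ((n - k - 1) choose (k - 1)) + 2 \<longrightarrow>
          (\<forall>B. admissible_extra n k B \<longrightarrow> isomorphic_families n \<F> (B_plus n k B)))"
proof (cases "int (card \<F>) < int ((n - 1) choose (k - 1)) - int ((n - k - 1) choose (k - 1)) + 2")
  case True then show ?thesis by simp
next
  case False
  then have size: "((n - 1) choose (k - 1)) + 2 \<le> card \<F> + ((n - k - 1) choose (k - 1))" by linarith
  have F: "\<F> \<subseteq> {S. S \<subseteq> {1..n} \<and> card S = k}" using assms(2) unfolding ksubsets_def .
  have "\<exists>x\<in>{1..n}. card {S\<in>\<F>. x \<notin> S} = 1"
  proof (cases "k = 3")
    case True
    then have n: "13 \<le> n" using assms(4) by auto
    then obtain j where j: "n = 13 + j" using le_Suc_ex by blast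
    have "(n - 1) choose 2 = ((n - 4) choose 2) + (3 * n - 9)"
      unfolding choose_two j by (simp add: algebra_simps)
    \<comment> \<open>For k = 3 the claimed bound is 3n - 7.\<close>
    then have "3 * n \<le> card \<F> + 7" using size n unfolding True by simp
    then show ?thesis using three_single_avoiding_set[OF _ assms(3) n] F unfolding True by simp
  next
    case False
    then show ?thesis using single_avoiding_set_in_range[OF F assms(3) _ size] assms(1,4) by fastforce
  qed
  then obtain x where "x \<in> {1..n}" "card {S\<in>\<F>. x \<notin> S} = 1" by blast
  then show ?thesis using single_avoiding_structure[OF assms(2,3)] assms(1) by simp
qed

end
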